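(* Let $x_{t+1}=f(x_t,u_t)$, the observables $\varphi$, the unquantized data matrices $\Phi,\Phi^+,U$, the dither-quantized data matrices $\bar\Phi,\bar\Phi^+,\bar U$ (quantization resolution $\epsilon$), and the quantized least-squares estimate $[\tilde A,\tilde B]$ (depending on $T$) be as defined in the context, and suppose Assumptions 1--4 of the context hold. Then there are matrix-valued functions $\beta(\epsilon)\in\mathbb{R}^{(N+m)\times N}$ and $\Gamma(\epsilon)\in\mathbb{R}^{(N+m)\times(N+m)}$ (not depending on $\mathcal{A},\mathcal{B}$, $T$ or the dither realization), both $O(\epsilon^2)$ as $\epsilon\to0$, such that, as $T\to\infty$, $[\tilde A,\tilde B]$ converges almost surely to the solution of the regularized least-squares problem $$\min_{\mathcal{A}\in\mathbb{R}^{N\times N},\ \mathcal{B}\in\mathbb{R}^{N\times m}}\ \limsup_{T\to\infty}\frac1T\|\Phi^+-\mathcal{A}\Phi-\mathcal{B}U\|^2+\operatorname{tr}(\mathcal{G}\beta(\epsilon))+\operatorname{tr}(\mathcal{G}^\top\mathcal{G}\,\Gamma(\epsilon)),\qquad \mathcal{G}=[\mathcal{A},\mathcal{B}].$$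
   Context: Setting. $\mathcal{M}\subset\mathbb{R}^n$ is a compact manifold, $\mathcal{U}\subset\mathbb{R}^m$ the set of admissible controls, and $x_{t+1}=f(x_t,u_t)$ with $x_t\in\mathcal{M}$, $u_t\in\mathcal{U}$, $t=0,1,2,\dots$, $f:\mathcal{M}\times\mathcal{U}\to\mathcal{M}$. The sequences $(x_t),(u_t)$ are fixed (non-random). The observables are $\varphi=[\varphi^1,\dots,\varphi^N]^\top$, real-valued functions on $\mathbb{R}^n$. $\|\cdot\|$ is the Euclidean norm for vectors and the Frobenius norm for matrices. Data matrices: $\Phi=[\varphi(x_0)\ \cdots\ \varphi(x_{T-1})]$, $\Phi^+=[\varphi(x_1)\ \cdots\ \varphi(x_T)]$, $U=[u_0\ \cdots\ u_{T-1}]$. Dither quantization. The uniform mid-point quantizer with range $(y_{\min},y_{\max})$, word-length $b$ and resolution $\epsilon=(y_{\max}-y_{\min})/2^b$ is $\mathcal{Q}(y)=\epsilon\lfloor (y-y_{\min})/\epsilon\rfloor+y_{\min}+\epsilon/2$; all quantized quantities are assumed to lie in the range (no saturation). It is applied componentwise. The decoded quantized data are $\tilde x_t=\mathcal{Q}(x_t+w^x_t)-w^x_t$ and $\tilde u_t=\mathcal{Q}(u_t+w^u_t)-w^u_t$, where all components of all dither vectors $w^x_t,w^u_t$ (over all $t$) are mutually independent and uniformly distributed on $[-\epsilon/2,\epsilon/2]$. Consequently the components of the errors $e^x_t=\tilde x_t-x_t$, $e^u_t=\tilde u_t-u_t$ are independent and uniform on $[-\epsilon/2,\epsilon/2]$.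 Quantized data matrices: $\bar\Phi=[\varphi(\tilde x_0)\ \cdots\ \varphi(\tilde x_{T-1})]$, $\bar\Phi^+=[\varphi(\tilde x_1)\ \cdots\ \varphi(\tilde x_T)]$, $\bar U=[\tilde u_0\ \cdots\ \tilde u_{T-1}]$. The quantized estimate is $[\tilde A,\tilde B]=\arg\min_{\mathcal{A}\in\mathbb{R}^{N\times N},\mathcal{B}\in\mathbb{R}^{N\times m}}\frac1T\|\bar\Phi^+-\mathcal{A}\bar\Phi-\mathcal{B}\bar U\|^2$. For given $(\mathcal{A},\mathcal{B})$ the one-step residual is $r(x',x,u)=\|\varphi(x')-\mathcal{A}\varphi(x)-\mathcal{B}u\|^2$. Assumption 1: the observables are bounded (for each $i$ there are $\ell_i<h_i$ with $\ell_i\le\varphi^i(x)\le h_i$ for all $x\in\mathbb{R}^n$) and the inputs $u_t$ are bounded uniformly in $t$. Assumption 2: there exist $\mathbb{A}\subseteq\mathbb{R}^{N\times N}$, $\mathbb{B}\subseteq\mathbb{R}^{N\times m}$ and $c_r>0$ such that $r(x_{t+1},x_t,u_t)<c_r$ for all $t$ whenever $\mathcal{A}\in\mathbb{A}$, $\mathcal{B}\in\mathbb{B}$; $\mathbb{A}\times\mathbb{B}$ is the set of $(\mathcal{A},\mathcal{B})$ for which $\lim_{T\to\infty}\frac1T\|\Phi^+-\mathcal{A}\Phi-\mathcal{B}U\|^2<\infty$. Assumption 3: for all $\mathcal{A}\in\mathbb{A}$, $\mathcal{B}\in\mathbb{B}$, $r(\cdot,\cdot,\cdot)$ has an absolutely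 convergent Taylor series on the region of $\mathcal{M}\times\mathcal{M}\times\mathcal{U}$ from which the data $x_t,u_t$ are collected, with radius of convergence greater than $\epsilon/2$. Assumption 4: there is $c_\varphi>0$ with $\|\nabla\varphi^i(x)\|\le c_\varphi$ for all $x\in\mathbb{R}^n$ and $i=1,\dots,N$.
   Formalization: Added hypothesis: for all (A,B) in Assumption 2's set the expected quantized cost converges as T→∞ (without it the claim is false). In Assumption 2 the limit exists for all (A,B) and c_r may depend on (A,B). Convergence is to the set of solutions. *)

theory Defs
  imports "HOL-Probability.Probability" "HOL-Library.Landau_Symbols"
begin

text \<open>A compact topological manifold (without boundary) in a Euclidean space: compact and, for some
  fixed dimension, locally homeomorphic to open subsets of a linear subspace of that dimension.\<close>

definition compact_manifold :: "'a::euclidean_space set \<Rightarrow> bool" where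
  "compact_manifold M \<longleftrightarrow> compact M \<and>
     (\<exists>d. \<forall>p\<in>M. \<exists>V S W. p \<in> V \<and> openin (top_of_set M) V \<and>
        subspace (S::'a set) \<and> dim S = d \<and> openin (top_of_set S) W \<and> V homeomorphic W)"

text \<open>A matrix with \<open>T\<close> columns, where \<open>T\<close> varies, is represented by its columns
  \<open>X 0, \<dots>, X (T - 1)\<close>.\<close>

definition frobenius_sq :: "nat \<Rightarrow> (nat \<Rightarrow> real^'k) \<Rightarrow> real" where
  "frobenius_sq T X = (\<Sum>t<T. \<Sum>i\<in>UNIV. (X t $ i)\<^sup>2)"

definition data_Phi :: "(real^'n \<Rightarrow> real^'N) \<Rightarrow> (nat \<Rightarrow> real^'n) \<Rightarrow> nat \<Rightarrow> real^'N" where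
  "data_Phi \<phi> x = (\<lambda>t. \<phi> (x t))"

definition data_Phi_plus :: "(real^'n \<Rightarrow> real^'N) \<Rightarrow> (nat \<Rightarrow> real^'n) \<Rightarrow> nat \<Rightarrow> real^'N" where
  "data_Phi_plus \<phi> x = (\<lambda>t. \<phi> (x (Suc t)))"

text \<open>The normalised least-squares cost \<open>(1/T) \<parallel>\<Phi>\<^sup>+ - A \<Phi> - B U\<parallel>\<^sup>2\<close>. It is applied both to the exact
  data and to the quantized data.\<close>

definition ls_cost ::
  "(real^'n \<Rightarrow> real^'N) \<Rightarrow> (nat \<Rightarrow> real^'n) \<Rightarrow> (nat \<Rightarrow> real^'m) \<Rightarrow> nat
     \<Rightarrow> real^'N^'N \<Rightarrow> real^'m^'N \<Rightarrow> real" where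
  "ls_cost \<phi> x u T A B =
     1 / real T * frobenius_sq T (\<lambda>t. data_Phi_plus \<phi> x t - A *v data_Phi \<phi> x t - B *v u t)"

definition residual ::
  "(real^'n \<Rightarrow> real^'N) \<Rightarrow> real^'N^'N \<Rightarrow> real^'m^'N \<Rightarrow> (real^'n) \<times> (real^'n) \<times> (real^'m) \<Rightarrow> real" where
  "residual \<phi> A B = (\<lambda>(x', x, u). (norm (\<phi> x' - A *v \<phi> x - B *v u))\<^sup>2)"

definition resolution :: "real \<Rightarrow> real \<Rightarrow> nat \<Rightarrow> real" where
  "resolution ymin ymax b = (ymax - ymin) / 2 ^ b"

definition quantizer :: "real \<Rightarrow> real \<Rightarrow> nat \<Rightarrow> real \<Rightarrow> real" where
  "quantizer ymin ymax b y =
     (let \<epsilon> = resolution ymin ymax b in \<epsilon> * of_int \<lfloor>(y - ymin) / \<epsilon>\<rfloor> + ymin + \<epsilon> / 2)"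

definition dither_quantize :: "real \<Rightarrow> real \<Rightarrow> nat \<Rightarrow> real^'k \<Rightarrow> real^'k \<Rightarrow> real^'k" where
  "dither_quantize ymin ymax b w v = (\<chi> i. quantizer ymin ymax b ((v + w) $ i)) - w"

text \<open>The scalar dither components, over all times and all state and input coordinates, form one
  mutually independent family.\<close>

definition dither ::
  "'w measure \<Rightarrow> real \<Rightarrow> (nat \<Rightarrow> 'w \<Rightarrow> real^'n) \<Rightarrow> (nat \<Rightarrow> 'w \<Rightarrow> real^'m) \<Rightarrow> bool" where
  "dither P \<epsilon> wx wu \<longleftrightarrow>
     prob_space.indep_vars P (\<lambda>_. borel)
       (\<lambda>(t, k) \<omega>. case k of Inl i \<Rightarrow> wx t \<omega> $ i | Inr j \<Rightarrow> wu t \<omega> $ j)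
       (UNIV :: (nat \<times> ('n + 'm)) set) \<and>
     (\<forall>t i. distr P borel (\<lambda>\<omega>. wx t \<omega> $ i) = uniform_measure lborel {- \<epsilon> / 2 .. \<epsilon> / 2}) \<and>
     (\<forall>t j. distr P borel (\<lambda>\<omega>. wu t \<omega> $ j) = uniform_measure lborel {- \<epsilon> / 2 .. \<epsilon> / 2})"

definition no_saturation ::
  "'w measure \<Rightarrow> real \<Rightarrow> real \<Rightarrow> (nat \<Rightarrow> real^'k) \<Rightarrow> (nat \<Rightarrow> 'w \<Rightarrow> real^'k) \<Rightarrow> bool" where
  "no_saturation P ymin ymax y w \<longleftrightarrow>
     (\<forall>t i. AE \<omega> in P. (y t + w t \<omega>) $ i \<in> {ymin<..<ymax})"

definition partial_deriv :: "'a::euclidean_space \<Rightarrow> ('a \<Rightarrow> real) \<Rightarrow> 'a \<Rightarrow> real" where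
  "partial_deriv b g p = deriv (\<lambda>s. g (p + s *\<^sub>R b)) 0"

text \<open>The multivariate Taylor series
  \<open>g (p + h) = (\<Sum>k. 1/k! (\<Sum>b1,\<dots>,bk. \<partial>b1 \<dots> \<partial>bk g(p) (h \<bullet> b1) \<dots> (h \<bullet> bk)))\<close>, indexed by the finite
  sequences \<open>[b1,\<dots>,bk]\<close> of coordinate directions.\<close>

definition taylor_term :: "('a::euclidean_space \<Rightarrow> real) \<Rightarrow> 'a \<Rightarrow> 'a \<Rightarrow> 'a list \<Rightarrow> real" where
  "taylor_term g p h bs =
     foldr partial_deriv bs g p / fact (length bs) * (\<Prod>b\<leftarrow>bs. h \<bullet> b)"

text \<open>The radius of convergence is measured per coordinate (polydisc), matching componentwise
  quantization errors.\<close>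

definition taylor_radius_gt :: "('a::euclidean_space \<Rightarrow> real) \<Rightarrow> 'a \<Rightarrow> real \<Rightarrow> bool" where
  "taylor_radius_gt g p \<rho> \<longleftrightarrow>
     (\<exists>R>\<rho>. \<forall>h. (\<forall>b\<in>Basis. \<bar>h \<bullet> b\<bar> < R) \<longrightarrow>
        (\<lambda>bs. \<bar>taylor_term g p h bs\<bar>) summable_on lists Basis \<and>
        g (p + h) = infsum (taylor_term g p h) (lists Basis))"

definition assumption1 :: "(real^'n \<Rightarrow> real^'N) \<Rightarrow> (nat \<Rightarrow> real^'m) \<Rightarrow> bool" where
  "assumption1 \<phi> u \<longleftrightarrow>
     (\<forall>i. \<exists>l h. l < h \<and> (\<forall>x. l \<le> \<phi> x $ i \<and> \<phi> x $ i \<le> h)) \<and> bounded (range u)"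

text \<open>Writing \<open>lim \<dots> < \<infinity>\<close> presupposes that the limit exists in \<open>[0, \<infinity>]\<close>; this is the second conjunct.
  The residual bound may depend on \<open>(A, B)\<close>: a bound uniform over the whole set of the third conjunct
  would, together with boundedness of the observables and inputs, force
  \<open>\<phi> (x t) = 0\<close> and \<open>u t = 0\<close> for all \<open>t\<close>.\<close>

definition assumption2 ::
  "(real^'n \<Rightarrow> real^'N) \<Rightarrow> (nat \<Rightarrow> real^'n) \<Rightarrow> (nat \<Rightarrow> real^'m)
     \<Rightarrow> (real^'N^'N) set \<Rightarrow> (real^'m^'N) set \<Rightarrow> bool" where
  "assumption2 \<phi> x u \<AA> \<BB> \<longleftrightarrow>
     (\<forall>A\<in>\<AA>. \<forall>B\<in>\<BB>. \<exists>c>0. \<forall>t. residual \<phi> A B (x (Suc t), x t, u t) < c) \<and>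
     (\<forall>A B. \<exists>L. (\<lambda>T. ereal (ls_cost \<phi> x u T A B)) \<longlonglongrightarrow> L) \<and>
     \<AA> \<times> \<BB> = {(A, B). lim (\<lambda>T. ereal (ls_cost \<phi> x u T A B)) < \<infinity>}"

definition assumption3 ::
  "(real^'n \<Rightarrow> real^'N) \<Rightarrow> (real^'n) set \<Rightarrow> (real^'m) set \<Rightarrow> (nat \<Rightarrow> real^'n) \<Rightarrow> (nat \<Rightarrow> real^'m)
     \<Rightarrow> (real^'N^'N) set \<Rightarrow> (real^'m^'N) set \<Rightarrow> real \<Rightarrow> bool" where
  "assumption3 \<phi> M \<U> x u \<AA> \<BB> \<epsilon> \<longleftrightarrow>
     (\<exists>D \<subseteq> M \<times> M \<times> \<U>. (\<forall>t. (x (Suc t), x t, u t) \<in> D) \<and>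
        (\<forall>A\<in>\<AA>. \<forall>B\<in>\<BB>. \<forall>p\<in>D. taylor_radius_gt (residual \<phi> A B) p (\<epsilon> / 2)))"

definition assumption4 :: "(real^'n \<Rightarrow> real^'N) \<Rightarrow> bool" where
  "assumption4 \<phi> \<longleftrightarrow>
     (\<exists>c>0. \<forall>i x. \<exists>D. (GDERIV (\<lambda>y. \<phi> y $ i) x :> D) \<and> norm D \<le> c)"

text \<open>Existence of the limiting expected cost of the quantized data, the quantized counterpart of the
  limit in \<^const>\<open>assumption2\<close>. It does not follow from the other assumptions, and without it the
  quantized estimates need not converge: let the state switch, at sparse times and through the input,
  between two points at which an observable has the same value but different slopes.\<close>

definition expected_ls_cost_convergent ::
  "'w measure \<Rightarrow> (real^'n \<Rightarrow> real^'N) \<Rightarrow> (nat \<Rightarrow> 'w \<Rightarrow> real^'n) \<Rightarrow> (nat \<Rightarrow> 'w \<Rightarrow> real^'m)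
     \<Rightarrow> (real^'N^'N) set \<Rightarrow> (real^'m^'N) set \<Rightarrow> bool" where
  "expected_ls_cost_convergent P \<phi> xq uq \<AA> \<BB> \<longleftrightarrow>
     (\<forall>A\<in>\<AA>. \<forall>B\<in>\<BB>.
        convergent (\<lambda>T. \<integral>\<omega>. ls_cost \<phi> (\<lambda>t. xq t \<omega>) (\<lambda>t. uq t \<omega>) T A B \<partial>P))"

definition block_row :: "real^'N^'N \<Rightarrow> real^'m^'N \<Rightarrow> real^('N + 'm)^'N" where
  "block_row A B = (\<chi> i j. case j of Inl k \<Rightarrow> A $ i $ k | Inr k \<Rightarrow> B $ i $ k)"

definition regularized_objective ::
  "(real^'n \<Rightarrow> real^'N) \<Rightarrow> (nat \<Rightarrow> real^'n) \<Rightarrow> (nat \<Rightarrow> real^'m)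
     \<Rightarrow> real^'N^('N + 'm) \<Rightarrow> real^('N + 'm)^('N + 'm)
     \<Rightarrow> (real^'N^'N) \<times> (real^'m^'N) \<Rightarrow> ereal" where
  "regularized_objective \<phi> x u \<beta> \<Gamma> = (\<lambda>(A, B).
     limsup (\<lambda>T. ereal (ls_cost \<phi> x u T A B)) +
     ereal (trace (block_row A B ** \<beta>)) +
     ereal (trace (transpose (block_row A B) ** block_row A B ** \<Gamma>)))"

definition minimizers :: "('a \<Rightarrow> 'b::order) \<Rightarrow> 'a set" where
  "minimizers F = {z. is_arg_min F (\<lambda>_. True) z}"

end

theory Submission
  imports Defs "HOL-Complex_Analysis.Conformal_Mappings"
begin

text \<open>
  For a uniform dither the quantization error of every component is again uniform, so the quantized data
  point at time \<open>t\<close> is \<open>p t + e\<close> with \<open>p t = (x (Suc t), x t, u t)\<close> and noise \<open>e\<close> whose law depends on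
  \<open>\<epsilon>\<close> only. By a strong law for bounded, one-dependent variables (Hoeffding and Borel-Cantelli) the
  quantized cost converges almost surely to the limiting average of the expected residuals. Expected
  and exact residuals differ by a quadratic polynomial in \<open>\<G> = [A, B]\<close>, whose coefficients are limiting
  averages of the biases of the entries of the Gram matrices; they form \<open>\<beta>\<close> and \<open>\<Gamma>\<close>. The noise being
  symmetric, each bias is a mean of second differences, which are \<open>O(\<epsilon>\<^sup>2)\<close> uniformly in \<open>t\<close> by analyticity
  and compactness.

  The limiting quadratic form may be degenerate, and then minimizers of the finite-sample costs could in
  principle drift away. Analyticity excludes this: if \<open>A \<phi>(x) + B u\<close> vanishes in the mean-square limit,
  it vanishes identically on the noise boxes at all times outside a set of density zero, by the
  identity theorem.
\<close>

section \<open>Power series on boxes\<close>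

text \<open>Bounded observables and inputs keep every cost bounded, so
  \<open>\<AA> \<times> \<BB>\<close> turns out to be the set of all pairs. Whatever is assumed
  about residuals thus holds for all \<open>(A, B)\<close>, and polarization passes it on to the
  separate products of entries of targets and regressors. Being finitely many, these products also
  allow a single null set for the uncountably many costs. The bias of the squared target does not
  involve \<open>(A, B)\<close>: it shifts the objective and leaves the minimizers alone. Minimizers
  may fail to be unique, and estimates may be unbounded along the kernel of the limiting quadratic
  form. Convergence is therefore measured by the distance to the solution set, and the kernel
  component of an estimate is never bounded but matched by a minimizer with the same component. The
  Taylor expansions come with no uniformity in time. Where uniformity matters (second differences,
  sparse times), compactness of the closure of the data supplies it, and expansions are taken around
  data points only, since none is assumed at limit points.\<close>

definition box_expansion ::
  "('a::euclidean_space \<Rightarrow> real) \<Rightarrow> 'a \<Rightarrow> real \<Rightarrow> ('a list \<Rightarrow> real) \<Rightarrow> bool" where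
  "box_expansion g p R c \<longleftrightarrow> (\<forall>h. (\<forall>b\<in>Basis. \<bar>h \<bullet> b\<bar> < R) \<longrightarrow>
     (\<lambda>bs. \<bar>c bs * (\<Prod>b\<leftarrow>bs. h \<bullet> b)\<bar>) summable_on lists Basis \<and>
     g (p + h) = infsum (\<lambda>bs. c bs * (\<Prod>b\<leftarrow>bs. h \<bullet> b)) (lists Basis))"

text \<open>Forgetting that the coefficients are iterated derivatives makes expansions trivially
  closed under sums and multiples, with no derivative of a sum to compute.\<close>

lemma box_expansion_of_taylor_radius:
  assumes "taylor_radius_gt g p \<rho>"
  obtains R c where "R > \<rho>" "box_expansion g p R c"
proof -
  from assms obtain R where R: "R > \<rho>" and *: "\<forall>h. (\<forall>b\<in>Basis. \<bar>h \<bullet> b\<bar> < R) \<longrightarrow>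
        (\<lambda>bs. \<bar>taylor_term g p h bs\<bar>) summable_on lists Basis \<and>
        g (p + h) = infsum (taylor_term g p h) (lists Basis)"
    unfolding taylor_radius_gt_def by blast
  have t: "taylor_term g p h = (\<lambda>bs. foldr partial_deriv bs g p / fact (length bs) * (\<Prod>b\<leftarrow>bs. h \<bullet> b))" for h
    by (rule ext) (simp add: taylor_term_def)
  have "box_expansion g p R (\<lambda>bs. foldr partial_deriv bs g p / fact (length bs))"
    unfolding box_expansion_def using *[unfolded t] by blast
  with R show thesis by (rule that)
qed

lemma box_expansion_mono: "box_expansion g p R c \<Longrightarrow> R' \<le> R \<Longrightarrow> box_expansion g p R' c"
  unfolding box_expansion_def by (meson less_le_trans)

lemma abs_summable_real: "(\<lambda>i. \<bar>f i\<bar>) summable_on I \<Longrightarrow> (f :: _ \<Rightarrow> real) summable_on I"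
  using abs_summable_summable[of f I] by simp

lemma box_expansion_add:
  fixes p :: "'a::euclidean_space"
  assumes "box_expansion g p R c" "box_expansion g' p R c'"
  shows "box_expansion (\<lambda>q. g q + g' q) p R (\<lambda>bs. c bs + c' bs)"
  unfolding box_expansion_def
proof (intro allI impI)
  fix h :: 'a assume h: "\<forall>b\<in>Basis. \<bar>h \<bullet> b\<bar> < R"
  let ?m = "\<lambda>bs. \<Prod>b\<leftarrow>bs. h \<bullet> b"
  have 1: "(\<lambda>bs. \<bar>c bs * ?m bs\<bar>) summable_on lists Basis" "g (p + h) = infsum (\<lambda>bs. c bs * ?m bs) (lists Basis)"
    and 2: "(\<lambda>bs. \<bar>c' bs * ?m bs\<bar>) summable_on lists Basis" "g' (p + h) = infsum (\<lambda>bs. c' bs * ?m bs) (lists Basis)"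
    using assms h by (auto simp: box_expansion_def)
  have "(\<lambda>bs. \<bar>(c bs + c' bs) * ?m bs\<bar>) summable_on lists Basis"
    by (rule summable_on_comparison_test[OF summable_on_add[OF 1(1) 2(1)]])
       (auto simp: distrib_right abs_triangle_ineq)
  moreover have "g (p + h) + g' (p + h) = infsum (\<lambda>bs. (c bs + c' bs) * ?m bs) (lists Basis)"
    using infsum_add[OF abs_summable_real[OF 1(1)] abs_summable_real[OF 2(1)]] 1(2) 2(2)
    by (simp add: distrib_right)
  ultimately show "(\<lambda>bs. \<bar>(c bs + c' bs) * ?m bs\<bar>) summable_on lists Basis \<and>
     g (p + h) + g' (p + h) = infsum (\<lambda>bs. (c bs + c' bs) * ?m bs) (lists Basis)" by blast
qed

lemma box_expansion_scale:
  fixes p :: "'a::euclidean_space"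
  assumes "box_expansion g p R c"
  shows "box_expansion (\<lambda>q. k * g q) p R (\<lambda>bs. k * c bs)"
  unfolding box_expansion_def
proof (intro allI impI)
  fix h :: 'a assume h: "\<forall>b\<in>Basis. \<bar>h \<bullet> b\<bar> < R"
  let ?m = "\<lambda>bs. \<Prod>b\<leftarrow>bs. h \<bullet> b"
  have 1: "(\<lambda>bs. \<bar>c bs * ?m bs\<bar>) summable_on lists Basis" "g (p + h) = infsum (\<lambda>bs. c bs * ?m bs) (lists Basis)"
    using assms h by (auto simp: box_expansion_def)
  have "(\<lambda>bs. \<bar>k * c bs * ?m bs\<bar>) summable_on lists Basis"
    using summable_on_cmult_right[OF 1(1), of "\<bar>k\<bar>"] by (simp add: abs_mult mult.assoc)
  moreover have "k * g (p + h) = infsum (\<lambda>bs. k * c bs * ?m bs) (lists Basis)"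
    using infsum_cmult_right[OF abs_summable_real[OF 1(1)], of k] 1(2) by (simp add: mult.assoc)
  ultimately show "(\<lambda>bs. \<bar>k * c bs * ?m bs\<bar>) summable_on lists Basis \<and>
     k * g (p + h) = infsum (\<lambda>bs. k * c bs * ?m bs) (lists Basis)" by blast
qed

text \<open>At the corner of the box with all coordinates equal to \<open>r\<close>, the monomial of
  a list is \<open>r\<close> to its length. Absolute convergence at this one point controls the
  series at all points of the smaller box, real or complex.\<close>

lemma box_expansion_majorant:
  assumes "box_expansion g p R (c :: 'a::euclidean_space list \<Rightarrow> real)" "0 < r" "r < R"
  shows "(\<lambda>bs. \<bar>c bs\<bar> * r ^ length bs) summable_on lists Basis"
proof -
  let ?h = "\<Sum>b\<in>Basis. r *\<^sub>R b :: 'a"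
  have h: "?h \<bullet> b = r" if "b \<in> Basis" for b
    using that by (simp add: inner_sum_left inner_Basis if_distrib sum.delta cong: if_cong)
  have "(\<lambda>bs. \<bar>c bs * (\<Prod>b\<leftarrow>bs. ?h \<bullet> b)\<bar>) summable_on lists Basis"
    using assms h by (simp add: box_expansion_def)
  also have "?this \<longleftrightarrow> ?thesis"
  proof (rule summable_on_cong)
    fix bs :: "'a list" assume "bs \<in> lists Basis"
    then have "(\<Prod>b\<leftarrow>bs. ?h \<bullet> b) = r ^ length bs"
      by (induction bs) (auto simp: h)
    then show "\<bar>c bs * (\<Prod>b\<leftarrow>bs. ?h \<bullet> b)\<bar> = \<bar>c bs\<bar> * r ^ length bs"
      using assms by (simp add: abs_mult)
  qed
  finally show ?thesis .
qed

text \<open>Stated over a normed field because it serves both the real products of the next lemma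
  and the complexified ones of the identity theorem.\<close>

lemma norm_prod_list_le:
  fixes f :: "'a \<Rightarrow> 'b::real_normed_field"
  assumes "\<And>b. b \<in> set bs \<Longrightarrow> norm (f b) \<le> r"
  shows "norm (\<Prod>b\<leftarrow>bs. f b) \<le> r ^ length bs"
  using assms
proof (induction bs)
  case (Cons b bs)
  have "0 \<le> r" using Cons.prems[of b] order_trans[OF norm_ge_zero[of "f b"]] by simp
  then have "norm (f b) * norm (\<Prod>b\<leftarrow>bs. f b) \<le> r * r ^ length bs"
    using Cons by (intro mult_mono) auto
  then show ?case by (simp add: norm_mult)
qed simp

text \<open>Both bounds are proved in one induction: the recursion of the second difference involves
  the first difference, and that of the first difference involves the plain size of the products.
  Splitting \<open>r\<close> into halves for \<open>d\<close> and \<open>h\<close> is what keeps the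
  constants 2 independent of the length, as each step contributes
  \<open>r / 2 + r / 2 = r\<close>.\<close>

lemma prod_list_second_difference:
  fixes d h :: "'a \<Rightarrow> real"
  assumes r: "0 < r" and \<tau>: "0 \<le> \<tau>" "\<tau> \<le> 1"
    and d: "\<And>b. b \<in> set bs \<Longrightarrow> \<bar>d b\<bar> \<le> r / 2"
    and h: "\<And>b. b \<in> set bs \<Longrightarrow> \<bar>h b\<bar> \<le> \<tau> * r / 2"
  shows "\<bar>(\<Prod>b\<leftarrow>bs. d b + h b) - (\<Prod>b\<leftarrow>bs. d b - h b)\<bar> \<le> 2 * \<tau> * r ^ length bs"
    and "\<bar>(\<Prod>b\<leftarrow>bs. d b + h b) + (\<Prod>b\<leftarrow>bs. d b - h b) - 2 * (\<Prod>b\<leftarrow>bs. d b)\<bar> \<le> 2 * \<tau>\<^sup>2 * r ^ length bs"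
proof -
  have "\<bar>(\<Prod>b\<leftarrow>bs. d b + h b) - (\<Prod>b\<leftarrow>bs. d b - h b)\<bar> \<le> 2 * \<tau> * r ^ length bs \<and>
    \<bar>(\<Prod>b\<leftarrow>bs. d b + h b) + (\<Prod>b\<leftarrow>bs. d b - h b) - 2 * (\<Prod>b\<leftarrow>bs. d b)\<bar> \<le> 2 * \<tau>\<^sup>2 * r ^ length bs"
    using d h
  proof (induction bs)
    case Nil
    then show ?case using \<tau> by simp
  next
    case (Cons b bs)
    let ?X = "\<Prod>b\<leftarrow>bs. d b + h b" and ?Y = "\<Prod>b\<leftarrow>bs. d b - h b" and ?Z = "\<Prod>b\<leftarrow>bs. d b"
    let ?k = "r ^ length bs"
    have hr: "\<bar>h b'\<bar> \<le> r / 2" if "b' \<in> set (b # bs)" for b'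
    proof -
      have "\<tau> * r \<le> 1 * r" using \<tau> r by (intro mult_right_mono) auto
      then show ?thesis using Cons.prems(2)[OF that] by linarith
    qed
    have "\<bar>d b' + h b'\<bar> \<le> r" if "b' \<in> set bs" for b'
      using Cons.prems(1)[of b'] hr[of b'] that by auto
    then have X: "\<bar>?X\<bar> \<le> ?k"
      using norm_prod_list_le[of bs "\<lambda>b. d b + h b" r] by simp
    have "\<bar>d b' - h b'\<bar> \<le> r" if "b' \<in> set bs" for b'
      using Cons.prems(1)[of b'] hr[of b'] that by auto
    then have Y: "\<bar>?Y\<bar> \<le> ?k"
      using norm_prod_list_le[of bs "\<lambda>b. d b - h b" r] by simp
    have IH: "\<bar>?X - ?Y\<bar> \<le> 2 * \<tau> * ?k" "\<bar>?X + ?Y - 2 * ?Z\<bar> \<le> 2 * \<tau>\<^sup>2 * ?k"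
      using Cons by auto
    have db: "\<bar>d b\<bar> \<le> r / 2" and hb: "\<bar>h b\<bar> \<le> \<tau> * r / 2" using Cons.prems by auto
    have eq: "(d b + h b) * ?X - (d b - h b) * ?Y = d b * (?X - ?Y) + h b * (?X + ?Y)"
      by (simp add: algebra_simps)
    have "\<bar>(d b + h b) * ?X - (d b - h b) * ?Y\<bar> \<le> \<bar>d b\<bar> * \<bar>?X - ?Y\<bar> + \<bar>h b\<bar> * \<bar>?X + ?Y\<bar>"
      unfolding eq by (rule order_trans[OF abs_triangle_ineq]) (simp add: abs_mult)
    also have "\<dots> \<le> (r / 2) * (2 * \<tau> * ?k) + (\<tau> * r / 2) * (2 * ?k)"
      using X Y IH db hb r \<tau> by (intro add_mono mult_mono) auto
    also have "\<dots> = 2 * \<tau> * (r * ?k)" by simp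
    finally have 1: "\<bar>(d b + h b) * ?X - (d b - h b) * ?Y\<bar> \<le> 2 * \<tau> * (r * ?k)" .
    have eq: "(d b + h b) * ?X + (d b - h b) * ?Y - 2 * (d b * ?Z) = d b * (?X + ?Y - 2 * ?Z) + h b * (?X - ?Y)"
      by (simp add: algebra_simps)
    have "\<bar>(d b + h b) * ?X + (d b - h b) * ?Y - 2 * (d b * ?Z)\<bar> \<le> \<bar>d b\<bar> * \<bar>?X + ?Y - 2 * ?Z\<bar> + \<bar>h b\<bar> * \<bar>?X - ?Y\<bar>"
      unfolding eq by (rule order_trans[OF abs_triangle_ineq]) (simp add: abs_mult)
    also have "\<dots> \<le> (r / 2) * (2 * \<tau>\<^sup>2 * ?k) + (\<tau> * r / 2) * (2 * \<tau> * ?k)"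
    proof (intro add_mono)
      show "\<bar>d b\<bar> * \<bar>?X + ?Y - 2 * ?Z\<bar> \<le> (r / 2) * (2 * \<tau>\<^sup>2 * ?k)"
        by (rule mult_mono[OF db IH(2)]) (use r in simp_all)
      show "\<bar>h b\<bar> * \<bar>?X - ?Y\<bar> \<le> (\<tau> * r / 2) * (2 * \<tau> * ?k)"
        by (rule mult_mono[OF hb IH(1)]) (use r \<tau> in simp_all)
    qed
    also have "\<dots> = 2 * \<tau>\<^sup>2 * (r * ?k)" by (simp only: power2_eq_square) (simp add: field_simps)
    finally show ?case using 1 by simp
  qed
  then show "\<bar>(\<Prod>b\<leftarrow>bs. d b + h b) - (\<Prod>b\<leftarrow>bs. d b - h b)\<bar> \<le> 2 * \<tau> * r ^ length bs"
    "\<bar>(\<Prod>b\<leftarrow>bs. d b + h b) + (\<Prod>b\<leftarrow>bs. d b - h b) - 2 * (\<Prod>b\<leftarrow>bs. d b)\<bar> \<le> 2 * \<tau>\<^sup>2 * r ^ length bs"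
    by auto
qed

text \<open>Holds term by term, summed against the majorant. The offset \<open>d\<close> separates
  the centre of expansion from the point of evaluation, so that one expansion can serve all nearby
  data points.\<close>

lemma box_expansion_second_difference:
  assumes g: "box_expansion g p R c" and r: "0 < r" "r < R" and \<tau>: "0 \<le> \<tau>" "\<tau> \<le> 1"
    and d: "\<And>b. b \<in> Basis \<Longrightarrow> \<bar>d \<bullet> b\<bar> \<le> r / 2"
    and h: "\<And>b. b \<in> Basis \<Longrightarrow> \<bar>h \<bullet> b\<bar> \<le> \<tau> * r / 2"
  shows "\<bar>g (p + d + h) + g (p + d - h) - 2 * g (p + d)\<bar>
           \<le> 2 * \<tau>\<^sup>2 * infsum (\<lambda>bs. \<bar>c bs\<bar> * r ^ length bs) (lists Basis)"
proof -
  let ?m = "\<lambda>v bs. c bs * (\<Prod>b\<leftarrow>bs. v \<bullet> b)"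
  have hr: "\<bar>h \<bullet> b\<bar> \<le> r / 2" if "b \<in> Basis" for b
  proof -
    have "\<tau> * r \<le> 1 * r" using \<tau> r by (intro mult_right_mono) auto
    then show ?thesis using h[OF that] by linarith
  qed
  have s: "(?m v has_sum g (p + v)) (lists Basis)"
    if "\<And>b. b \<in> Basis \<Longrightarrow> \<bar>v \<bullet> b\<bar> < R" for v
  proof -
    have "?m v summable_on lists Basis" "g (p + v) = infsum (?m v) (lists Basis)"
      using g that abs_summable_real[of "?m v" "lists Basis"] unfolding box_expansion_def by auto
    then show ?thesis by simp
  qed
  have bd: "\<bar>(d + h) \<bullet> b\<bar> < R" "\<bar>(d - h) \<bullet> b\<bar> < R" "\<bar>d \<bullet> b\<bar> < R" if "b \<in> Basis" for b
    using d[OF that] hr[OF that] r by (auto simp: inner_add_left inner_diff_left abs_if split: if_splits)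
  note s1 = s[of "d + h", OF bd(1)] and s2 = s[of "d - h", OF bd(2)] and s3 = s[of d, OF bd(3)]
  let ?D = "\<lambda>bs. c bs * ((\<Prod>b\<leftarrow>bs. d \<bullet> b + h \<bullet> b) + (\<Prod>b\<leftarrow>bs. d \<bullet> b - h \<bullet> b) - 2 * (\<Prod>b\<leftarrow>bs. d \<bullet> b))"
  have "((\<lambda>bs. ?m (d + h) bs + ?m (d - h) bs + (-2) * ?m d bs) has_sum
      g (p + (d + h)) + g (p + (d - h)) + (-2) * g (p + d)) (lists Basis)"
    by (intro has_sum_add has_sum_cmult_right s1 s2 s3)
  also have "(\<lambda>bs. ?m (d + h) bs + ?m (d - h) bs + (-2) * ?m d bs) = ?D"
    by (simp add: inner_add_left inner_diff_left algebra_simps)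
  finally have D: "(?D has_sum g (p + d + h) + g (p + d - h) - 2 * g (p + d)) (lists Basis)"
    by (simp add: add.assoc add_diff_eq)
  have S: "(\<lambda>bs. 2 * \<tau>\<^sup>2 * (\<bar>c bs\<bar> * r ^ length bs)) summable_on lists Basis"
    by (rule summable_on_cmult_right[OF box_expansion_majorant[OF g r]])
  have le: "\<bar>?D bs\<bar> \<le> 2 * \<tau>\<^sup>2 * (\<bar>c bs\<bar> * r ^ length bs)" if "bs \<in> lists Basis" for bs
  proof -
    have "\<bar>(\<Prod>b\<leftarrow>bs. d \<bullet> b + h \<bullet> b) + (\<Prod>b\<leftarrow>bs. d \<bullet> b - h \<bullet> b) - 2 * (\<Prod>b\<leftarrow>bs. d \<bullet> b)\<bar> \<le> 2 * \<tau>\<^sup>2 * r ^ length bs"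
      using that by (intro prod_list_second_difference r \<tau> d h) auto
    then have "\<bar>c bs\<bar> * \<bar>(\<Prod>b\<leftarrow>bs. d \<bullet> b + h \<bullet> b) + (\<Prod>b\<leftarrow>bs. d \<bullet> b - h \<bullet> b) - 2 * (\<Prod>b\<leftarrow>bs. d \<bullet> b)\<bar>
      \<le> \<bar>c bs\<bar> * (2 * \<tau>\<^sup>2 * r ^ length bs)" by (intro mult_left_mono) auto
    then show ?thesis by (simp add: abs_mult mult_ac)
  qed
  have "\<bar>infsum ?D (lists Basis)\<bar> \<le> infsum (\<lambda>bs. 2 * \<tau>\<^sup>2 * (\<bar>c bs\<bar> * r ^ length bs)) (lists Basis)"
    using norm_infsum_le[OF D has_sum_infsum[OF S]] le infsumI[OF D] by auto
  then show ?thesis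
    using infsumI[OF D] infsum_cmult_right'[of "2 * \<tau>\<^sup>2" "\<lambda>bs. \<bar>c bs\<bar> * r ^ length bs" "lists Basis"] by simp
qed

text \<open>Between two points of the box the expansion extends to a holomorphic function of the complexified
  segment parameter, so the one-variable identity theorem applies.\<close>

lemma box_expansion_identity:
  fixes p :: "'a::euclidean_space"
  assumes g: "box_expansion g p R c" and e: "0 < e"
    and d: "\<And>b. b \<in> Basis \<Longrightarrow> \<bar>d \<bullet> b\<bar> < R" and h: "\<And>b. b \<in> Basis \<Longrightarrow> \<bar>h \<bullet> b\<bar> < R"
    and zero: "\<And>q. norm (q - (p + d)) < e \<Longrightarrow> g q = 0"
  shows "g (p + h) = 0"
proof -
  \<comment> \<open>The largest coordinate modulus of the two end points. An \<open>r\<close>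
    strictly between \<open>m\<close> and \<open>R\<close> puts both ends inside the region where
    the majorant at \<open>r\<close> applies.\<close>
  define m where "m = Max ((\<lambda>b. max \<bar>d \<bullet> b\<bar> \<bar>h \<bullet> b\<bar>) ` Basis)"
  have mb: "\<bar>d \<bullet> b\<bar> \<le> m" "\<bar>h \<bullet> b\<bar> \<le> m" if "b \<in> Basis" for b
    using Max_ge[of "(\<lambda>b. max \<bar>d \<bullet> b\<bar> \<bar>h \<bullet> b\<bar>) ` Basis" "max \<bar>d \<bullet> b\<bar> \<bar>h \<bullet> b\<bar>"] that
    unfolding m_def by auto
  have "m < R" unfolding m_def using d h by (subst Max_less_iff) auto
  moreover have "0 \<le> m" using mb(1)[OF SOME_Basis] by (smt (verit))
  ultimately obtain r where r: "m < r" "r < R" "0 < r" using dense by (smt (verit))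
  \<comment> \<open>\<open>l b s\<close> is coordinate \<open>b\<close> of
    \<open>d + s (h - d)\<close> for complex \<open>s\<close>. Being affine in \<open>s\<close>, it
    makes \<open>S\<close> convex, hence connected, and \<open>S\<close> contains the real segment
    from 0 to 1.\<close>
  define l where "l = (\<lambda>b s. complex_of_real (d \<bullet> b) + s * complex_of_real ((h - d) \<bullet> b))"
  define S where "S = (\<Inter>b\<in>(Basis::'a set). {s. norm (l b s) < r})"
  define t where "t = (\<lambda>bs s. complex_of_real (c bs) * (\<Prod>b\<leftarrow>bs. l b s))"
  define G where "G = (\<lambda>s. infsum (\<lambda>bs. t bs s) (lists Basis))"
  have opS: "open S" unfolding S_def l_def
    by (intro open_INT finite_Basis ballI open_Collect_less continuous_intros)
  have "convex {s. norm (l b s) < r}" for b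
  proof (rule convexI)
    fix x y and u v :: real assume xy: "x \<in> {s. norm (l b s) < r}" "y \<in> {s. norm (l b s) < r}" and uv: "0 \<le> u" "0 \<le> v" "u + v = 1"
    have "l b (u *\<^sub>R x + v *\<^sub>R y) = (u + v) *\<^sub>R complex_of_real (d \<bullet> b) + (u *\<^sub>R x + v *\<^sub>R y) * complex_of_real ((h - d) \<bullet> b)"
      using uv by (simp add: l_def)
    also have "\<dots> = u *\<^sub>R l b x + v *\<^sub>R l b y"
      by (simp add: l_def algebra_simps scaleR_conv_of_real)
    finally have "l b (u *\<^sub>R x + v *\<^sub>R y) = u *\<^sub>R l b x + v *\<^sub>R l b y" .
    then have "norm (l b (u *\<^sub>R x + v *\<^sub>R y)) \<le> u * norm (l b x) + v * norm (l b y)"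
      using uv by (metis norm_triangle_ineq norm_scaleR abs_of_nonneg)
    also have "\<dots> < r" using convex_bound_lt[of "norm (l b x)" r "norm (l b y)" u v] xy uv by auto
    finally show "u *\<^sub>R x + v *\<^sub>R y \<in> {s. norm (l b s) < r}" by simp
  qed
  then have "convex S" unfolding S_def by (intro convex_INT)
  then have conS: "connected S" by (rule convex_connected)
  have S01: "0 \<in> S" "1 \<in> S"
    using mb r unfolding S_def l_def
    by (auto simp: inner_diff_left intro!: le_less_trans[OF _ r(1)])
  have tb: "norm (t bs s) \<le> \<bar>c bs\<bar> * r ^ length bs" if "bs \<in> lists Basis" "s \<in> S" for bs s
  proof -
    have "norm (\<Prod>b\<leftarrow>bs. l b s) \<le> r ^ length bs"
      using that by (intro norm_prod_list_le) (auto simp: S_def less_imp_le)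
    then show ?thesis by (auto simp: t_def norm_mult intro!: mult_left_mono)
  qed
  have ul: "uniform_limit S (\<lambda>X s. \<Sum>bs\<in>X. t bs s) G (finite_subsets_at_top (lists Basis))"
    unfolding G_def
    using box_expansion_majorant[OF g r(3,2)]
    by (intro Weierstrass_m_test_general[of "lists Basis" S t "\<lambda>bs. \<bar>c bs\<bar> * r ^ length bs"] tb) auto
  have holt: "t bs holomorphic_on S" for bs
  proof (induction bs)
    case Nil show ?case by (simp add: t_def)
  next
    case (Cons b bs)
    have "(\<lambda>s. \<Prod>b\<leftarrow>bs. l b s) holomorphic_on S" for bs
      by (induction bs) (auto simp: l_def intro!: holomorphic_intros)
    then show ?case unfolding t_def by (intro holomorphic_intros)
  qed
  have holG: "G holomorphic_on S"
  proof -
    have "\<exists>f'. (G has_field_derivative f') (at z)" if z: "z \<in> S" for z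
    proof -
      obtain k where k: "k > 0" "cball z k \<subseteq> S" using opS z open_contains_cball by blast
      have "G holomorphic_on ball z k"
      proof (rule holomorphic_uniform_limit[where f = "\<lambda>X s. \<Sum>bs\<in>X. t bs s" and g = G and z = z and r = k
            and F = "finite_subsets_at_top (lists (Basis::'a set))"])
        have "(\<lambda>s. \<Sum>bs\<in>X. t bs s) holomorphic_on S" for X
          by (intro holomorphic_intros holt)
        then show "\<forall>\<^sub>F X in finite_subsets_at_top (lists Basis). continuous_on (cball z k) (\<lambda>s. \<Sum>bs\<in>X. t bs s)
            \<and> (\<lambda>s. \<Sum>bs\<in>X. t bs s) holomorphic_on ball z k"
          using k by (intro always_eventually)
            (meson ball_subset_cball holomorphic_on_imp_continuous_on holomorphic_on_subset order.trans)
        show "uniform_limit (cball z k) (\<lambda>X s. \<Sum>bs\<in>X. t bs s) G (finite_subsets_at_top (lists Basis))"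
          using ul k(2) by (rule uniform_limit_on_subset)
      qed auto
      then show ?thesis using k holomorphic_on_open[of "ball z k" G] by auto
    qed
    then show ?thesis using holomorphic_on_open[OF opS] by blast
  qed
  have Greal: "G (of_real s) = of_real (g (p + (d + s *\<^sub>R (h - d))))" if "of_real s \<in> S" for s
  proof -
    let ?v = "d + s *\<^sub>R (h - d)"
    have lr: "l b (of_real s) = of_real (?v \<bullet> b)" for b by (simp add: l_def inner_add_left)
    have v: "\<bar>?v \<bullet> b\<bar> < R" if "b \<in> Basis" for b
    proof -
      have "norm (l b (of_real s)) < r" using \<open>of_real s \<in> S\<close> that by (auto simp: S_def)
      then show ?thesis unfolding lr using r(2) by simp
    qed
    have gv: "g (p + ?v) = infsum (\<lambda>bs. c bs * (\<Prod>b\<leftarrow>bs. ?v \<bullet> b)) (lists Basis)"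
      using g v unfolding box_expansion_def by blast
    have "of_real (\<Prod>b\<leftarrow>bs. ?v \<bullet> b) = (\<Prod>b\<leftarrow>bs. l b (of_real s))" for bs
      by (induction bs) (simp_all add: lr)
    then have t: "t bs (of_real s) = of_real (c bs * (\<Prod>b\<leftarrow>bs. ?v \<bullet> b))" for bs
      unfolding t_def by simp
    have "(\<lambda>bs. c bs * (\<Prod>b\<leftarrow>bs. ?v \<bullet> b)) summable_on lists Basis"
      by (rule abs_summable_real) (use g v in \<open>unfold box_expansion_def, blast\<close>)
    from has_sum_of_real[OF has_sum_infsum[OF this], where 'a = complex] show ?thesis
      unfolding gv G_def t by (rule infsumI)
  qed
  \<comment> \<open>The summand 1 keeps the quotient \<open>e / N\<close> meaningful when
    \<open>h = d\<close>.\<close>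
  define N where "N = norm (h - d) + 1"
  have N: "N > 0" "norm (h - d) < N" unfolding N_def using norm_ge_zero[of "h - d"] by linarith+
  \<comment> \<open>Real parameters so close to 0 that the segment point is still within
    \<open>e\<close> of \<open>p + d\<close>; \<open>G\<close> vanishes there, and they accumulate
    at 0.\<close>
  define U where "U = complex_of_real ` {s. \<bar>s\<bar> < e / N \<and> complex_of_real s \<in> S}"
  have zU: "G z = 0" if zU: "z \<in> U" for z
  proof -
    obtain s where s: "z = of_real s" "\<bar>s\<bar> < e / N" "of_real s \<in> S" using zU unfolding U_def by blast
    have "\<bar>s\<bar> * norm (h - d) \<le> \<bar>s\<bar> * N" using N by (intro mult_left_mono) auto
    also have "\<dots> < e" using s(2) N by (simp add: field_simps)
    finally have "g (p + (d + s *\<^sub>R (h - d))) = 0" by (intro zero) simp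
    then show ?thesis using Greal[OF s(3)] s(1) by simp
  qed
  have lim: "0 islimpt U"
  proof -
    obtain k where k: "k > 0" "ball 0 k \<subseteq> S" using opS S01(1) open_contains_ball by blast
    show ?thesis unfolding islimpt_approachable
    proof (intro allI impI)
      fix \<delta> :: real assume "0 < \<delta>"
      define s where "s = min (min (\<delta>/2) (k/2)) (e / N / 2)"
      have s: "0 < s" "s < \<delta>" "s < k" "s < e / N"
        using \<open>0 < \<delta>\<close> k divide_pos_pos[OF e N(1)] by (auto simp: s_def min_less_iff_disj)
      then have "of_real s \<in> S" using k(2) by (auto simp: subset_iff dist_norm)
      then show "\<exists>x'\<in>U. x' \<noteq> 0 \<and> dist x' 0 < \<delta>"
        using s by (intro bexI[of _ "of_real s"]) (auto simp: U_def)
    qed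
  qed
  have "G 1 = 0"
    by (rule analytic_continuation[OF holG opS conS _ S01(1) lim _ S01(2)]) (auto simp: zU, auto simp: U_def)
  then show ?thesis using Greal[of 1] S01(2) by simp
qed

section \<open>Averages and degenerate least squares\<close>

definition avg :: "(nat \<Rightarrow> real) \<Rightarrow> nat \<Rightarrow> real" where
  "avg f T = (\<Sum>t<T. f t) / real T"

lemma avg_add: "avg (\<lambda>t. f t + g t) T = avg f T + avg g T"
  by (simp add: avg_def sum.distrib add_divide_distrib)

lemma avg_diff: "avg (\<lambda>t. f t - g t) T = avg f T - avg g T"
  by (simp add: avg_def sum_subtractf diff_divide_distrib)

lemma avg_cmult: "avg (\<lambda>t. c * f t) T = c * avg f T"
  by (simp add: avg_def flip: sum_distrib_left)

lemma avg_sum: "avg (\<lambda>t. \<Sum>i\<in>I. f i t) T = (\<Sum>i\<in>I. avg (f i) T)"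
  unfolding avg_def by (subst sum.swap) (simp add: sum_divide_distrib)

lemma avg_mono: "(\<And>t. t < T \<Longrightarrow> f t \<le> g t) \<Longrightarrow> avg f T \<le> avg g T"
  unfolding avg_def by (intro divide_right_mono sum_mono) auto

lemma avg_nonneg: "(\<And>t. 0 \<le> f t) \<Longrightarrow> 0 \<le> avg f T"
  unfolding avg_def by (intro divide_nonneg_nonneg sum_nonneg) auto

lemma abs_avg_le: "\<bar>avg f T\<bar> \<le> avg (\<lambda>t. \<bar>f t\<bar>) T"
  unfolding avg_def by (simp add: divide_right_mono sum_abs)

lemma avg_le_bound: "(\<And>t. f t \<le> c) \<Longrightarrow> 0 \<le> c \<Longrightarrow> avg f T \<le> c"
  unfolding avg_def using sum_bounded_above[of "{..<T}" f c]
  by (cases "T = 0") (auto simp: field_simps)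

lemma tendsto_0_dominated:
  fixes f :: "nat \<Rightarrow> real"
  assumes "\<And>T. \<bar>f T\<bar> \<le> g T" "g \<longlonglongrightarrow> 0"
  shows "f \<longlonglongrightarrow> 0"
  using assms by (intro Lim_null_comparison[of f g] always_eventually) auto

text \<open>No bound on \<open>d\<close> is known beforehand. Once
  \<open>\<bar>\<delta> T\<bar> < l / 4\<close>, the quadratic part of the right-hand side is
  absorbed by half of the left-hand side, which leaves a bound of \<open>d\<close> squared by a
  multiple of \<open>\<bar>\<delta> T\<bar>\<close>.\<close>

lemma affine_quadratic_bound_tendsto_0:
  fixes d \<delta> :: "nat \<Rightarrow> real"
  assumes \<delta>: "\<delta> \<longlonglongrightarrow> 0" and pos: "\<And>T. 0 \<le> d T" "0 < l" "0 \<le> c"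
    and le: "\<And>T. l * (d T)\<^sup>2 \<le> \<delta> T * (c + d T)\<^sup>2"
  shows "d \<longlonglongrightarrow> 0"
proof -
  have ev: "\<forall>\<^sub>F T in sequentially. \<bar>\<delta> T\<bar> < l / 4"
    using tendstoD[OF \<delta>, of "l / 4"] pos by (simp add: dist_real_def)
  have b: "(d T)\<^sup>2 \<le> 4 * c\<^sup>2 / l * \<bar>\<delta> T\<bar>" if T: "\<bar>\<delta> T\<bar> < l / 4" for T
  proof -
    have "(c + d T)\<^sup>2 \<le> 2 * c\<^sup>2 + 2 * (d T)\<^sup>2"
      using sum_squares_bound[of c "d T"] by (simp add: power2_sum)
    then have "\<delta> T * (c + d T)\<^sup>2 \<le> \<bar>\<delta> T\<bar> * (2 * c\<^sup>2 + 2 * (d T)\<^sup>2)"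
      by (intro mult_mono) auto
    moreover have "\<bar>\<delta> T\<bar> * (2 * (d T)\<^sup>2) \<le> l / 4 * (2 * (d T)\<^sup>2)"
      using T by (intro mult_right_mono) auto
    ultimately have "l / 2 * (d T)\<^sup>2 \<le> 2 * \<bar>\<delta> T\<bar> * c\<^sup>2"
      using le[of T] by (simp add: algebra_simps)
    then show ?thesis using pos by (simp add: field_simps)
  qed
  have "(\<lambda>T. 4 * c\<^sup>2 / l * \<bar>\<delta> T\<bar>) \<longlonglongrightarrow> 4 * c\<^sup>2 / l * \<bar>0\<bar>"
    by (intro tendsto_intros \<delta>)
  then have u: "(\<lambda>T. 4 * c\<^sup>2 / l * \<bar>\<delta> T\<bar>) \<longlonglongrightarrow> 0" by simp
  have "(\<lambda>T. (d T)\<^sup>2) \<longlonglongrightarrow> 0"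
    by (rule tendsto_sandwich[OF _ _ tendsto_const u])
      (simp, rule eventually_mono[OF ev b])
  then have "(\<lambda>T. sqrt ((d T)\<^sup>2)) \<longlonglongrightarrow> sqrt 0" by (intro tendsto_real_sqrt)
  then show ?thesis using pos by simp
qed

text \<open>The limiting cost may be degenerate. Its kernel is invisible at all but a density-zero set of
  times, so the kernel component of an estimate hardly influences the cost, and the complementary
  component is controlled by strong convexity.\<close>

theorem least_squares_consistency:
  fixes L :: "nat \<Rightarrow> 'e::euclidean_space \<Rightarrow> 'f::euclidean_space"
  assumes lin: "\<And>t. linear (L t)" and K: "0 \<le> K"
    and bL: "\<And>t \<theta>. norm (L t \<theta>) \<le> K * norm \<theta>" and bY: "\<And>t. norm (y t) \<le> K"
    and conv: "\<And>\<theta>. avg (\<lambda>t. (norm (y t - L t \<theta>))\<^sup>2) \<longlonglongrightarrow> q \<theta>"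
    and sparse: "\<And>\<theta>. avg (\<lambda>t. (norm (L t \<theta>))\<^sup>2) \<longlonglongrightarrow> 0 \<Longrightarrow>
                   avg (\<lambda>t. of_bool (L t \<theta> \<noteq> 0)) \<longlonglongrightarrow> 0"
    and est: "\<And>T \<theta>. avg (\<lambda>t. (norm (y t - L t (est T)))\<^sup>2) T \<le> avg (\<lambda>t. (norm (y t - L t \<theta>))\<^sup>2) T"
  shows "{\<theta>. \<forall>\<theta>'. q \<theta> \<le> q \<theta>'} \<noteq> {}"
    and "(\<lambda>T. infdist (est T) {\<theta>. \<forall>\<theta>'. q \<theta> \<le> q \<theta>'}) \<longlonglongrightarrow> 0"
proof -
  \<comment> \<open>Polarization at the level of limits: \<open>m\<close> is to be the limit of the
    averaged \<open>y t \<bullet> L t \<theta>\<close>, \<open>Q\<close> the limiting quadratic form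
    and \<open>B\<close> its bilinear form. Each is a fixed combination of values of
    \<open>q\<close>, so these limits exist.\<close>
  define m where "m \<theta> = (q (- \<theta>) - q \<theta>) / 4" for \<theta>
  define Q where "Q \<theta> = (q \<theta> + q (- \<theta>) - 2 * q 0) / 2" for \<theta>
  define B where "B \<theta> \<theta>' = (Q (\<theta> + \<theta>') - Q (\<theta> - \<theta>')) / 4" for \<theta> \<theta>'
  note L_simps = linear_0[OF lin] linear_neg[OF lin] linear_add[OF lin] linear_diff[OF lin] linear_scale[OF lin]
  have norm_diff_sq: "(norm (a - b))\<^sup>2 = (norm a)\<^sup>2 - 2 * (a \<bullet> b) + (norm b)\<^sup>2" for a b :: 'f
    by (simp add: power2_norm_eq_inner inner_diff_left inner_diff_right inner_commute)
  have m: "avg (\<lambda>t. y t \<bullet> L t \<theta>) \<longlonglongrightarrow> m \<theta>" for \<theta>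
  proof -
    have "(\<lambda>T. (avg (\<lambda>t. (norm (y t - L t (- \<theta>)))\<^sup>2) T - avg (\<lambda>t. (norm (y t - L t \<theta>))\<^sup>2) T) / 4) \<longlonglongrightarrow> m \<theta>"
      unfolding m_def by (intro tendsto_intros conv) simp
    also have "(\<lambda>T. (avg (\<lambda>t. (norm (y t - L t (- \<theta>)))\<^sup>2) T - avg (\<lambda>t. (norm (y t - L t \<theta>))\<^sup>2) T) / 4)
        = (\<lambda>T. avg (\<lambda>t. 1/4 * ((norm (y t - L t (- \<theta>)))\<^sup>2 - (norm (y t - L t \<theta>))\<^sup>2)) T)"
      by (simp only: avg_diff avg_cmult) simp
    also have "(\<lambda>t. 1/4 * ((norm (y t - L t (- \<theta>)))\<^sup>2 - (norm (y t - L t \<theta>))\<^sup>2)) = (\<lambda>t. y t \<bullet> L t \<theta>)"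
      by (rule ext, subst (1 2) norm_diff_sq) (simp add: L_simps)
    finally show ?thesis .
  qed
  have Q: "avg (\<lambda>t. (norm (L t \<theta>))\<^sup>2) \<longlonglongrightarrow> Q \<theta>" for \<theta>
  proof -
    have "(\<lambda>T. (avg (\<lambda>t. (norm (y t - L t \<theta>))\<^sup>2) T + avg (\<lambda>t. (norm (y t - L t (- \<theta>)))\<^sup>2) T
        - 2 * avg (\<lambda>t. (norm (y t - L t 0))\<^sup>2) T) / 2) \<longlonglongrightarrow> Q \<theta>"
      unfolding Q_def by (intro tendsto_intros conv) simp
    also have "(\<lambda>T. (avg (\<lambda>t. (norm (y t - L t \<theta>))\<^sup>2) T + avg (\<lambda>t. (norm (y t - L t (- \<theta>)))\<^sup>2) T
        - 2 * avg (\<lambda>t. (norm (y t - L t 0))\<^sup>2) T) / 2)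
        = (\<lambda>T. avg (\<lambda>t. 1/2 * ((norm (y t - L t \<theta>))\<^sup>2 + (norm (y t - L t (- \<theta>)))\<^sup>2 - 2 * (norm (y t - L t 0))\<^sup>2)) T)"
      by (simp only: avg_diff avg_add avg_cmult) simp
    also have "(\<lambda>t. 1/2 * ((norm (y t - L t \<theta>))\<^sup>2 + (norm (y t - L t (- \<theta>)))\<^sup>2 - 2 * (norm (y t - L t 0))\<^sup>2))
        = (\<lambda>t. (norm (L t \<theta>))\<^sup>2)"
      by (rule ext, subst (1 2 3) norm_diff_sq) (simp add: L_simps)
    finally show ?thesis .
  qed
  have B: "avg (\<lambda>t. L t \<theta> \<bullet> L t \<theta>') \<longlonglongrightarrow> B \<theta> \<theta>'" for \<theta> \<theta>'
  proof -
    have "(\<lambda>T. (avg (\<lambda>t. (norm (L t (\<theta> + \<theta>')))\<^sup>2) T - avg (\<lambda>t. (norm (L t (\<theta> - \<theta>')))\<^sup>2) T) / 4) \<longlonglongrightarrow> B \<theta> \<theta>'"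
      unfolding B_def by (intro tendsto_intros Q) simp
    also have "(\<lambda>T. (avg (\<lambda>t. (norm (L t (\<theta> + \<theta>')))\<^sup>2) T - avg (\<lambda>t. (norm (L t (\<theta> - \<theta>')))\<^sup>2) T) / 4)
        = (\<lambda>T. avg (\<lambda>t. 1/4 * ((norm (L t (\<theta> + \<theta>')))\<^sup>2 - (norm (L t (\<theta> - \<theta>')))\<^sup>2)) T)"
      by (simp only: avg_diff avg_cmult) simp
    also have "(\<lambda>t. 1/4 * ((norm (L t (\<theta> + \<theta>')))\<^sup>2 - (norm (L t (\<theta> - \<theta>')))\<^sup>2)) = (\<lambda>t. L t \<theta> \<bullet> L t \<theta>')"
      by (rule ext) (simp add: L_simps power2_norm_eq_inner inner_add_left inner_add_right
          inner_diff_left inner_diff_right inner_commute)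
    finally show ?thesis .
  qed
  have Lsum: "L t \<theta> = (\<Sum>b\<in>Basis. (\<theta> \<bullet> b) *\<^sub>R L t b)" for t \<theta>
  proof -
    have "L t \<theta> = L t (\<Sum>b\<in>Basis. (\<theta> \<bullet> b) *\<^sub>R b)" by (simp add: euclidean_representation)
    also have "\<dots> = (\<Sum>b\<in>Basis. (\<theta> \<bullet> b) *\<^sub>R L t b)" by (simp add: linear_sum[OF lin] L_simps)
    finally show ?thesis .
  qed
  have mT: "avg (\<lambda>t. y t \<bullet> L t \<theta>) T = (\<Sum>b\<in>Basis. (\<theta> \<bullet> b) * avg (\<lambda>t. y t \<bullet> L t b) T)" for \<theta> T
    by (subst Lsum) (simp add: inner_sum_right avg_sum avg_cmult)
  have QT: "avg (\<lambda>t. (norm (L t \<theta>))\<^sup>2) T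
      = (\<Sum>b\<in>Basis. \<Sum>b'\<in>Basis. (\<theta> \<bullet> b) * (\<theta> \<bullet> b') * avg (\<lambda>t. L t b \<bullet> L t b') T)" for \<theta> T
  proof -
    have *: "a \<bullet> L t \<theta> = (\<Sum>b\<in>Basis. (\<theta> \<bullet> b) * (a \<bullet> L t b))" for a t
      by (subst Lsum) (simp add: inner_sum_right)
    have "(norm (L t \<theta>))\<^sup>2 = (\<Sum>b\<in>Basis. \<Sum>b'\<in>Basis. (\<theta> \<bullet> b) * (\<theta> \<bullet> b') * (L t b \<bullet> L t b'))" for t
      unfolding power2_norm_eq_inner *[of "L t \<theta>"] inner_commute[of "L t \<theta>"] *[of "L t _"]
      by (simp add: sum_distrib_left mult.assoc)
    then show ?thesis by (simp add: avg_sum avg_cmult)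
  qed
  \<comment> \<open>The finite-sample averages are polynomials in the coordinates of
    \<open>\<theta>\<close> with finitely many coefficients, and the limits inherit this form.
    Continuity and homogeneity of \<open>Q\<close> and \<open>m\<close> are read off from
    it.\<close>
  have m_sum: "m \<theta> = (\<Sum>b\<in>Basis. (\<theta> \<bullet> b) * m b)" for \<theta>
    by (rule LIMSEQ_unique[OF m]) (subst ext[OF mT], intro tendsto_intros m)
  have Q_sum: "Q \<theta> = (\<Sum>b\<in>Basis. \<Sum>b'\<in>Basis. (\<theta> \<bullet> b) * (\<theta> \<bullet> b') * B b b')" for \<theta>
    by (rule LIMSEQ_unique[OF Q]) (subst ext[OF QT], intro tendsto_intros B)
  have q_eq: "q \<theta> = q 0 - 2 * m \<theta> + Q \<theta>" for \<theta> by (simp add: m_def Q_def field_simps)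
  have Qcont: "continuous_on S Q" for S
    by (subst ext[OF Q_sum]) (intro continuous_intros)
  have mcont: "continuous_on S m" for S
    by (subst ext[OF m_sum]) (intro continuous_intros)
  have Qnn: "0 \<le> Q \<theta>" for \<theta>
    by (rule LIMSEQ_le_const[OF Q]) (auto intro!: avg_nonneg)
  have Qscale: "Q (c *\<^sub>R \<theta>) = c\<^sup>2 * Q \<theta>" for c \<theta>
    unfolding Q_sum[of "c *\<^sub>R \<theta>"] Q_sum[of \<theta>] by (simp add: sum_distrib_left power2_eq_square mult_ac)
  \<comment> \<open>The parallelogram law in the limit: \<open>q\<close> is strongly convex in all
    directions on which \<open>Q\<close> is positive.\<close>
  have q_mid: "q ((1/2) *\<^sub>R (\<theta> + \<theta>')) = q \<theta> / 2 + q \<theta>' / 2 - Q (\<theta>' - \<theta>) / 4" for \<theta> \<theta>'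
  proof (rule LIMSEQ_unique[OF conv])
    have eq: "(norm (y t - L t ((1/2) *\<^sub>R (\<theta> + \<theta>'))))\<^sup>2 = 1/2 * (norm (y t - L t \<theta>))\<^sup>2
      + 1/2 * (norm (y t - L t \<theta>'))\<^sup>2 - 1/4 * (norm (L t (\<theta>' - \<theta>)))\<^sup>2" for t
      by (simp add: L_simps power2_norm_eq_inner algebra_simps inner_add_left inner_add_right
          inner_diff_left inner_diff_right inner_commute)
    have "(\<lambda>T. 1/2 * avg (\<lambda>t. (norm (y t - L t \<theta>))\<^sup>2) T + 1/2 * avg (\<lambda>t. (norm (y t - L t \<theta>'))\<^sup>2) T
        - 1/4 * avg (\<lambda>t. (norm (L t (\<theta>' - \<theta>)))\<^sup>2) T) \<longlonglongrightarrow> 1/2 * q \<theta> + 1/2 * q \<theta>' - 1/4 * Q (\<theta>' - \<theta>)"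
      by (intro tendsto_intros conv Q)
    moreover have "avg (\<lambda>t. (norm (y t - L t ((1/2) *\<^sub>R (\<theta> + \<theta>'))))\<^sup>2)
      = (\<lambda>T. 1/2 * avg (\<lambda>t. (norm (y t - L t \<theta>))\<^sup>2) T + 1/2 * avg (\<lambda>t. (norm (y t - L t \<theta>'))\<^sup>2) T
        - 1/4 * avg (\<lambda>t. (norm (L t (\<theta>' - \<theta>)))\<^sup>2) T)"
      by (rule ext) (simp only: eq avg_add avg_diff avg_cmult)
    ultimately show "avg (\<lambda>t. (norm (y t - L t ((1/2) *\<^sub>R (\<theta> + \<theta>'))))\<^sup>2) \<longlonglongrightarrow> q \<theta> / 2 + q \<theta>' / 2 - Q (\<theta>' - \<theta>) / 4"
      by simp
  qed
  define V where "V = {\<theta>. Q \<theta> = 0}"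
  have "subspace V"
    unfolding subspace_def
  proof (intro conjI ballI allI)
    show "0 \<in> V" by (simp add: V_def Q_def)
    fix v w assume v: "v \<in> V" and w: "w \<in> V"
    have "Q (v + w) \<le> 2 * Q v + 2 * Q w"
    proof (rule LIMSEQ_le[OF Q])
      show "(\<lambda>T. 2 * avg (\<lambda>t. (norm (L t v))\<^sup>2) T + 2 * avg (\<lambda>t. (norm (L t w))\<^sup>2) T) \<longlonglongrightarrow> 2 * Q v + 2 * Q w"
        by (intro tendsto_intros Q)
      have "(norm (L t (v + w)))\<^sup>2 \<le> 2 * (norm (L t v))\<^sup>2 + 2 * (norm (L t w))\<^sup>2" for t
      proof -
        show ?thesis
          using zero_le_power2[of "norm (L t v - L t w)"]
          by (simp add: L_simps power2_norm_eq_inner inner_add_left inner_add_right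
              inner_diff_left inner_diff_right inner_commute)
      qed
      then show "\<exists>N. \<forall>n\<ge>N. avg (\<lambda>t. (norm (L t (v + w)))\<^sup>2) n
          \<le> 2 * avg (\<lambda>t. (norm (L t v))\<^sup>2) n + 2 * avg (\<lambda>t. (norm (L t w))\<^sup>2) n"
        unfolding avg_cmult[symmetric] avg_add[symmetric] by (intro exI allI impI avg_mono)
    qed
    then show "v + w \<in> V" using v w Qnn[of "v + w"] by (simp add: V_def)
  next
    fix c :: real and v assume "v \<in> V" then show "c *\<^sub>R v \<in> V" by (simp add: V_def Qscale)
  qed
  \<comment> \<open>The sparseness hypothesis speaks of one vector at a time. With a finite basis
    the exceptional times of the whole kernel form a finite union, which still has density
    zero.\<close>
  obtain \<B> where \<B>': "\<B> \<subseteq> V" "independent \<B>" "V \<subseteq> span \<B>"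
    by (rule basis_exists[of V])
  have \<B>: "finite \<B>" "\<B> \<subseteq> V" "span \<B> = V"
    using \<B>' independent_imp_finite[OF \<B>'(2)] span_minimal[OF \<B>'(1) \<open>subspace V\<close>] by auto
  define S where "S = {t. \<exists>v\<in>\<B>. L t v \<noteq> 0}"
  define \<rho> where "\<rho> = avg (\<lambda>t. of_bool (t \<in> S))"
  have good: "L t v = 0" if "t \<notin> S" "v \<in> V" for t v
    using that linear_eq_0_on_span[OF lin, of \<B> t v] \<B>(3) by (auto simp: S_def)
  have \<rho>: "\<rho> \<longlonglongrightarrow> 0"
  proof -
    have "avg (\<lambda>t. of_bool (L t v \<noteq> 0)) \<longlonglongrightarrow> 0" if "v \<in> \<B>" for v
      using \<B>(2) that Q[of v] by (intro sparse) (auto simp: V_def)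
    then have "(\<lambda>T. \<Sum>v\<in>\<B>. avg (\<lambda>t. of_bool (L t v \<noteq> 0)) T) \<longlonglongrightarrow> 0"
      by (intro tendsto_null_sum)
    moreover have "\<rho> T \<le> (\<Sum>v\<in>\<B>. avg (\<lambda>t. of_bool (L t v \<noteq> 0)) T)" for T
      unfolding \<rho>_def avg_sum[symmetric]
    proof (rule avg_mono)
      fix t
      show "of_bool (t \<in> S) \<le> (\<Sum>v\<in>\<B>. of_bool (L t v \<noteq> 0) :: real)"
      proof (cases "t \<in> S")
        case True
        then obtain v where v: "v \<in> \<B>" "L t v \<noteq> 0" by (auto simp: S_def)
        then show ?thesis
          using member_le_sum[of v \<B> "\<lambda>v. of_bool (L t v \<noteq> 0) :: real"] \<B>(1) True by simp
      qed (simp add: sum_nonneg)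
    qed
    moreover have "0 \<le> \<rho> T" for T unfolding \<rho>_def by (rule avg_nonneg) simp
    ultimately show ?thesis by (intro tendsto_0_dominated[of \<rho>]) auto
  qed
  \<comment> \<open>Outside \<open>S\<close> the terms vanish, and on \<open>S\<close> they are
    bounded, so the density \<open>\<rho>\<close> carries the estimate. The same argument gives
    \<open>qV\<close>.\<close>
  have mV: "m v = 0" if v: "v \<in> V" for v
  proof (rule LIMSEQ_unique[OF m])
    have "\<bar>avg (\<lambda>t. y t \<bullet> L t v) T\<bar> \<le> K * (K * norm v) * \<rho> T" for T
    proof -
      have "\<bar>y t \<bullet> L t v\<bar> \<le> K * (K * norm v) * of_bool (t \<in> S)" for t
      proof (cases "t \<in> S")
        case True
        have "\<bar>y t \<bullet> L t v\<bar> \<le> norm (y t) * norm (L t v)" by (rule Cauchy_Schwarz_ineq2)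
        also have "\<dots> \<le> K * (K * norm v)" by (intro mult_mono bY bL K) auto
        finally show ?thesis using True by simp
      qed (simp add: good v)
      then show ?thesis
        unfolding \<rho>_def avg_cmult[symmetric] by (intro order_trans[OF abs_avg_le] avg_mono)
    qed
    moreover have "(\<lambda>T. K * (K * norm v) * \<rho> T) \<longlonglongrightarrow> 0"
      using tendsto_mult_right_zero[OF \<rho>] by simp
    ultimately show "avg (\<lambda>t. y t \<bullet> L t v) \<longlonglongrightarrow> 0"
      by (rule tendsto_0_dominated)
  qed
  have madd: "m (\<theta> + \<theta>') = m \<theta> + m \<theta>'" for \<theta> \<theta>'
    unfolding m_sum[of "\<theta> + \<theta>'"] m_sum[of \<theta>] m_sum[of \<theta>']
    by (simp add: inner_add_left distrib_right sum.distrib)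
  have qV: "q (w + v) = q w" if v: "v \<in> V" for v w
  proof (rule LIMSEQ_unique[OF conv])
    have "\<bar>avg (\<lambda>t. (norm (y t - L t (w + v)))\<^sup>2) T - avg (\<lambda>t. (norm (y t - L t w))\<^sup>2) T\<bar>
        \<le> ((K + K * norm (w + v))\<^sup>2 + (K + K * norm w)\<^sup>2) * \<rho> T" for T
      unfolding avg_diff[symmetric] \<rho>_def avg_cmult[symmetric]
    proof (intro order_trans[OF abs_avg_le] avg_mono)
      fix t
      have n: "(norm (y t - L t \<theta>))\<^sup>2 \<le> (K + K * norm \<theta>)\<^sup>2" for \<theta>
        by (intro power_mono order_trans[OF norm_triangle_ineq4] add_mono bY bL) simp
      show "\<bar>(norm (y t - L t (w + v)))\<^sup>2 - (norm (y t - L t w))\<^sup>2\<bar>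
        \<le> ((K + K * norm (w + v))\<^sup>2 + (K + K * norm w)\<^sup>2) * of_bool (t \<in> S)"
      proof (cases "t \<in> S")
        case True
        have "\<bar>(norm (y t - L t (w + v)))\<^sup>2 - (norm (y t - L t w))\<^sup>2\<bar>
            \<le> (K + K * norm (w + v))\<^sup>2 + (K + K * norm w)\<^sup>2"
          using n[of "w + v"] n[of w] zero_le_power2[of "norm (y t - L t (w + v))"]
            zero_le_power2[of "norm (y t - L t w)"] by linarith
        then show ?thesis using True by simp
      qed (simp add: good v L_simps)
    qed
    moreover have "(\<lambda>T. ((K + K * norm (w + v))\<^sup>2 + (K + K * norm w)\<^sup>2) * \<rho> T) \<longlonglongrightarrow> 0"
      by (rule tendsto_mult_right_zero[OF \<rho>])
    ultimately have "(\<lambda>T. avg (\<lambda>t. (norm (y t - L t (w + v)))\<^sup>2) T - avg (\<lambda>t. (norm (y t - L t w))\<^sup>2) T) \<longlonglongrightarrow> 0"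
      by (rule tendsto_0_dominated)
    from tendsto_add[OF this conv[of w]]
    show "avg (\<lambda>t. (norm (y t - L t (w + v)))\<^sup>2) \<longlonglongrightarrow> q w" by simp
  qed
  define W where "W = {w. \<forall>v\<in>V. orthogonal v w}"
  have subW: "subspace W" unfolding W_def by (rule subspace_orthogonal_to_vectors)
  have decomp: "\<exists>v w. v \<in> V \<and> w \<in> W \<and> \<theta> = v + w" for \<theta>
  proof -
    obtain v w where "v \<in> span V" "\<And>v'. v' \<in> span V \<Longrightarrow> orthogonal w v'" "\<theta> = v + w"
      using orthogonal_subspace_decomp_exists[of V \<theta>] by metis
    moreover have "span V = V" using \<open>subspace V\<close> by (simp add: span_eq_iff)
    ultimately have "v \<in> V" "w \<in> W" "\<theta> = v + w" by (simp_all add: W_def orthogonal_commute)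
    then show ?thesis by blast
  qed
  \<comment> \<open>The minimum of \<open>Q\<close> on the unit sphere of \<open>W\<close> is
    positive because \<open>W\<close> meets the kernel only in 0. If \<open>W\<close> is trivial the
    sphere is empty and 1 serves.\<close>
  obtain l where l: "0 < l" "\<And>w. w \<in> W \<Longrightarrow> l * (norm w)\<^sup>2 \<le> Q w"
  proof -
    let ?C = "sphere 0 1 \<inter> W"
    have comp: "compact ?C" by (intro compact_Int_closed compact_sphere closed_subspace subW)
    obtain l where l: "0 < l" "\<And>w. w \<in> ?C \<Longrightarrow> l \<le> Q w"
    proof (cases "?C = {}")
      case False
      then obtain w0 where w0: "w0 \<in> ?C" "\<And>w. w \<in> ?C \<Longrightarrow> Q w0 \<le> Q w"
        using continuous_attains_inf[OF comp False Qcont] by blast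
      have "Q w0 \<noteq> 0"
      proof
        assume "Q w0 = 0"
        then have "orthogonal w0 w0" using w0(1) by (auto simp: V_def W_def)
        then show False using w0(1) by (auto simp: orthogonal_self)
      qed
      with Qnn[of w0] have "0 < Q w0" by linarith
      then show thesis using w0(2) by (rule that)
    qed (auto intro: that[of 1])
    show thesis
    proof (rule that[OF l(1)])
      fix w assume w: "w \<in> W"
      show "l * (norm w)\<^sup>2 \<le> Q w"
      proof (cases "w = 0")
        case False
        have "l \<le> Q ((1 / norm w) *\<^sub>R w)"
          using False w subspace_scale[OF subW] by (intro l(2)) auto
        then show ?thesis using False by (simp add: Qscale power_divide field_simps)
      qed (simp add: Qnn)
    qed
  qed
  obtain \<theta>s where \<theta>s: "\<theta>s \<in> W" "\<And>\<theta>. q \<theta>s \<le> q \<theta>"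
  proof -
    define M where "M = (\<Sum>b\<in>Basis. \<bar>m b\<bar>)"
    have M0: "0 \<le> M" unfolding M_def by (intro sum_nonneg) simp
    have mM: "\<bar>m \<theta>\<bar> \<le> M * norm \<theta>" for \<theta>
    proof -
      have "\<bar>m \<theta>\<bar> \<le> (\<Sum>b\<in>Basis. \<bar>\<theta> \<bullet> b\<bar> * \<bar>m b\<bar>)"
        unfolding m_sum[of \<theta>] by (rule order_trans[OF sum_abs]) (simp add: abs_mult)
      also have "\<dots> \<le> (\<Sum>b\<in>Basis. norm \<theta> * \<bar>m b\<bar>)"
        by (intro sum_mono mult_right_mono Basis_le_norm) auto
      finally show ?thesis by (simp add: M_def sum_distrib_left sum_distrib_right mult_ac)
    qed
    \<comment> \<open>Beyond this radius the quadratic growth \<open>l * norm w * norm w\<close>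
      exceeds twice the linear term, so \<open>q\<close> is at least \<open>q 0\<close> there and a
      minimum over the compact part is a minimum over \<open>W\<close>.\<close>
    define r where "r = 2 * M / l"
    have r0: "0 \<le> r" using M0 l by (simp add: r_def)
    have qcont: "continuous_on A q" for A
    proof -
      have "continuous_on A (\<lambda>\<theta>. q 0 - 2 * m \<theta> + Q \<theta>)"
        by (intro continuous_on_add continuous_on_diff continuous_on_mult continuous_on_const mcont Qcont)
      then show ?thesis by (simp only: q_eq[symmetric])
    qed
    have comp: "compact (cball 0 r \<inter> W)" by (intro compact_Int_closed compact_cball closed_subspace subW)
    have ne: "0 \<in> cball 0 r \<inter> W" using r0 subspace_0[OF subW] by simp
    have "\<exists>z\<in>cball 0 r \<inter> W. \<forall>w\<in>cball 0 r \<inter> W. q z \<le> q w"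
      by (rule continuous_attains_inf[OF comp _ qcont]) (use ne in blast)
    then obtain z where z: "z \<in> cball 0 r \<inter> W" "\<And>w. w \<in> cball 0 r \<inter> W \<Longrightarrow> q z \<le> q w"
      by blast
    have zW: "q z \<le> q w" if w: "w \<in> W" for w
    proof (cases "norm w \<le> r")
      case False
      have "q z \<le> q 0" using z(2) ne by blast
      moreover have "2 * m w \<le> l * norm w * norm w"
      proof -
        have "2 * M \<le> l * norm w" using False l by (simp add: r_def field_simps)
        then have "2 * M * norm w \<le> l * norm w * norm w" by (intro mult_right_mono) auto
        then show ?thesis using mM[of w] by linarith
      qed
      ultimately show ?thesis using l(2)[OF w] q_eq[of w] by (simp add: power2_eq_square)
    qed (use z w in auto)
    show thesis
    proof (rule that[of z])
      fix \<theta> obtain v w where "v \<in> V" "w \<in> W" "\<theta> = v + w" using decomp by blast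
      then show "q z \<le> q \<theta>" using zW[of w] qV[of v w] by (simp add: add.commute)
    qed (use z in auto)
  qed
  then show ne: "{\<theta>. \<forall>\<theta>'. q \<theta> \<le> q \<theta>'} \<noteq> {}" by blast
  have "\<forall>T. \<exists>v w. v \<in> V \<and> w \<in> W \<and> est T = v + w" using decomp by blast
  then obtain v w where vw: "\<And>T. v T \<in> V" "\<And>T. w T \<in> W" "\<And>T. est T = v T + w T"
    unfolding choice_iff by blast
  \<comment> \<open>The total deviation of all coefficients of the finite-sample cost from their
    limits. It bounds the deviation of the cost at every \<open>\<theta>\<close> at once, up to the
    factor \<open>(1 + norm \<theta>)\<close> squared.\<close>
  define \<delta> where "\<delta> T = \<bar>avg (\<lambda>t. (norm (y t))\<^sup>2) T - q 0\<bar> + 2 * (\<Sum>b\<in>Basis. \<bar>avg (\<lambda>t. y t \<bullet> L t b) T - m b\<bar>)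
     + (\<Sum>b\<in>Basis. \<Sum>b'\<in>Basis. \<bar>avg (\<lambda>t. L t b \<bullet> L t b') T - B b b'\<bar>)" for T
  have \<delta>0: "\<delta> \<longlonglongrightarrow> 0"
  proof -
    have "avg (\<lambda>t. (norm (y t))\<^sup>2) \<longlonglongrightarrow> q 0" using conv[of 0] by (simp add: L_simps)
    then have "\<delta> \<longlonglongrightarrow> \<bar>q 0 - q 0\<bar> + 2 * (\<Sum>b\<in>Basis. \<bar>m b - m b\<bar>) + (\<Sum>b\<in>Basis. \<Sum>b'\<in>Basis. \<bar>B b b' - B b b'\<bar>)"
      unfolding \<delta>_def by (intro tendsto_intros m B)
    then show ?thesis by simp
  qed
  have unif: "\<bar>avg (\<lambda>t. (norm (y t - L t \<theta>))\<^sup>2) T - q \<theta>\<bar> \<le> \<delta> T * (1 + norm \<theta>)\<^sup>2" for \<theta> T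
  proof -
    let ?n = "(1 + norm \<theta>)\<^sup>2"
    have n: "1 \<le> ?n" "norm \<theta> \<le> ?n" "(norm \<theta>)\<^sup>2 \<le> ?n"
    proof -
      have "?n = 1 + 2 * norm \<theta> + (norm \<theta>)\<^sup>2" by (simp add: power2_sum)
      then show "1 \<le> ?n" "norm \<theta> \<le> ?n" "(norm \<theta>)\<^sup>2 \<le> ?n"
        using norm_ge_zero[of \<theta>] zero_le_power2[of "norm \<theta>"] by linarith+
    qed
    have b: "\<bar>\<theta> \<bullet> b\<bar> \<le> norm \<theta>" if "b \<in> Basis" for b using that by (rule Basis_le_norm)
    have e: "avg (\<lambda>t. (norm (y t - L t \<theta>))\<^sup>2) T = avg (\<lambda>t. (norm (y t))\<^sup>2) T
        - 2 * avg (\<lambda>t. y t \<bullet> L t \<theta>) T + avg (\<lambda>t. (norm (L t \<theta>))\<^sup>2) T"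
      by (simp add: norm_diff_sq avg_add avg_diff avg_cmult)
    have "\<bar>avg (\<lambda>t. (norm (y t))\<^sup>2) T - q 0\<bar> \<le> \<bar>avg (\<lambda>t. (norm (y t))\<^sup>2) T - q 0\<bar> * ?n"
      using n(1) mult_left_mono[OF n(1), of "\<bar>avg (\<lambda>t. (norm (y t))\<^sup>2) T - q 0\<bar>"] by simp
    moreover have "\<bar>avg (\<lambda>t. y t \<bullet> L t \<theta>) T - m \<theta>\<bar> \<le> (\<Sum>b\<in>Basis. \<bar>avg (\<lambda>t. y t \<bullet> L t b) T - m b\<bar>) * ?n"
    proof -
      have eq: "avg (\<lambda>t. y t \<bullet> L t \<theta>) T - m \<theta> = (\<Sum>b\<in>Basis. (\<theta> \<bullet> b) * (avg (\<lambda>t. y t \<bullet> L t b) T - m b))"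
        unfolding mT[of \<theta>] m_sum[of \<theta>] by (simp add: sum_subtractf right_diff_distrib)
      have "\<bar>avg (\<lambda>t. y t \<bullet> L t \<theta>) T - m \<theta>\<bar> \<le> (\<Sum>b\<in>Basis. \<bar>avg (\<lambda>t. y t \<bullet> L t b) T - m b\<bar> * ?n)"
        unfolding eq
      proof (rule order_trans[OF sum_abs], rule sum_mono)
        fix b :: 'e assume bb: "b \<in> Basis"
        show "\<bar>(\<theta> \<bullet> b) * (avg (\<lambda>t. y t \<bullet> L t b) T - m b)\<bar> \<le> \<bar>avg (\<lambda>t. y t \<bullet> L t b) T - m b\<bar> * ?n"
          using order_trans[OF b[OF bb] n(2)]
          by (subst mult.commute) (simp add: abs_mult mult_left_mono)
      qed
      then show ?thesis by (simp add: sum_distrib_right)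
    qed
    moreover have "\<bar>avg (\<lambda>t. (norm (L t \<theta>))\<^sup>2) T - Q \<theta>\<bar>
        \<le> (\<Sum>b\<in>Basis. \<Sum>b'\<in>Basis. \<bar>avg (\<lambda>t. L t b \<bullet> L t b') T - B b b'\<bar>) * ?n"
    proof -
      have eq: "avg (\<lambda>t. (norm (L t \<theta>))\<^sup>2) T - Q \<theta>
          = (\<Sum>b\<in>Basis. \<Sum>b'\<in>Basis. (\<theta> \<bullet> b) * (\<theta> \<bullet> b') * (avg (\<lambda>t. L t b \<bullet> L t b') T - B b b'))"
        unfolding QT[of \<theta>] Q_sum[of \<theta>] by (simp add: sum_subtractf right_diff_distrib)
      have "\<bar>avg (\<lambda>t. (norm (L t \<theta>))\<^sup>2) T - Q \<theta>\<bar> \<le> (\<Sum>b\<in>Basis. \<Sum>b'\<in>Basis. \<bar>avg (\<lambda>t. L t b \<bullet> L t b') T - B b b'\<bar> * ?n)"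
        unfolding eq
      proof (rule order_trans[OF sum_abs], rule sum_mono, rule order_trans[OF sum_abs], rule sum_mono)
        fix b b' :: 'e assume bb: "b \<in> Basis" "b' \<in> Basis"
        have "\<bar>\<theta> \<bullet> b\<bar> * \<bar>\<theta> \<bullet> b'\<bar> \<le> norm \<theta> * norm \<theta>" using b bb by (intro mult_mono) auto
        then have "\<bar>\<theta> \<bullet> b\<bar> * \<bar>\<theta> \<bullet> b'\<bar> \<le> ?n" using n(3) by (simp add: power2_eq_square)
        then show "\<bar>(\<theta> \<bullet> b) * (\<theta> \<bullet> b') * (avg (\<lambda>t. L t b \<bullet> L t b') T - B b b')\<bar>
            \<le> \<bar>avg (\<lambda>t. L t b \<bullet> L t b') T - B b b'\<bar> * ?n"
          by (subst mult.commute) (simp add: abs_mult mult_left_mono)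
      qed
      then show ?thesis by (simp add: sum_distrib_right)
    qed
    ultimately show ?thesis unfolding e q_eq[of \<theta>] \<delta>_def by (simp add: distrib_right)
  qed
  \<comment> \<open>One \<open>\<delta> T\<close> is paid for passing to the limit at
    \<open>w T\<close> and one at \<open>\<theta>s\<close>; the last term pays for dropping the
    kernel component at the times in \<open>S\<close>.\<close>
  define \<epsilon> where "\<epsilon> T = 2 * \<delta> T + \<rho> T * K\<^sup>2" for T
  have \<epsilon>_bound: "l / 2 * (norm (w T - \<theta>s))\<^sup>2 \<le> \<epsilon> T * ((1 + norm \<theta>s) + norm (w T - \<theta>s))\<^sup>2" for T
  proof -
    let ?N = "((1 + norm \<theta>s) + norm (w T - \<theta>s))\<^sup>2"
    have \<delta>nn: "0 \<le> \<delta> T" unfolding \<delta>_def by (intro add_nonneg_nonneg mult_nonneg_nonneg sum_nonneg) auto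
    have \<rho>nn: "0 \<le> \<rho> T" unfolding \<rho>_def by (rule avg_nonneg) simp
    have N1: "(1 + norm \<theta>s)\<^sup>2 \<le> ?N" by (intro power_mono) auto
    have "norm (w T) \<le> norm \<theta>s + norm (w T - \<theta>s)"
      using norm_triangle_ineq[of \<theta>s "w T - \<theta>s"] by simp
    then have N2: "(1 + norm (w T))\<^sup>2 \<le> ?N" by (intro power_mono) auto
    \<comment> \<open>Only this direction is available: on \<open>S\<close> the cost of
      \<open>w T\<close> is bounded through its norm, while that of \<open>est T\<close> can be
      arbitrarily large and enters only through its sign.\<close>
    have "avg (\<lambda>t. (norm (y t - L t (w T)))\<^sup>2) T
        \<le> avg (\<lambda>t. (norm (y t - L t (est T)))\<^sup>2 + K\<^sup>2 * (1 + norm (w T))\<^sup>2 * of_bool (t \<in> S)) T"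
    proof (rule avg_mono)
      fix t
      have "(norm (y t - L t (w T)))\<^sup>2 \<le> (K * (1 + norm (w T)))\<^sup>2"
        by (intro power_mono order_trans[OF norm_triangle_ineq4])
          (auto simp: distrib_left intro!: add_mono bY bL)
      then show "(norm (y t - L t (w T)))\<^sup>2 \<le> (norm (y t - L t (est T)))\<^sup>2 + K\<^sup>2 * (1 + norm (w T))\<^sup>2 * of_bool (t \<in> S)"
        using good[of t "v T"] vw(1,3)[of T]
        by (cases "t \<in> S") (auto simp: L_simps power_mult_distrib intro: add_increasing)
    qed
    also have "\<dots> = avg (\<lambda>t. (norm (y t - L t (est T)))\<^sup>2) T + K\<^sup>2 * (1 + norm (w T))\<^sup>2 * \<rho> T"
      by (simp add: avg_add avg_cmult \<rho>_def)
    also have "\<dots> \<le> avg (\<lambda>t. (norm (y t - L t \<theta>s))\<^sup>2) T + K\<^sup>2 * ?N * \<rho> T"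
      using \<rho>nn N2 by (intro add_mono est mult_right_mono mult_left_mono) auto
    also have "\<dots> \<le> q \<theta>s + \<delta> T * ?N + K\<^sup>2 * ?N * \<rho> T"
      using unif[of \<theta>s T] mult_left_mono[OF N1 \<delta>nn] by linarith
    finally have "q (w T) \<le> q \<theta>s + \<epsilon> T * ?N"
      using unif[of "w T" T] mult_left_mono[OF N2 \<delta>nn] unfolding \<epsilon>_def by (simp add: algebra_simps)
    moreover have "Q (w T - \<theta>s) / 2 \<le> q (w T) - q \<theta>s"
      using q_mid[of \<theta>s "w T"] \<theta>s(2)[of "(1/2) *\<^sub>R (\<theta>s + w T)"] by simp
    moreover have "l * (norm (w T - \<theta>s))\<^sup>2 \<le> Q (w T - \<theta>s)"
      using subspace_diff[OF subW] vw(2) \<theta>s(1) by (intro l(2)) auto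
    ultimately show ?thesis by simp
  qed
  have \<epsilon>0: "\<epsilon> \<longlonglongrightarrow> 0"
  proof -
    have "\<epsilon> \<longlonglongrightarrow> 2 * 0 + 0 * K\<^sup>2" unfolding \<epsilon>_def by (intro tendsto_intros \<delta>0 \<rho>)
    then show ?thesis by simp
  qed
  have w0: "(\<lambda>T. norm (w T - \<theta>s)) \<longlonglongrightarrow> 0"
    by (rule affine_quadratic_bound_tendsto_0[OF \<epsilon>0 _ _ _ \<epsilon>_bound]) (use l(1) in simp_all)
  have "infdist (est T) {\<theta>. \<forall>\<theta>'. q \<theta> \<le> q \<theta>'} \<le> norm (w T - \<theta>s)" for T
  proof -
    \<comment> \<open>A minimizer that shares the kernel component of the estimate, however large
      that component is.\<close>
    have "\<theta>s + v T \<in> {\<theta>. \<forall>\<theta>'. q \<theta> \<le> q \<theta>'}" using \<theta>s(2) qV[OF vw(1)] by simp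
    from infdist_le[OF this, of "est T"] show ?thesis by (simp add: vw(3) dist_norm algebra_simps)
  qed
  then show "(\<lambda>T. infdist (est T) {\<theta>. \<forall>\<theta>'. q \<theta> \<le> q \<theta>'}) \<longlonglongrightarrow> 0"
    by (intro tendsto_0_dominated[OF _ w0]) (simp add: infdist_nonneg)
qed

section \<open>Strong laws and uniform noise\<close>

context prob_space
begin

text \<open>For variables bounded by \<open>c\<close>, a deviation of the sum by
  \<open>\<delta> * n\<close> has probability at most geometric in \<open>n\<close>, hence summable.
  Identical distribution is replaced by centring each variable at its own mean.\<close>

lemma bounded_indep_strong_law:
  fixes X :: "nat \<Rightarrow> 'a \<Rightarrow> real"
  assumes ind: "indep_vars (\<lambda>_. borel) X UNIV"
    and bd: "\<And>t. AE \<omega> in M. \<bar>X t \<omega>\<bar> \<le> c" and c: "0 < c"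
  shows "AE \<omega> in M. avg (\<lambda>t. X t \<omega> - expectation (X t)) \<longlonglongrightarrow> 0"
proof -
  have rv [measurable]: "random_variable borel (X t)" for t
    using ind by (auto simp: indep_vars_def)
  have ev: "AE \<omega> in M. \<forall>\<^sub>F n in sequentially. \<bar>avg (\<lambda>t. X t \<omega> - expectation (X t)) n\<bar> \<le> \<delta>" if \<delta>: "0 < \<delta>" for \<delta>
  proof -
    define A where "A n = {\<omega>\<in>space M. \<delta> * real n \<le> \<bar>(\<Sum>t<n. X t \<omega>) - (\<Sum>t<n. expectation (X t))\<bar>}" for n
    have [measurable]: "A n \<in> sets M" for n unfolding A_def by measurable
    have prob_A: "prob (A n) \<le> 2 * exp (- \<delta>\<^sup>2 / (2 * c\<^sup>2)) ^ n" if n: "0 < n" for n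
    proof -
      interpret H: Hoeffding_ineq M "{..<n}" X "\<lambda>_. - c" "\<lambda>_. c" "\<Sum>t<n. expectation (X t)"
      proof unfold_locales
        show "indep_vars (\<lambda>_. borel) X {..<n}" using ind by (rule indep_vars_subset) auto
        show "AE x in M. X i x \<in> {- c..c}" for i using bd[of i] by eventually_elim auto
      qed auto
      have "prob (A n) \<le> 2 * exp (- 2 * (\<delta> * real n)\<^sup>2 / (\<Sum>i<n. (c - - c)\<^sup>2))"
        unfolding A_def by (rule H.Hoeffding_ineq_abs_ge) (use \<delta> n c in auto)
      \<comment> \<open>The squared ranges add up to \<open>n\<close> times the square of
        \<open>2 * c\<close>, which turns the exponent into a multiple of \<open>n\<close>.\<close>
      also have "- 2 * (\<delta> * real n)\<^sup>2 / (\<Sum>i<n. (c - - c)\<^sup>2) = real n * (- \<delta>\<^sup>2 / (2 * c\<^sup>2))"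
        using n c by (simp add: power2_eq_square field_simps)
      finally show ?thesis by (simp only: exp_of_nat_mult)
    qed
    have "summable (\<lambda>n. prob (A n))"
    proof (rule summable_comparison_test'[of "\<lambda>n. 2 * exp (- \<delta>\<^sup>2 / (2 * c\<^sup>2)) ^ n" 1])
      show "summable (\<lambda>n. 2 * exp (- \<delta>\<^sup>2 / (2 * c\<^sup>2)) ^ n)"
        using \<delta> c by (intro summable_mult summable_geometric) simp
    qed (use prob_A in simp)
    then have "AE \<omega> in M. \<forall>\<^sub>F n in sequentially. \<omega> \<in> space M - A n"
      by (intro borel_cantelli_AE1) (auto simp: less_top[symmetric])
    then show ?thesis
    proof eventually_elim
      case (elim \<omega>)
      then show ?case
      proof eventually_elim
        case (elim n)
        then have "\<bar>(\<Sum>t<n. X t \<omega>) - (\<Sum>t<n. expectation (X t))\<bar> < \<delta> * real n" by (auto simp: A_def)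
        then show ?case using \<delta>
          by (cases "n = 0") (auto simp: avg_def sum_subtractf field_simps)
      qed
    qed
  qed
  have "AE \<omega> in M. \<forall>k. \<forall>\<^sub>F n in sequentially. \<bar>avg (\<lambda>t. X t \<omega> - expectation (X t)) n\<bar> \<le> 1 / real (Suc k)"
    unfolding AE_all_countable by (intro allI ev) simp
  then show ?thesis
  proof eventually_elim
    case (elim \<omega>)
    show ?case
    proof (rule tendstoI)
      fix e :: real assume "0 < e"
      then obtain k where "1 / real (Suc k) < e" using nat_approx_posE by metis
      with elim[rule_format, of k] show "\<forall>\<^sub>F n in sequentially. dist (avg (\<lambda>t. X t \<omega> - expectation (X t)) n) 0 < e"
        by (auto elim!: eventually_mono)
    qed
  qed
qed

text \<open>The variables at even times are independent, and so are those at odd times.\<close>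

lemma bounded_one_dependent_strong_law:
  fixes e :: "nat \<times> 'k \<Rightarrow> 'a \<Rightarrow> real" and F :: "nat \<Rightarrow> (nat \<times> 'k \<Rightarrow> real) \<Rightarrow> real"
  assumes ind: "indep_vars (\<lambda>_. borel) e UNIV"
    and F: "\<And>t. F t \<in> borel_measurable (PiM ({t, Suc t} \<times> UNIV) (\<lambda>_. borel))"
    and X: "\<And>t \<omega>. X t \<omega> = F t (\<lambda>i\<in>{t, Suc t} \<times> UNIV. e i \<omega>)"
    and bd: "\<And>t. AE \<omega> in M. \<bar>X t \<omega>\<bar> \<le> c" and c: "0 < c"
  shows "AE \<omega> in M. avg (\<lambda>t. X t \<omega> - expectation (X t)) \<longlonglongrightarrow> 0"
proof -
  have rv_e [measurable]: "random_variable borel (e i)" for i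
    using ind unfolding indep_vars_def by blast
  have rv: "random_variable borel (X t)" for t
    unfolding X[abs_def] by (rule measurable_compose[OF _ F]) measurable
  \<comment> \<open>Terms of the wrong parity are set to 0 instead of being removed, so both halves
    remain sequences over all times and their averages simply add up.\<close>
  have part: "AE \<omega> in M. avg (\<lambda>t. (if even t = r then X t \<omega> else 0) - expectation (\<lambda>\<omega>. if even t = r then X t \<omega> else 0)) \<longlonglongrightarrow> 0" for r
  proof (rule bounded_indep_strong_law[OF _ _ c])
    \<comment> \<open>Blocks \<open>{t, Suc t}\<close> with \<open>t\<close> of one parity are
      disjoint; the other times receive the empty block, on which a constant is measurable.\<close>
    define K where "K t = (if even t = r then {t, Suc t} \<times> (UNIV :: 'k set) else {})" for t :: nat
    define G where "G t v = (if even t = r then F t v else 0)" for t v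
    have disj: "disjoint_family_on K UNIV"
      unfolding disjoint_family_on_def
    proof (intro ballI impI)
      fix s t :: nat assume "s \<noteq> t"
      then show "K s \<inter> K t = {}"
        by (cases "even s = r"; cases "even t = r") (auto simp: K_def)
    qed
    have "indep_vars (\<lambda>j. PiM (K j) (\<lambda>_. borel)) (\<lambda>j \<omega>. restrict (\<lambda>i. e i \<omega>) (K j)) UNIV"
      by (rule indep_vars_restrict[OF ind _ disj]) auto
    then have "indep_vars (\<lambda>_. borel) (\<lambda>t \<omega>. G t (restrict (\<lambda>i. e i \<omega>) (K t))) UNIV"
      by (rule indep_vars_compose2) (auto simp: G_def[abs_def] K_def F)
    also have "(\<lambda>t \<omega>. G t (restrict (\<lambda>i. e i \<omega>) (K t))) = (\<lambda>t \<omega>. if even t = r then X t \<omega> else 0)"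
      by (auto simp: G_def K_def X fun_eq_iff)
    finally show "indep_vars (\<lambda>_. borel) (\<lambda>t \<omega>. if even t = r then X t \<omega> else 0) UNIV" .
    show "AE \<omega> in M. \<bar>if even t = r then X t \<omega> else 0\<bar> \<le> c" for t
      using c by (intro eventually_mono[OF bd[of t]]) auto
  qed
  from part[of True] part[of False] show ?thesis
  proof eventually_elim
    case (elim \<omega>)
    have "avg (\<lambda>t. X t \<omega> - expectation (X t)) = (\<lambda>T.
       avg (\<lambda>t. (if even t = True then X t \<omega> else 0) - expectation (\<lambda>\<omega>. if even t = True then X t \<omega> else 0)) T +
       avg (\<lambda>t. (if even t = False then X t \<omega> else 0) - expectation (\<lambda>\<omega>. if even t = False then X t \<omega> else 0)) T)"
      unfolding avg_add[symmetric] by (rule ext, rule arg_cong[where f = "\<lambda>f. avg f _"]) auto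
    with tendsto_add[OF elim] show ?case by simp
  qed
qed

end

section \<open>Uniform laws on intervals and boxes\<close>

definition unif :: "real \<Rightarrow> real measure" where
  "unif \<epsilon> = uniform_measure lborel {- \<epsilon> / 2 .. \<epsilon> / 2}"

lemma sets_unif [simp, measurable_cong]: "sets (unif \<epsilon>) = sets borel"
  by (simp add: unif_def)

lemma space_unif [simp]: "space (unif \<epsilon>) = UNIV"
  by (simp add: unif_def)

lemma prob_space_unif: "0 < \<epsilon> \<Longrightarrow> prob_space (unif \<epsilon>)"
  unfolding unif_def by (intro prob_space_uniform_measure) auto

lemma emeasure_unif: "A \<in> sets borel \<Longrightarrow>
    emeasure (unif \<epsilon>) A = emeasure lborel ({- \<epsilon> / 2 .. \<epsilon> / 2} \<inter> A) / emeasure lborel {- \<epsilon> / 2 .. \<epsilon> / 2}"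
  unfolding unif_def by (rule emeasure_uniform_measure) auto

lemma AE_unif: "0 < \<epsilon> \<Longrightarrow> AE s in unif \<epsilon>. \<bar>s\<bar> \<le> \<epsilon> / 2"
  unfolding unif_def by (rule AE_uniform_measureI) auto

lemma emeasure_lborel_reflect:
  fixes A :: "real set"
  assumes A: "A \<in> sets borel"
  shows "emeasure lborel {s. k - s \<in> A} = emeasure lborel A"
proof -
  have "lborel = distr lborel borel (\<lambda>s. k - s :: real)"
    using lborel_real_affine[of "-1" k] by (simp add: density_1 one_ennreal_def[symmetric])
  then have "emeasure lborel A = emeasure (distr lborel borel (\<lambda>s. k - s)) A" by simp
  also have "\<dots> = emeasure lborel {s. k - s \<in> A}"
    using A by (simp add: emeasure_distr vimage_def)
  finally show ?thesis ..
qed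

lemma distr_unif_uminus: "distr (unif \<epsilon>) borel uminus = unif \<epsilon>"
proof (rule measure_eqI)
  fix A :: "real set" assume "A \<in> sets (distr (unif \<epsilon>) borel uminus)"
  then have A: "A \<in> sets borel" by simp
  have "{s. 0 - s \<in> A} \<in> sets borel" using A by measurable
  have "emeasure (distr (unif \<epsilon>) borel uminus) A = emeasure (unif \<epsilon>) {s. 0 - s \<in> A}"
    using A by (simp add: emeasure_distr vimage_def)
  also have "{- \<epsilon> / 2 .. \<epsilon> / 2} \<inter> {s. 0 - s \<in> A} = {s. 0 - s \<in> {- \<epsilon> / 2 .. \<epsilon> / 2} \<inter> A}" by auto
  then have "emeasure (unif \<epsilon>) {s. 0 - s \<in> A} = emeasure (unif \<epsilon>) A"
    using emeasure_lborel_reflect[of "{- \<epsilon> / 2 .. \<epsilon> / 2} \<inter> A" 0] A \<open>{s. 0 - s \<in> A} \<in> sets borel\<close>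
    by (simp add: emeasure_unif del: diff_0)
  finally show "emeasure (distr (unif \<epsilon>) borel uminus) A = emeasure (unif \<epsilon>) A" .
qed simp

text \<open>On the support of the dither, the error \<open>quantizer (v + s) - s - v\<close> is piecewise a reflection of
  \<open>s\<close>: the two pieces left and right of the only quantization threshold \<open>w\<close> are each mapped onto the
  other end of the interval.\<close>

lemma distr_unif_quantizer_error:
  assumes \<epsilon>: "\<epsilon> = resolution ymin ymax b" "0 < \<epsilon>"
  shows "distr (unif \<epsilon>) borel (\<lambda>s. quantizer ymin ymax b (v + s) - s - v) = unif \<epsilon>" (is "distr _ _ ?e = _")
proof (rule measure_eqI)
  have me [measurable]: "?e \<in> borel_measurable borel"
    unfolding quantizer_def Let_def by measurable
  fix A :: "real set" assume "A \<in> sets (distr (unif \<epsilon>) borel ?e)"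
  then have A [measurable]: "A \<in> sets borel" by simp
  define I where "I = {- \<epsilon> / 2 .. \<epsilon> / 2}"
  \<comment> \<open>\<open>n\<close> is the index of the highest threshold that \<open>v + s\<close>
    can reach for a dither \<open>s\<close> up to \<open>\<epsilon> / 2\<close>, and
    \<open>w\<close> is the dither that reaches it exactly. Hence \<open>w\<close> lies in the
    dither interval, and the floor jumps there only.\<close>
  define n where "n = \<lfloor>(v - ymin) / \<epsilon> + 1 / 2\<rfloor>"
  define w where "w = \<epsilon> * n - (v - ymin)"
  have n: "real_of_int n \<le> (v - ymin) / \<epsilon> + 1 / 2" "(v - ymin) / \<epsilon> + 1 / 2 < real_of_int n + 1"
    unfolding n_def by linarith+
  have n': "\<epsilon> * n \<le> (v - ymin) + \<epsilon> / 2" "(v - ymin) + \<epsilon> / 2 < \<epsilon> * n + \<epsilon>"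
    using n \<epsilon>(2) by (simp_all add: field_simps)
  have w: "- \<epsilon> / 2 < w" "w \<le> \<epsilon> / 2" using n' by (auto simp: w_def)
  have e1: "?e s = w - \<epsilon> / 2 - s" if s: "- \<epsilon> / 2 \<le> s" "s < w" for s
  proof -
    have "\<lfloor>(v + s - ymin) / \<epsilon>\<rfloor> = n - 1"
      using s n' \<epsilon>(2) unfolding w_def by (intro floor_unique) (auto simp: field_simps)
    then show ?thesis unfolding quantizer_def Let_def \<epsilon>(1)[symmetric]
      by (simp only:) (simp add: w_def algebra_simps)
  qed
  have e2: "?e s = w + \<epsilon> / 2 - s" if s: "w \<le> s" "s \<le> \<epsilon> / 2" for s
  proof -
    have "\<lfloor>(v + s - ymin) / \<epsilon>\<rfloor> = n"
      using s n' \<epsilon>(2) unfolding w_def by (intro floor_unique) (auto simp: field_simps)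
    then show ?thesis unfolding quantizer_def Let_def \<epsilon>(1)[symmetric]
      by (simp only:) (simp add: w_def algebra_simps)
  qed
  \<comment> \<open>The images of the two half-open pieces overlap in \<open>w\<close> and leave out
    \<open>- \<epsilon> / 2\<close>. Both defects are single points and are removed as null sets
    below.\<close>
  let ?A1 = "A \<inter> {- \<epsilon> / 2 <.. w}" and ?A2 = "A \<inter> {w .. \<epsilon> / 2}"
  have "I \<inter> {s. ?e s \<in> A} = {s. (w - \<epsilon> / 2) - s \<in> ?A1} \<union> {s. (w + \<epsilon> / 2) - s \<in> ?A2}"
  proof (rule set_eqI)
    fix s
    consider "s < - \<epsilon> / 2 \<or> \<epsilon> / 2 < s" | "- \<epsilon> / 2 \<le> s" "s < w" | "w \<le> s" "s \<le> \<epsilon> / 2" by linarith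
    then show "s \<in> I \<inter> {s. ?e s \<in> A} \<longleftrightarrow> s \<in> {s. (w - \<epsilon> / 2) - s \<in> ?A1} \<union> {s. (w + \<epsilon> / 2) - s \<in> ?A2}"
    proof cases
      case 1
      then show ?thesis using w by (auto simp: I_def)
    next
      case 2
      then show ?thesis using w unfolding Int_iff mem_Collect_eq Un_iff e1[OF 2] by (auto simp: I_def)
    next
      case 3
      then show ?thesis using w unfolding Int_iff mem_Collect_eq Un_iff e2[OF 3] by (auto simp: I_def)
    qed
  qed
  then have "emeasure lborel (I \<inter> {s. ?e s \<in> A})
      = emeasure lborel {s. (w - \<epsilon> / 2) - s \<in> ?A1} + emeasure lborel {s. (w + \<epsilon> / 2) - s \<in> ?A2}"
    by (auto intro!: plus_emeasure[symmetric])
  also have "\<dots> = emeasure lborel ?A1 + emeasure lborel ?A2"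
    by (intro arg_cong2[where f = "(+)"] emeasure_lborel_reflect) auto
  also have "emeasure lborel ?A2 = emeasure lborel (A \<inter> {w <.. \<epsilon> / 2})"
    using AE_lborel_singleton[of w] by (intro emeasure_eq_AE) (auto elim!: eventually_mono)
  also have "emeasure lborel ?A1 + emeasure lborel (A \<inter> {w <.. \<epsilon> / 2}) = emeasure lborel (?A1 \<union> A \<inter> {w <.. \<epsilon> / 2})"
    by (intro plus_emeasure) auto
  also have "\<dots> = emeasure lborel (I \<inter> A)"
    using AE_lborel_singleton[of "- \<epsilon> / 2"] w by (intro emeasure_eq_AE) (auto simp: I_def elim!: eventually_mono)
  finally have "emeasure lborel (I \<inter> {s. ?e s \<in> A}) = emeasure lborel (I \<inter> A)" .
  moreover have "{s. ?e s \<in> A} \<in> sets borel" by measurable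
  ultimately have "emeasure (unif \<epsilon>) {s. ?e s \<in> A} = emeasure (unif \<epsilon>) A"
    by (simp add: emeasure_unif I_def)
  then show "emeasure (distr (unif \<epsilon>) borel ?e) A = emeasure (unif \<epsilon>) A"
    by (subst emeasure_distr) (auto simp: vimage_def)
qed simp

text \<open>Transporting the product law from coordinate functions to the vector space itself lets
  one definition cover whole data points \<open>(x', x, u)\<close>.\<close>

definition noise :: "real \<Rightarrow> 'a::euclidean_space measure" where
  "noise \<epsilon> = distr (PiM Basis (\<lambda>_. unif \<epsilon>)) borel (\<lambda>f. \<Sum>b\<in>Basis. f b *\<^sub>R b)"

lemma sets_noise [simp, measurable_cong]: "sets (noise \<epsilon>) = sets borel"
  by (simp add: noise_def)

lemma space_noise [simp]: "space (noise \<epsilon>) = UNIV"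
  by (simp add: noise_def)

lemma measurable_sum_Basis [measurable]:
  "(\<lambda>f. \<Sum>b\<in>Basis. f b *\<^sub>R b :: 'a::euclidean_space) \<in> borel_measurable (PiM Basis (\<lambda>_. unif \<epsilon>))"
  by measurable

lemma prob_space_noise: "0 < \<epsilon> \<Longrightarrow> prob_space (noise \<epsilon> :: 'a::euclidean_space measure)"
  unfolding noise_def by (intro prob_space.prob_space_distr prob_space_PiM prob_space_unif) auto

lemma sum_Basis_inner:
  "b \<in> Basis \<Longrightarrow> (\<Sum>b\<in>Basis. f b *\<^sub>R b :: 'a::euclidean_space) \<bullet> b = f b"
  by (simp add: inner_sum_left inner_Basis if_distrib sum.delta cong: if_cong)

lemma AE_noise:
  assumes "0 < \<epsilon>"
  shows "AE e in (noise \<epsilon> :: 'a::euclidean_space measure). \<forall>b\<in>Basis. \<bar>e \<bullet> b\<bar> \<le> \<epsilon> / 2"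
proof -
  have "AE f in PiM (Basis :: 'a set) (\<lambda>_. unif \<epsilon>). \<bar>f b\<bar> \<le> \<epsilon> / 2" if "b \<in> Basis" for b
    using that assms by (intro AE_PiM_component[where M = "\<lambda>_. unif \<epsilon>"] prob_space_unif AE_unif)
  then have "AE f in PiM (Basis :: 'a set) (\<lambda>_. unif \<epsilon>). \<forall>b\<in>Basis. \<bar>f b\<bar> \<le> \<epsilon> / 2"
    by (intro AE_finite_allI) auto
  then show ?thesis unfolding noise_def
    by (subst AE_distr_iff) (auto simp: sum_Basis_inner)
qed

text \<open>Independence says that the joint law of the coordinates is the product of their laws,
  and the vector is recovered from its coordinates.\<close>

lemma (in prob_space) distr_eq_noise:
  fixes X :: "'a \<Rightarrow> 'b::euclidean_space"
  assumes ind: "indep_vars (\<lambda>_. borel) (\<lambda>b \<omega>. X \<omega> \<bullet> b) Basis"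
    and un: "\<And>b. b \<in> Basis \<Longrightarrow> distr M borel (\<lambda>\<omega>. X \<omega> \<bullet> b) = unif \<epsilon>"
  shows "distr M borel X = noise \<epsilon>"
proof -
  have rv [measurable]: "random_variable borel (\<lambda>\<omega>. X \<omega> \<bullet> b)" if "b \<in> Basis" for b
    using ind that by (auto simp: indep_vars_def)
  have "distr M (PiM Basis (\<lambda>_. borel)) (\<lambda>\<omega>. \<lambda>b\<in>Basis. X \<omega> \<bullet> b) = PiM Basis (\<lambda>b. distr M borel (\<lambda>\<omega>. X \<omega> \<bullet> b))"
    using ind by (subst (asm) indep_vars_iff_distr_eq_PiM') (auto simp: rv)
  also have "\<dots> = PiM Basis (\<lambda>_. unif \<epsilon>)"
    by (intro PiM_cong refl un)
  finally have "noise \<epsilon> = distr (distr M (PiM Basis (\<lambda>_. borel)) (\<lambda>\<omega>. \<lambda>b\<in>Basis. X \<omega> \<bullet> b)) borel (\<lambda>f. \<Sum>b\<in>Basis. f b *\<^sub>R b :: 'b)"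
    by (simp add: noise_def)
  also have "\<dots> = distr M borel ((\<lambda>f. \<Sum>b\<in>Basis. f b *\<^sub>R b :: 'b) \<circ> (\<lambda>\<omega>. \<lambda>b\<in>Basis. X \<omega> \<bullet> b))"
    by (intro distr_distr measurable_restrict rv) auto
  also have "(\<lambda>f. \<Sum>b\<in>Basis. f b *\<^sub>R b :: 'b) \<circ> (\<lambda>\<omega>. \<lambda>b\<in>Basis. X \<omega> \<bullet> b) = X"
    by (auto simp: fun_eq_iff euclidean_representation)
  finally show ?thesis ..
qed

lemma indep_vars_noise:
  assumes "0 < \<epsilon>"
  shows "prob_space.indep_vars (noise \<epsilon> :: 'a::euclidean_space measure) (\<lambda>_. borel) (\<lambda>b e. e \<bullet> b) Basis"
    and "b \<in> Basis \<Longrightarrow> distr (noise \<epsilon> :: 'a measure) borel (\<lambda>e. e \<bullet> b) = unif \<epsilon>"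
proof -
  interpret prob_space "noise \<epsilon> :: 'a measure" using assms by (rule prob_space_noise)
  have d: "distr (noise \<epsilon> :: 'a measure) borel (\<lambda>e. e \<bullet> b) = unif \<epsilon>" if b: "b \<in> Basis" for b
  proof -
    have "distr (noise \<epsilon> :: 'a measure) borel (\<lambda>e. e \<bullet> b)
        = distr (PiM (Basis :: 'a set) (\<lambda>_. unif \<epsilon>)) borel ((\<lambda>e. e \<bullet> b) \<circ> (\<lambda>f. \<Sum>b\<in>Basis. f b *\<^sub>R b))"
      unfolding noise_def by (intro distr_distr) auto
    also have "\<dots> = distr (PiM (Basis :: 'a set) (\<lambda>_. unif \<epsilon>)) (unif \<epsilon>) (\<lambda>f. f b)"
      using b by (intro distr_cong) (auto simp: sum_Basis_inner)
    also have "\<dots> = unif \<epsilon>"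
      using b assms by (intro distr_PiM_component[where M = "\<lambda>_. unif \<epsilon>"] prob_space_unif)
    finally show ?thesis .
  qed
  then show "b \<in> Basis \<Longrightarrow> distr (noise \<epsilon> :: 'a measure) borel (\<lambda>e. e \<bullet> b) = unif \<epsilon>" .
  have "distr (noise \<epsilon>) (PiM Basis (\<lambda>_. borel)) (\<lambda>e. \<lambda>b\<in>Basis. e \<bullet> b)
      = distr (PiM (Basis :: 'a set) (\<lambda>_. unif \<epsilon>)) (PiM Basis (\<lambda>_. borel)) ((\<lambda>e. \<lambda>b\<in>Basis. e \<bullet> b) \<circ> (\<lambda>f. \<Sum>b\<in>Basis. f b *\<^sub>R b))"
    unfolding noise_def by (intro distr_distr measurable_restrict) auto
  also have "\<dots> = distr (PiM (Basis :: 'a set) (\<lambda>_. unif \<epsilon>)) (PiM Basis (\<lambda>_. unif \<epsilon>)) (\<lambda>f. f)"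
  proof (rule distr_cong)
    fix f assume "f \<in> space (PiM (Basis :: 'a set) (\<lambda>_. unif \<epsilon>))"
    then have "f \<in> extensional Basis" by (auto simp: space_PiM PiE_def)
    then show "((\<lambda>e. \<lambda>b\<in>Basis. e \<bullet> b) \<circ> (\<lambda>f. \<Sum>b\<in>Basis. f b *\<^sub>R b)) f = f"
      by (auto simp: fun_eq_iff restrict_def sum_Basis_inner extensional_def)
  qed (auto intro!: sets_PiM_cong)
  also have "\<dots> = PiM Basis (\<lambda>b. distr (noise \<epsilon> :: 'a measure) borel (\<lambda>e. e \<bullet> b))"
    by (simp add: d cong: PiM_cong)
  finally show "indep_vars (\<lambda>_. borel) (\<lambda>b e. (e::'a) \<bullet> b) Basis"
    by (subst indep_vars_iff_distr_eq_PiM') auto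
qed

text \<open>Negation preserves independence of the coordinates and each of their symmetric laws, so
  \<open>distr_eq_noise\<close> reassembles the same law.\<close>

lemma distr_noise_uminus:
  assumes "0 < \<epsilon>"
  shows "distr (noise \<epsilon> :: 'a::euclidean_space measure) borel uminus = noise \<epsilon>"
proof -
  interpret prob_space "noise \<epsilon> :: 'a measure" using assms by (rule prob_space_noise)
  show ?thesis
  proof (rule distr_eq_noise)
    show "indep_vars (\<lambda>_. borel) (\<lambda>b e. (- e :: 'a) \<bullet> b) Basis"
      using indep_vars_compose2[OF indep_vars_noise(1)[OF assms], of "\<lambda>_. uminus" "\<lambda>_. borel"] by simp
    fix b :: 'a assume b: "b \<in> Basis"
    have "distr (noise \<epsilon>) borel (\<lambda>e. - e \<bullet> b) = distr (distr (noise \<epsilon>) borel (\<lambda>e. e \<bullet> b)) borel uminus"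
      by (subst distr_distr) (auto simp: comp_def)
    then show "distr (noise \<epsilon>) borel (\<lambda>e. - e \<bullet> b) = unif \<epsilon>"
      by (simp add: indep_vars_noise(2)[OF assms b] distr_unif_uminus)
  qed
qed

text \<open>A small coordinate box around \<open>e0\<close>, clipped to the noise box, lies in
  \<open>U\<close> and has positive product measure because every side has positive length.\<close>

lemma noise_full_support:
  fixes e0 :: "'a::euclidean_space"
  assumes \<epsilon>: "0 < \<epsilon>" and U: "open U" "e0 \<in> U" and e0: "\<And>b. b \<in> Basis \<Longrightarrow> \<bar>e0 \<bullet> b\<bar> < \<epsilon> / 2"
    and ae: "AE e in noise \<epsilon>. e \<notin> U"
  shows False
proof -
  obtain r where r: "0 < r" "ball e0 r \<subseteq> U" using U open_contains_ball by blast
  \<comment> \<open>Dividing by the dimension suffices because the norm is at most the sum of the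
    coordinate moduli.\<close>
  define \<delta> where "\<delta> = r / DIM('a)"
  have \<delta>: "0 < \<delta>" using r by (simp add: \<delta>_def)
  define J where "J b = {max (e0 \<bullet> b - \<delta>) (- \<epsilon> / 2) <..< min (e0 \<bullet> b + \<delta>) (\<epsilon> / 2)}" for b
  interpret product_prob_space "\<lambda>_. unif \<epsilon>" "Basis :: 'a set"
    by (rule product_prob_spaceI) (rule prob_space_unif[OF \<epsilon>])
  have "AE f in PiM (Basis :: 'a set) (\<lambda>_. unif \<epsilon>). (\<Sum>b\<in>Basis. f b *\<^sub>R b) \<notin> U"
  proof -
    have "{x. x \<notin> U} \<in> sets borel" using U(1) by (simp flip: Compl_eq)
    then show ?thesis using ae unfolding noise_def by (subst (asm) AE_distr_iff) auto
  qed
  moreover have "(\<Sum>b\<in>Basis. f b *\<^sub>R b) \<in> U" if "\<And>b. b \<in> Basis \<Longrightarrow> f b \<in> J b" for f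
  proof -
    have "norm ((\<Sum>b\<in>Basis. f b *\<^sub>R b) - e0) \<le> (\<Sum>b\<in>Basis. \<bar>((\<Sum>b\<in>Basis. f b *\<^sub>R b) - e0) \<bullet> b\<bar>)"
      by (rule norm_le_l1)
    also have "\<dots> < (\<Sum>b\<in>(Basis::'a set). \<delta>)"
      using that by (intro sum_strict_mono) (fastforce simp: inner_diff_left sum_Basis_inner J_def abs_if)+
    also have "\<dots> = r" by (simp add: \<delta>_def)
    finally show ?thesis using r(2) by (auto simp: subset_iff dist_norm norm_minus_commute)
  qed
  ultimately have "AE f in PiM (Basis :: 'a set) (\<lambda>_. unif \<epsilon>). f \<notin> Pi\<^sub>E Basis J"
    by (auto elim!: eventually_mono simp: PiE_def)
  then have "emeasure (PiM (Basis :: 'a set) (\<lambda>_. unif \<epsilon>)) (Pi\<^sub>E Basis J) = 0"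
    by (rule AE_iff_measurable[THEN iffD1, rotated 2])
      (auto simp: space_PiM J_def PiE_iff extensional_def intro!: sets_PiM_I_finite)
  also have "emeasure (PiM (Basis :: 'a set) (\<lambda>_. unif \<epsilon>)) (Pi\<^sub>E Basis J) = (\<Prod>b\<in>Basis. emeasure (unif \<epsilon>) (J b))"
    by (intro emeasure_PiM) (auto simp: J_def)
  finally obtain b where b: "b \<in> Basis" "emeasure (unif \<epsilon>) (J b) = 0" by auto
  have "{- \<epsilon> / 2 .. \<epsilon> / 2} \<inter> J b = J b" unfolding J_def by auto
  moreover have "emeasure lborel (J b) > 0"
  proof -
    have "- (\<epsilon> / 2) < e0 \<bullet> b" "e0 \<bullet> b < \<epsilon> / 2" using e0[OF b(1)] by linarith+
    then have "max (e0 \<bullet> b - \<delta>) (- \<epsilon> / 2) < min (e0 \<bullet> b + \<delta>) (\<epsilon> / 2)"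
      unfolding max_less_iff_conj min_less_iff_conj using \<delta> \<epsilon> by auto
    then show ?thesis unfolding J_def by (subst emeasure_lborel_Ioo) auto
  qed
  ultimately show False using b(2) \<epsilon> by (simp add: emeasure_unif J_def ennreal_divide_eq_0_iff)
qed

section \<open>Averaging analytic functions over the noise\<close>

text \<open>The majorants of the expansions at different \<open>p t\<close> are unrelated. Finitely
  many balls around data points cover the closure of the data, so every \<open>p t\<close> is an
  offset of one of finitely many centres, and only their majorants enter \<open>C\<close>. Radii
  strictly above \<open>\<rho>\<close> make the majorant at \<open>\<rho>\<close> itself
  finite.\<close>

lemma uniform_second_difference:
  fixes p :: "nat \<Rightarrow> 'a::euclidean_space"
  assumes bp: "bounded (range p)" and \<rho>: "0 < \<rho>"
    and ex: "\<And>t. \<exists>R>\<rho>. \<exists>c. box_expansion F (p t) R c"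
  shows "\<exists>C\<ge>0. \<forall>t \<delta> h. 0 \<le> \<delta> \<longrightarrow> \<delta> \<le> \<rho> / 2 \<longrightarrow> (\<forall>b\<in>Basis. \<bar>h \<bullet> b\<bar> \<le> \<delta>) \<longrightarrow>
           \<bar>F (p t + h) + F (p t - h) - 2 * F (p t)\<bar> \<le> C * \<delta>\<^sup>2"
proof -
  from ex obtain R c where Rc: "\<And>t. \<rho> < R t" "\<And>t. box_expansion F (p t) (R t) (c t)" by metis
  define S where "S t = infsum (\<lambda>bs. \<bar>c t bs\<bar> * \<rho> ^ length bs) (lists Basis)" for t
  have S0: "0 \<le> S t" for t unfolding S_def using \<rho> by (intro infsum_nonneg) auto
  have "compact (closure (range p))" using bp by simp
  moreover have "closure (range p) \<subseteq> (\<Union>t. ball (p t) (\<rho> / 2))"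
  proof
    fix q assume "q \<in> closure (range p)"
    then obtain t where "dist (p t) q < \<rho> / 2"
      using \<rho> by (auto simp: closure_approachable dest!: spec[of _ "\<rho> / 2"])
    then show "q \<in> (\<Union>t. ball (p t) (\<rho> / 2))" by auto
  qed
  ultimately obtain N where N: "finite N" "closure (range p) \<subseteq> (\<Union>t\<in>N. ball (p t) (\<rho> / 2))"
    using compactE_image[of "closure (range p)" UNIV "\<lambda>t. ball (p t) (\<rho> / 2)"] by (metis open_ball)
  \<comment> \<open>With \<open>\<tau> = 2 * \<delta> / \<rho>\<close> the bound
    \<open>2 * \<tau>^2\<close> becomes \<open>8 / \<rho>^2\<close> times \<open>\<delta>^2\<close>;
    the sum over \<open>N\<close> stands in for a maximum.\<close>
  define C where "C = 8 / \<rho>\<^sup>2 * (\<Sum>t\<in>N. S t)"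
  show ?thesis
  proof (intro exI[of _ C] conjI allI impI)
    show "0 \<le> C" unfolding C_def by (intro mult_nonneg_nonneg sum_nonneg S0) auto
    fix t \<delta> and h :: 'a assume \<delta>: "0 \<le> \<delta>" "\<delta> \<le> \<rho> / 2" and h: "\<forall>b\<in>Basis. \<bar>h \<bullet> b\<bar> \<le> \<delta>"
    have "p t \<in> (\<Union>t\<in>N. ball (p t) (\<rho> / 2))" using subsetD[OF N(2) subsetD[OF closure_subset]] by blast
    then obtain s where s: "s \<in> N" "dist (p s) (p t) < \<rho> / 2" by auto
    define d where "d = p t - p s"
    have d: "\<bar>d \<bullet> b\<bar> \<le> \<rho> / 2" if "b \<in> Basis" for b
      using Basis_le_norm[OF that, of d] s(2) by (simp add: d_def dist_norm norm_minus_commute)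
    have "\<bar>F (p s + d + h) + F (p s + d - h) - 2 * F (p s + d)\<bar> \<le> 2 * (2 * \<delta> / \<rho>)\<^sup>2 * S s"
      unfolding S_def using \<delta> \<rho> h
      by (intro box_expansion_second_difference[OF Rc(2) \<rho> Rc(1)] d) (auto simp: field_simps)
    also have "\<dots> = 8 / \<rho>\<^sup>2 * S s * \<delta>\<^sup>2" by (simp add: power2_eq_square)
    also have "\<dots> \<le> C * \<delta>\<^sup>2"
      unfolding C_def using N(1) s(1) S0 by (intro mult_right_mono mult_left_mono member_le_sum) auto
    finally show "\<bar>F (p t + h) + F (p t - h) - 2 * F (p t)\<bar> \<le> C * \<delta>\<^sup>2" by (simp add: d_def)
  qed
qed

text \<open>All shifted points stay in one ball, whose radius exceeds that of \<open>P\<close> by at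
  most the dimension times \<open>r\<close>; continuity on this compact ball gives the
  bound.\<close>

lemma bounded_on_box_shifts:
  fixes F :: "'a::euclidean_space \<Rightarrow> real"
  assumes "continuous_on UNIV F" "bounded P"
  obtains c where "0 < c" "\<And>p e. p \<in> P \<Longrightarrow> \<forall>b\<in>Basis. \<bar>e \<bullet> b\<bar> \<le> r \<Longrightarrow> \<bar>F (p + e)\<bar> \<le> c"
proof -
  obtain k where k: "\<And>p. p \<in> P \<Longrightarrow> norm p \<le> k" using assms(2) by (auto simp: bounded_iff)
  have "compact (F ` cball 0 (k + DIM('a) * r))"
    using assms(1) by (intro compact_continuous_image) (auto intro: continuous_on_subset)
  then obtain c where c: "0 < c" "\<forall>v\<in>F ` cball 0 (k + DIM('a) * r). norm v \<le> c"
    using compact_imp_bounded bounded_pos by metis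
  show thesis
  proof (rule that[OF c(1)])
    fix p e :: 'a assume p: "p \<in> P" and e: "\<forall>b\<in>Basis. \<bar>e \<bullet> b\<bar> \<le> r"
    have "norm e \<le> (\<Sum>b\<in>(Basis::'a set). r)"
      using e by (intro order_trans[OF norm_le_l1] sum_mono) auto
    then have "norm (p + e) \<le> k + DIM('a) * r"
      using k[OF p] norm_triangle_ineq[of p e] by simp
    then show "\<bar>F (p + e)\<bar> \<le> c" using c(2) by simp
  qed
qed

lemma integrable_noise:
  fixes F :: "'a::euclidean_space \<Rightarrow> real"
  assumes F: "continuous_on UNIV F" and \<epsilon>: "0 < \<epsilon>"
  shows "integrable (noise \<epsilon>) (\<lambda>e. F (p + e))"
proof -
  interpret prob_space "noise \<epsilon> :: 'a measure" using \<epsilon> by (rule prob_space_noise)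
  obtain c where "\<And>q e. q \<in> {p} \<Longrightarrow> \<forall>b\<in>Basis. \<bar>e \<bullet> b\<bar> \<le> \<epsilon> / 2 \<Longrightarrow> \<bar>F (q + e)\<bar> \<le> c"
    using bounded_on_box_shifts[OF F, of "{p}"] by (metis bounded_insert bounded_empty)
  then have "AE e in noise \<epsilon>. norm (F (p + e)) \<le> c"
    using AE_noise[OF \<epsilon>, where 'a = 'a] by (auto elim!: eventually_mono)
  moreover have "continuous_on UNIV (\<lambda>e. F (p + e))"
    by (intro continuous_on_compose2[OF F] continuous_intros) auto
  then have "(\<lambda>e. F (p + e)) \<in> borel_measurable (noise \<epsilon>)"
    using borel_measurable_continuous_onI measurable_cong_sets[OF sets_noise refl] by blast
  ultimately show ?thesis by (rule integrable_const_bound)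
qed

text \<open>The noise is symmetric, so first-order terms cancel.\<close>

lemma noise_bias_le:
  fixes F :: "'a::euclidean_space \<Rightarrow> real"
  assumes F: "continuous_on UNIV F" and \<epsilon>: "0 < \<epsilon>"
    and C: "\<And>h. \<forall>b\<in>Basis. \<bar>h \<bullet> b\<bar> \<le> \<epsilon> / 2 \<Longrightarrow> \<bar>F (p + h) + F (p - h) - 2 * F p\<bar> \<le> C"
  shows "\<bar>(\<integral>e. F (p + e) \<partial>noise \<epsilon>) - F p\<bar> \<le> C / 2"
proof -
  interpret prob_space "noise \<epsilon> :: 'a measure" using \<epsilon> by (rule prob_space_noise)
  note int = integrable_noise[OF F \<epsilon>]
  have m: "(\<lambda>e. F (p + e)) \<in> borel_measurable borel" using int[of p] by (auto dest: borel_measurable_integrable)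
  have "(\<integral>e. F (p + e) \<partial>noise \<epsilon>) = (\<integral>e. F (p + e) \<partial>distr (noise \<epsilon>) borel uminus)"
    using distr_noise_uminus[OF \<epsilon>, where 'a = 'a] by simp
  also have "\<dots> = (\<integral>e. F (p - e) \<partial>noise \<epsilon>)"
    using m by (subst integral_distr) auto
  finally have sym: "(\<integral>e. F (p - e) \<partial>noise \<epsilon>) = (\<integral>e. F (p + e) \<partial>noise \<epsilon>)" ..
  have int': "integrable (noise \<epsilon>) (\<lambda>e. F (p - e))"
    using int[of p] m integrable_distr_eq[of uminus "noise \<epsilon>" borel "\<lambda>e. F (p + e)"]
    by (simp add: distr_noise_uminus[OF \<epsilon>])
  \<comment> \<open>Reflected noise has the same mean, so the mean of the second difference is twice
    the bias; hence the bound \<open>C / 2\<close>.\<close>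
  have "(\<integral>e. F (p + e) + F (p - e) - 2 * F p \<partial>noise \<epsilon>) = 2 * ((\<integral>e. F (p + e) \<partial>noise \<epsilon>) - F p)"
    using int int' sym by (simp add: prob_space[unfolded space_noise])
  moreover have "\<bar>\<integral>e. F (p + e) + F (p - e) - 2 * F p \<partial>noise \<epsilon>\<bar> \<le> expectation (\<lambda>_. C)"
  proof -
    have ae: "AE e in noise \<epsilon>. \<bar>F (p + e) + F (p - e) - 2 * F p\<bar> \<le> C"
      using AE_noise[OF \<epsilon>, where 'a = 'a] C by (auto elim!: eventually_mono)
    have "(\<integral>e. \<bar>F (p + e) + F (p - e) - 2 * F p\<bar> \<partial>noise \<epsilon>) \<le> expectation (\<lambda>_. C)"
      by (rule integral_mono_AE) (use int int' ae in auto)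
    then show ?thesis by (rule order_trans[OF integral_abs_bound])
  qed
  moreover have "expectation (\<lambda>_. C) = C" by (simp add: prob_space[unfolded space_noise])
  ultimately have "\<bar>2 * ((\<integral>e. F (p + e) \<partial>noise \<epsilon>) - F p)\<bar> \<le> C" by (simp only:)
  then show ?thesis unfolding abs_mult by simp
qed

text \<open>If the mean of \<open>G (p t + e)\<close> is small, \<open>p t\<close> is close to a point around which \<open>G\<close> vanishes on
  the whole noise box; the identity theorem then makes \<open>G\<close> vanish on the noise box around \<open>p t\<close>.\<close>

lemma sparse_nonvanishing:
  fixes p :: "nat \<Rightarrow> 'a::euclidean_space"
  assumes G: "continuous_on UNIV G" "\<And>q. 0 \<le> G q" and \<epsilon>: "0 < \<epsilon>" and bp: "bounded (range p)"
    and ex: "\<And>t. \<exists>R>\<epsilon> / 2. \<exists>c. box_expansion G (p t) R c"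
    and lim: "avg (\<lambda>t. \<integral>e. G (p t + e) \<partial>noise \<epsilon>) \<longlonglongrightarrow> 0"
  shows "avg (\<lambda>t. of_bool (\<exists>e. (\<forall>b\<in>Basis. \<bar>e \<bullet> b\<bar> \<le> \<epsilon> / 2) \<and> G (p t + e) \<noteq> 0)) \<longlonglongrightarrow> 0"
proof -
  interpret prob_space "noise \<epsilon> :: 'a measure" using \<epsilon> by (rule prob_space_noise)
  define S where "S = {t. \<exists>e. (\<forall>b\<in>Basis. \<bar>e \<bullet> b\<bar> \<le> \<epsilon> / 2) \<and> G (p t + e) \<noteq> 0}"
  define g where "g t = (\<integral>e. G (p t + e) \<partial>noise \<epsilon>)" for t
  have g0: "0 \<le> g t" for t unfolding g_def using G(2) by simp
  \<comment> \<open>A positive lower bound for the means on \<open>S\<close> suffices: then the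
    indicator of \<open>S\<close> is at most \<open>g / \<eta>\<close>, whose averages vanish in the
    limit.\<close>
  have "\<exists>\<eta>>0. \<forall>t\<in>S. \<eta> \<le> g t"
  proof (rule ccontr)
    assume "\<not> (\<exists>\<eta>>0. \<forall>t\<in>S. \<eta> \<le> g t)"
    then have "\<forall>k. \<exists>t\<in>S. g t < 1 / real (Suc k)" by (auto simp: not_le)
    then obtain s where s: "\<And>k. s k \<in> S" "\<And>k. g (s k) < 1 / real (Suc k)" by metis
    have "compact (closure (range p))" using bp by simp
    moreover have "\<forall>k. p (s k) \<in> closure (range p)" using closure_subset[of "range p"] by auto
    ultimately obtain z r where r: "strict_mono r" "((\<lambda>k. p (s k)) \<circ> r) \<longlonglongrightarrow> z"
      unfolding compact_def by metis
    then have pz: "(\<lambda>k. p (s (r k))) \<longlonglongrightarrow> z" by (simp add: comp_def)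
    obtain c where c: "\<And>q e. q \<in> range p \<Longrightarrow> \<forall>b\<in>Basis. \<bar>e \<bullet> b\<bar> \<le> \<epsilon> / 2 \<Longrightarrow> \<bar>G (q + e)\<bar> \<le> c"
      using bounded_on_box_shifts[OF G(1) bp] by metis
    have "(\<lambda>k. g (s (r k))) \<longlonglongrightarrow> (\<integral>e. G (z + e) \<partial>noise \<epsilon>)"
      unfolding g_def
    proof (rule integral_dominated_convergence[where w = "\<lambda>_. c"])
      show "AE e in noise \<epsilon>. (\<lambda>k. G (p (s (r k)) + e)) \<longlonglongrightarrow> G (z + e)"
        using G(1) by (intro AE_I2 continuous_on_tendsto_compose[OF G(1)] tendsto_intros pz) auto
      show "AE e in noise \<epsilon>. norm (G (p (s (r k)) + e)) \<le> c" for k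
        using AE_noise[OF \<epsilon>, where 'a = 'a] c by (auto elim!: eventually_mono)
    qed (use integrable_noise[OF G(1) \<epsilon>] in \<open>auto dest: borel_measurable_integrable\<close>)
    moreover have "(\<lambda>k. g (s (r k))) \<longlonglongrightarrow> 0"
    proof (rule tendsto_0_dominated)
      show "\<bar>g (s (r k))\<bar> \<le> 1 / real (Suc k)" for k
      proof -
        have "1 / real (Suc (r k)) \<le> 1 / real (Suc k)"
          using seq_suble[OF r(1), of k] by (simp add: field_simps)
        then show ?thesis using s(2)[of "r k"] g0[of "s (r k)"] by linarith
      qed
      show "(\<lambda>k. 1 / real (Suc k)) \<longlonglongrightarrow> 0" by (rule LIMSEQ_inverse_real_of_nat[unfolded inverse_eq_divide])
    qed
    ultimately have "(\<integral>e. G (z + e) \<partial>noise \<epsilon>) = 0" by (rule LIMSEQ_unique)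
    then have ae: "AE e in noise \<epsilon>. G (z + e) = 0"
      using integral_nonneg_eq_0_iff_AE[OF integrable_noise[OF G(1) \<epsilon>]] G(2) by simp
    have Gz: "G (z + e0) = 0" if e0: "\<And>b. b \<in> Basis \<Longrightarrow> \<bar>e0 \<bullet> b\<bar> < \<epsilon> / 2" for e0
    proof (rule ccontr)
      assume "G (z + e0) \<noteq> 0"
      have "continuous_on UNIV (\<lambda>e. G (z + e))"
        by (intro continuous_on_compose2[OF G(1)] continuous_intros) auto
      then have "open {e. G (z + e) \<noteq> 0}"
        by (intro open_Collect_neq continuous_intros)
      then show False
        by (rule noise_full_support[OF \<epsilon> _ _ e0]) (use \<open>G (z + e0) \<noteq> 0\<close> ae in auto)
    qed
    have "\<forall>\<^sub>F k in sequentially. dist (p (s (r k))) z < \<epsilon> / 2"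
      using pz \<epsilon> by (intro tendstoD) auto
    then obtain k where k: "dist (p (s (r k))) z < \<epsilon> / 2"
      by (auto simp: eventually_sequentially)
    \<comment> \<open>No expansion is available at the limit point \<open>z\<close>. A data point
      \<open>q\<close> within \<open>\<epsilon> / 2\<close> of \<open>z\<close> has one whose box
      contains \<open>z\<close>, and \<open>G\<close> vanishes on a ball around \<open>z\<close>, so
      the identity theorem applies with offset \<open>z - q\<close>.\<close>
    define q where "q = p (s (r k))"
    obtain R c where R: "\<epsilon> / 2 < R" "box_expansion G q R c" using ex unfolding q_def by blast
    have "G (q + h) = 0" if h: "\<forall>b\<in>Basis. \<bar>h \<bullet> b\<bar> \<le> \<epsilon> / 2" for h
    proof (rule box_expansion_identity[OF R(2), of "\<epsilon> / 2" "z - q"])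
      fix b :: 'a assume b: "b \<in> Basis"
      have "\<bar>(z - q) \<bullet> b\<bar> \<le> norm (z - q)" using b by (rule Basis_le_norm)
      also have "\<dots> < \<epsilon> / 2" using k by (simp add: q_def dist_norm norm_minus_commute)
      finally show "\<bar>(z - q) \<bullet> b\<bar> < R" using R(1) by simp
      show "\<bar>h \<bullet> b\<bar> < R" using h b R(1) by (auto intro: le_less_trans)
    next
      fix v assume v: "norm (v - (q + (z - q))) < \<epsilon> / 2"
      have "G (z + (v - z)) = 0"
      proof (rule Gz)
        fix b :: 'a assume b: "b \<in> Basis"
        show "\<bar>(v - z) \<bullet> b\<bar> < \<epsilon> / 2" using v Basis_le_norm[OF b, of "v - z"] by simp
      qed
      then show "G v = 0" by simp
    qed (use \<epsilon> in auto)
    then show False using s(1)[of "r k"] by (auto simp: S_def q_def)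
  qed
  then obtain \<eta> where \<eta>: "0 < \<eta>" "\<And>t. t \<in> S \<Longrightarrow> \<eta> \<le> g t" by blast
  have "avg (\<lambda>t. of_bool (t \<in> S)) \<longlonglongrightarrow> 0"
  proof (rule tendsto_0_dominated)
    fix T
    have "0 \<le> avg (\<lambda>t. of_bool (t \<in> S)) T" by (rule avg_nonneg) simp
    moreover have "avg (\<lambda>t. of_bool (t \<in> S)) T \<le> avg (\<lambda>t. 1 / \<eta> * g t) T"
      using \<eta> g0 by (intro avg_mono) (auto simp: field_simps)
    ultimately show "\<bar>avg (\<lambda>t. of_bool (t \<in> S)) T\<bar> \<le> 1 / \<eta> * avg g T"
      by (simp only: avg_cmult abs_of_nonneg)
    show "(\<lambda>T. 1 / \<eta> * avg g T) \<longlonglongrightarrow> 0"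
      using lim unfolding g_def[abs_def] by (rule tendsto_mult_right_zero)
  qed
  then show ?thesis by (simp add: S_def)
qed

section \<open>Dithered data\<close>

definition data_point :: "(nat \<Rightarrow> real^'n) \<Rightarrow> (nat \<Rightarrow> real^'m) \<Rightarrow> nat \<Rightarrow> (real^'n) \<times> (real^'n) \<times> (real^'m)" where
  "data_point x u t = (x (Suc t), x t, u t)"

text \<open>The scalar dither that acts on a given coordinate direction of the data point at time
  \<open>t\<close>. The first component is the next state and thus uses time \<open>Suc t\<close>;
  consecutive data points share these dithers, which is the source of one-dependence.\<close>

definition noise_index :: "nat \<Rightarrow> (real^'n) \<times> (real^'n) \<times> (real^'m) \<Rightarrow> nat \<times> ('n + 'm)" where
  "noise_index t b =
     (if fst b \<noteq> 0 then (Suc t, Inl (axis_index (fst b)))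
      else if fst (snd b) \<noteq> 0 then (t, Inl (axis_index (fst (snd b))))
      else (t, Inr (axis_index (snd (snd b)))))"

lemma Basis_triple_cases:
  fixes b :: "(real^'n) \<times> (real^'n) \<times> (real^'m)"
  assumes "b \<in> Basis"
  obtains i where "b = (axis i 1, 0, 0)" | i where "b = (0, axis i 1, 0)" | j where "b = (0, 0, axis j 1)"
proof -
  have "(\<exists>i. b = (axis i 1, 0, 0)) \<or> (\<exists>i. b = (0, axis i 1, 0)) \<or> (\<exists>j. b = (0, 0, axis j 1))"
    using assms by (auto simp: Basis_prod_def zero_prod_def dest!: axis_inverse)
  then show thesis using that by blast
qed

lemma noise_index_simps [simp]:
  "noise_index t (axis i 1, 0, 0) = (Suc t, Inl i)"
  "noise_index t (0, axis i 1, 0) = (t, Inl i)"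
  "noise_index t (0, 0, axis j 1) = (t, Inr j)"
  by (simp_all add: noise_index_def)

lemma inj_on_noise_index: "inj_on (noise_index t) Basis"
proof (rule inj_onI)
  fix b b' :: "(real^'a) \<times> (real^'a) \<times> (real^'b)"
  assume "b \<in> Basis" "b' \<in> Basis" and eq: "noise_index t b = noise_index t b'"
  show "b = b'"
    by (rule Basis_triple_cases[OF \<open>b \<in> Basis\<close>]; rule Basis_triple_cases[OF \<open>b' \<in> Basis\<close>]) (use eq in auto)
qed

lemma noise_index_in: "noise_index t b \<in> {t, Suc t} \<times> UNIV"
  by (simp add: noise_index_def)

locale dithered_data = prob_space M for M :: "'w measure" +
  fixes ymin ymax \<epsilon> :: real and b :: nat and x :: "nat \<Rightarrow> real^'n" and u :: "nat \<Rightarrow> real^'m"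
    and wx :: "nat \<Rightarrow> 'w \<Rightarrow> real^'n" and wu :: "nat \<Rightarrow> 'w \<Rightarrow> real^'m"
  assumes \<epsilon>: "\<epsilon> = resolution ymin ymax b" and \<epsilon>_pos: "0 < \<epsilon>" and dither: "dither M \<epsilon> wx wu"
begin

definition quantized_point :: "nat \<Rightarrow> 'w \<Rightarrow> (real^'n) \<times> (real^'n) \<times> (real^'m)" where
  "quantized_point t \<omega> = data_point (\<lambda>t. dither_quantize ymin ymax b (wx t \<omega>) (x t))
      (\<lambda>t. dither_quantize ymin ymax b (wu t \<omega>) (u t)) t"

definition dith :: "nat \<times> ('n + 'm) \<Rightarrow> 'w \<Rightarrow> real" where
  "dith = (\<lambda>(t, k) \<omega>. case k of Inl i \<Rightarrow> wx t \<omega> $ i | Inr j \<Rightarrow> wu t \<omega> $ j)"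

definition signal :: "nat \<times> ('n + 'm) \<Rightarrow> real" where
  "signal = (\<lambda>(t, k). case k of Inl i \<Rightarrow> x t $ i | Inr j \<Rightarrow> u t $ j)"

definition err :: "nat \<times> ('n + 'm) \<Rightarrow> 'w \<Rightarrow> real" where
  "err i \<omega> = quantizer ymin ymax b (signal i + dith i \<omega>) - dith i \<omega> - signal i"

lemma quantized_point_error:
  "c \<in> Basis \<Longrightarrow> (quantized_point t \<omega> - data_point x u t) \<bullet> c = err (noise_index t c) \<omega>"
  by (erule Basis_triple_cases)
    (simp_all add: quantized_point_def data_point_def err_def dith_def signal_def dither_quantize_def inner_axis)

lemma indep_dith: "indep_vars (\<lambda>_. borel) dith UNIV"
  using dither unfolding dither_def dith_def by blast

lemma distr_dith: "distr M borel (dith i) = unif \<epsilon>"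
  using dither unfolding dither_def dith_def unif_def by (cases i; cases "snd i") auto

lemma measurable_quantizer_error: "(\<lambda>s. quantizer ymin ymax b (v + s) - s - v) \<in> borel_measurable borel"
  unfolding quantizer_def Let_def by measurable

lemma indep_err: "indep_vars (\<lambda>_. borel) err UNIV"
  unfolding err_def[abs_def]
  by (rule indep_vars_compose2[OF indep_dith, where Y = "\<lambda>i s. quantizer ymin ymax b (signal i + s) - s - signal i"])
    (rule measurable_quantizer_error)

lemma measurable_err [measurable]: "err i \<in> borel_measurable M"
  using indep_err unfolding indep_vars_def by blast

lemma distr_err: "distr M borel (err i) = unif \<epsilon>"
proof -
  have m: "dith i \<in> borel_measurable M" using indep_dith unfolding indep_vars_def by blast
  have "distr M borel (err i) = distr (distr M borel (dith i)) borel (\<lambda>s. quantizer ymin ymax b (signal i + s) - s - signal i)"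
    unfolding err_def[abs_def] by (subst distr_distr[OF measurable_quantizer_error m]) (simp add: comp_def)
  then show ?thesis by (simp add: distr_dith distr_unif_quantizer_error[OF \<epsilon> \<epsilon>_pos])
qed

text \<open>Distinct coordinates of one data point use distinct scalar errors, by injectivity of
  \<open>noise_index\<close>, so the error vector has independent uniform coordinates. Its law is
  the same at all times, whatever the signal.\<close>

lemma distr_quantized_point: "distr M borel (\<lambda>\<omega>. quantized_point t \<omega> - data_point x u t) = noise \<epsilon>"
proof (rule distr_eq_noise)
  have "indep_vars (\<lambda>c. PiM {noise_index t c} (\<lambda>_. borel)) (\<lambda>c \<omega>. restrict (\<lambda>i. err i \<omega>) {noise_index t c}) Basis"
    using inj_on_noise_index[of t]
    by (intro indep_vars_restrict[OF indep_err]) (auto simp: disjoint_family_on_def inj_on_def)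
  then have "indep_vars (\<lambda>_. borel) (\<lambda>c \<omega>. (restrict (\<lambda>i. err i \<omega>) {noise_index t c}) (noise_index t c)) Basis"
    by (rule indep_vars_compose2[where Y = "\<lambda>c f. f (noise_index t c)"]) measurable
  then show "indep_vars (\<lambda>_. borel) (\<lambda>c \<omega>. (quantized_point t \<omega> - data_point x u t) \<bullet> c) Basis"
    by (rule iffD1[OF indep_vars_cong, rotated -1]) (auto simp: quantized_point_error)
  show "distr M borel (\<lambda>\<omega>. (quantized_point t \<omega> - data_point x u t) \<bullet> c) = unif \<epsilon>" if "c \<in> Basis" for c
    using that distr_err by (simp add: quantized_point_error)
qed

lemma measurable_quantized_point: "(\<lambda>\<omega>. quantized_point t \<omega> - data_point x u t) \<in> borel_measurable M"
  by (subst borel_measurable_euclidean_space) (simp add: quantized_point_error)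

lemma AE_quantized_point:
  "AE \<omega> in M. \<forall>t. \<forall>c\<in>Basis. \<bar>(quantized_point t \<omega> - data_point x u t) \<bullet> c\<bar> \<le> \<epsilon> / 2"
  unfolding AE_all_countable
proof
  fix t
  show "AE \<omega> in M. \<forall>c\<in>Basis. \<bar>(quantized_point t \<omega> - data_point x u t) \<bullet> c\<bar> \<le> \<epsilon> / 2"
    by (rule AE_distrD[OF measurable_quantized_point]) (simp only: distr_quantized_point AE_noise[OF \<epsilon>_pos])
qed

lemma expectation_quantized_point:
  fixes F :: "(real^'n) \<times> (real^'n) \<times> (real^'m) \<Rightarrow> real"
  assumes F: "continuous_on UNIV F"
  shows "expectation (\<lambda>\<omega>. F (quantized_point t \<omega>)) = (\<integral>e. F (data_point x u t + e) \<partial>noise \<epsilon>)"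
    and "integrable M (\<lambda>\<omega>. F (quantized_point t \<omega>))"
proof -
  have m: "(\<lambda>e. F (data_point x u t + e)) \<in> borel_measurable borel" for t
    using borel_measurable_integrable[OF integrable_noise[OF F \<epsilon>_pos]] by simp
  show "expectation (\<lambda>\<omega>. F (quantized_point t \<omega>)) = (\<integral>e. F (data_point x u t + e) \<partial>noise \<epsilon>)"
    unfolding distr_quantized_point[of t, symmetric]
    by (subst integral_distr[OF measurable_quantized_point m]) simp
  show "integrable M (\<lambda>\<omega>. F (quantized_point t \<omega>))"
    using integrable_noise[OF F \<epsilon>_pos, of "data_point x u t"]
      integrable_distr_eq[OF measurable_quantized_point[of t] m[of t]]
    unfolding distr_quantized_point by simp
qed

text \<open>Almost surely all errors stay in the noise box, where \<open>F\<close> is bounded, and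
  the term at time \<open>t\<close> depends on errors with times \<open>t\<close> and
  \<open>Suc t\<close> only.\<close>

lemma quantized_strong_law:
  fixes F :: "(real^'n) \<times> (real^'n) \<times> (real^'m) \<Rightarrow> real"
  assumes F: "continuous_on UNIV F" and bp: "bounded (range (data_point x u))"
  shows "AE \<omega> in M. avg (\<lambda>t. F (quantized_point t \<omega>) - (\<integral>e. F (data_point x u t + e) \<partial>noise \<epsilon>)) \<longlonglongrightarrow> 0"
proof -
  obtain c where c: "0 < c" "\<And>q e. q \<in> range (data_point x u) \<Longrightarrow> \<forall>c\<in>Basis. \<bar>e \<bullet> c\<bar> \<le> \<epsilon> / 2 \<Longrightarrow> \<bar>F (q + e)\<bar> \<le> c"
    using bounded_on_box_shifts[OF F bp] by metis
  define H where "H t v = F (data_point x u t + (\<Sum>c\<in>Basis. v (noise_index t c) *\<^sub>R c))" for t v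
  have mF: "F \<in> borel_measurable borel" by (rule borel_measurable_continuous_onI[OF F])
  have "AE \<omega> in M. avg (\<lambda>t. F (quantized_point t \<omega>) - expectation (\<lambda>\<omega>. F (quantized_point t \<omega>))) \<longlonglongrightarrow> 0"
  proof (rule bounded_one_dependent_strong_law[OF indep_err _ _ _ c(1)])
    fix t
    have "(\<lambda>v. v (noise_index t c)) \<in> borel_measurable (PiM ({t, Suc t} \<times> UNIV) (\<lambda>_. borel :: real measure))" for c
      by (rule measurable_component_singleton[OF noise_index_in])
    then show "H t \<in> borel_measurable (PiM ({t, Suc t} \<times> UNIV) (\<lambda>_. borel))"
      unfolding H_def[abs_def]
      by (intro measurable_compose[OF _ mF] borel_measurable_add borel_measurable_sum borel_measurable_scaleR) auto
    show "F (quantized_point t \<omega>) = H t (\<lambda>i\<in>{t, Suc t} \<times> UNIV. err i \<omega>)" for \<omega>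
    proof -
      have "(\<Sum>c\<in>Basis. (\<lambda>i\<in>{t, Suc t} \<times> UNIV. err i \<omega>) (noise_index t c) *\<^sub>R c)
          = (\<Sum>c\<in>Basis. ((quantized_point t \<omega> - data_point x u t) \<bullet> c) *\<^sub>R c)"
        using noise_index_in by (intro sum.cong) (auto simp: quantized_point_error)
      then show ?thesis by (simp add: H_def euclidean_representation)
    qed
    show "AE \<omega> in M. \<bar>F (quantized_point t \<omega>)\<bar> \<le> c"
      using AE_quantized_point
    proof eventually_elim
      case (elim \<omega>)
      then show ?case
        using c(2)[of "data_point x u t" "quantized_point t \<omega> - data_point x u t"] by simp
    qed
  qed
  then show ?thesis by (simp only: expectation_quantized_point[OF F])
qed

end

section \<open>Residuals as quadratic polynomials\<close>

definition regressor :: "(real^'n \<Rightarrow> real^'N) \<Rightarrow> (real^'n) \<times> (real^'n) \<times> (real^'m) \<Rightarrow> real^('N + 'm)" where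
  "regressor \<phi> p = (\<chi> k. case k of Inl i \<Rightarrow> \<phi> (fst (snd p)) $ i | Inr j \<Rightarrow> snd (snd p) $ j)"

definition predict :: "(real^'n \<Rightarrow> real^'N) \<Rightarrow> (real^'n) \<times> (real^'n) \<times> (real^'m)
    \<Rightarrow> (real^'N^'N) \<times> (real^'m^'N) \<Rightarrow> real^'N" where
  "predict \<phi> p \<theta> = fst \<theta> *v \<phi> (fst (snd p)) + snd \<theta> *v snd (snd p)"

lemma block_row_regressor: "block_row A B *v regressor \<phi> p = predict \<phi> p (A, B)"
  for A :: "real^'N^'N" and B :: "real^'m^'N"
proof -
  have "(\<Sum>k\<in>UNIV. g k) = (\<Sum>i\<in>UNIV. g (Inl i)) + (\<Sum>j\<in>UNIV. g (Inr j))" for g :: "'N + 'm \<Rightarrow> real"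
    using sum.Plus[of "UNIV :: 'N set" "UNIV :: 'm set" g] by (simp add: comp_def)
  then show ?thesis
    by (simp add: vec_eq_iff predict_def matrix_vector_mult_def block_row_def regressor_def)
qed

lemma block_row_surj: obtains A B where "G = block_row A B"
proof
  show "G = block_row (\<chi> i k. G $ i $ Inl k) (\<chi> i k. G $ i $ Inr k)"
    by (auto simp: vec_eq_iff block_row_def split: sum.split)
qed

lemma residual_predict: "residual \<phi> A B p = (norm (\<phi> (fst p) - predict \<phi> p (A, B)))\<^sup>2"
  by (cases p) (simp add: residual_def predict_def algebra_simps)

lemma residual_block_row: "residual \<phi> A B p = (norm (\<phi> (fst p) - block_row A B *v regressor \<phi> p))\<^sup>2"
  by (simp add: residual_predict block_row_regressor)

lemma ls_cost_eq_avg: "ls_cost \<phi> x u T A B = avg (\<lambda>t. residual \<phi> A B (data_point x u t)) T"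
  by (simp add: ls_cost_def frobenius_sq_def avg_def residual_def data_point_def data_Phi_def
      data_Phi_plus_def norm_vec_def L2_set_def sum_nonneg)

lemma linear_predict: "linear (predict \<phi> p)"
  by (rule linearI)
    (simp_all add: predict_def matrix_vector_mult_add_rdistrib scaleR_matrix_vector_assoc[symmetric]
      algebra_simps)

text \<open>The norm of the matrix type is the Frobenius norm, so Cauchy-Schwarz on each row
  suffices.\<close>

lemma norm_matrix_vector_mult_le: "norm (A *v v) \<le> norm A * norm v" for A :: "real^'m^'n"
proof -
  have "norm (A *v v) \<le> L2_set (\<lambda>i. norm (A $ i) * norm v) UNIV"
    unfolding norm_vec_def[of "A *v v"]
  proof (intro L2_set_mono)
    show "norm ((A *v v) $ i) \<le> norm (A $ i) * norm v" for i
      using Cauchy_Schwarz_ineq2[of "A $ i" v]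
      by (simp add: matrix_vector_mul_component)
  qed simp
  then show ?thesis by (simp add: L2_set_left_distrib norm_vec_def[of A])
qed

lemma norm_predict_le: "norm (predict \<phi> p \<theta>) \<le> (norm (\<phi> (fst (snd p))) + norm (snd (snd p))) * norm \<theta>"
proof -
  have "norm (predict \<phi> p \<theta>) \<le> norm (fst \<theta>) * norm (\<phi> (fst (snd p))) + norm (snd \<theta>) * norm (snd (snd p))"
    unfolding predict_def by (intro order_trans[OF norm_triangle_ineq] add_mono norm_matrix_vector_mult_le)
  also have "\<dots> \<le> norm \<theta> * norm (\<phi> (fst (snd p))) + norm \<theta> * norm (snd (snd p))"
    by (intro add_mono mult_right_mono) (use norm_fst_le[of "fst \<theta>" "snd \<theta>"] norm_snd_le[of "snd \<theta>" "fst \<theta>"] in simp_all)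
  finally show ?thesis by (simp add: algebra_simps)
qed

text \<open>Convergence of averages, continuity and Taylor expansions are assumed or known for
  residuals and survive sums and multiples. Working in the span carries them over to single entries
  by induction.\<close>

inductive_set residual_span :: "(real^'n \<Rightarrow> real^'N) \<Rightarrow> ((real^'n) \<times> (real^'n) \<times> (real^'m) \<Rightarrow> real) set"
  for \<phi> where
  residual: "residual \<phi> A B \<in> residual_span \<phi>"
| add: "F \<in> residual_span \<phi> \<Longrightarrow> G \<in> residual_span \<phi> \<Longrightarrow> (\<lambda>p. F p + G p) \<in> residual_span \<phi>"
| scale: "F \<in> residual_span \<phi> \<Longrightarrow> (\<lambda>p. c * F p) \<in> residual_span \<phi>"

lemma residual_span_matrix: "(\<lambda>p. (norm (\<phi> (fst p) - G *v regressor \<phi> p))\<^sup>2) \<in> residual_span \<phi>"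
  for \<phi> :: "real^'n \<Rightarrow> real^'N" and G :: "real^('N::finite + 'm::finite)^'N"
proof -
  obtain A B where "G = block_row A B" by (rule block_row_surj)
  then have "(\<lambda>p. (norm (\<phi> (fst p) - G *v regressor \<phi> p))\<^sup>2) = residual \<phi> A B"
    by (simp add: fun_eq_iff residual_block_row)
  then show ?thesis using residual_span.residual by metis
qed

lemma residual_span_target: "(\<lambda>p. (norm (\<phi> (fst p)))\<^sup>2) \<in> residual_span \<phi>"
  using residual_span_matrix[of \<phi> 0] by simp

lemma norm_diff_sq: "(norm (a - b))\<^sup>2 = (norm a)\<^sup>2 - 2 * (a \<bullet> b) + (norm b)\<^sup>2" for a b :: "'a::real_inner"
  by (simp add: power2_norm_eq_inner inner_diff_left inner_diff_right inner_commute)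

lemma norm_add_sq: "(norm (a + b))\<^sup>2 = (norm a)\<^sup>2 + 2 * (a \<bullet> b) + (norm b)\<^sup>2" for a b :: "'a::real_inner"
  by (simp add: power2_norm_eq_inner inner_add_left inner_add_right inner_commute)

lemma matrix_uminus_vector: "(- G) *v v = - (G *v v)" for G :: "real^'k^'n"
  by (simp add: vec_eq_iff matrix_vector_mult_def sum_negf)

text \<open>Averaging the residuals of \<open>G\<close> and \<open>- G\<close> cancels the cross
  term, and the squared target, itself the residual of the zero matrix, is subtracted.\<close>

lemma residual_span_quadratic: "(\<lambda>p. (norm (G *v regressor \<phi> p))\<^sup>2) \<in> residual_span \<phi>"
  for \<phi> :: "real^'n \<Rightarrow> real^'N" and G :: "real^('N::finite + 'm::finite)^'N"
proof -
  have eq: "(\<lambda>p. (norm (G *v regressor \<phi> p))\<^sup>2) = (\<lambda>p. (1/2) * ((norm (\<phi> (fst p) - G *v regressor \<phi> p))\<^sup>2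
      + (norm (\<phi> (fst p) - (- G) *v regressor \<phi> p))\<^sup>2) + (- 1) * (norm (\<phi> (fst p)))\<^sup>2)"
    by (simp add: fun_eq_iff norm_diff_sq norm_add_sq matrix_uminus_vector field_simps)
  show ?thesis
    unfolding eq by (intro residual_span.scale residual_span.add residual_span_matrix residual_span_target)
qed

lemma residual_span_bilinear: "(\<lambda>p. \<phi> (fst p) \<bullet> (G *v regressor \<phi> p)) \<in> residual_span \<phi>"
proof -
  have eq: "(\<lambda>p. \<phi> (fst p) \<bullet> (G *v regressor \<phi> p)) = (\<lambda>p. (1/4) * ((norm (\<phi> (fst p) - (- G) *v regressor \<phi> p))\<^sup>2
      + (- 1) * (norm (\<phi> (fst p) - G *v regressor \<phi> p))\<^sup>2))"
    by (simp add: fun_eq_iff norm_diff_sq norm_add_sq matrix_uminus_vector)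
  show ?thesis
    unfolding eq by (intro residual_span.scale residual_span.add residual_span_matrix)
qed

definition unit_matrix :: "'n \<Rightarrow> 'k \<Rightarrow> real^'k^'n" where
  "unit_matrix i k = (\<chi> i' k'. of_bool (i' = i \<and> k' = k))"

lemma unit_matrix_mult: "unit_matrix i k *v v = axis i (v $ k)"
  by (auto simp: vec_eq_iff matrix_vector_mult_def unit_matrix_def axis_def of_bool_conj
      sum.delta if_distrib[of "\<lambda>c. c * _"] of_bool_def cong: if_cong)

lemma residual_span_target_regressor: "(\<lambda>p. \<phi> (fst p) $ i * regressor \<phi> p $ k) \<in> residual_span \<phi>"
  using residual_span_bilinear[of \<phi> "unit_matrix i k"] by (simp add: unit_matrix_mult inner_axis)

lemma residual_span_regressor_regressor: "(\<lambda>p. regressor \<phi> p $ k * regressor \<phi> p $ l) \<in> residual_span \<phi>"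
  for \<phi> :: "real^'n \<Rightarrow> real^'N"
proof -
  \<comment> \<open>Any row will do. Placing both unit entries in the same row turns the squared
    norm into the square of a scalar, to which polarization applies.\<close>
  fix i :: 'N
  let ?E = "unit_matrix i k" and ?F = "unit_matrix i l"
  have norm_axis: "(norm (axis i c))\<^sup>2 = c\<^sup>2" for c :: real
    by (simp only: power2_norm_eq_inner inner_axis_axis) (simp add: power2_eq_square)
  have "((?E + ?F) *v v) = axis i (v $ k + v $ l)" "((?E - ?F) *v v) = axis i (v $ k - v $ l)" for v
    by (simp_all add: matrix_vector_mult_add_rdistrib matrix_vector_mult_diff_rdistrib unit_matrix_mult
        vec_eq_iff axis_def)
  then have eq: "(\<lambda>p. regressor \<phi> p $ k * regressor \<phi> p $ l)
      = (\<lambda>p. (1/4) * ((norm ((?E + ?F) *v regressor \<phi> p))\<^sup>2 + (- 1) * (norm ((?E - ?F) *v regressor \<phi> p))\<^sup>2))"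
    by (simp add: fun_eq_iff norm_axis) (simp add: power2_eq_square algebra_simps)
  show ?thesis
    unfolding eq by (intro residual_span.scale residual_span.add residual_span_quadratic)
qed

lemma residual_expand:
  "residual \<phi> A B p = (norm (\<phi> (fst p)))\<^sup>2
     + (- 2) * (\<Sum>i\<in>UNIV. \<Sum>k\<in>UNIV. block_row A B $ i $ k * (\<phi> (fst p) $ i * regressor \<phi> p $ k))
     + (\<Sum>i\<in>UNIV. \<Sum>k\<in>UNIV. \<Sum>l\<in>UNIV. (block_row A B $ i $ k * block_row A B $ i $ l)
          * (regressor \<phi> p $ k * regressor \<phi> p $ l))"
proof -
  let ?G = "block_row A B" and ?z = "regressor \<phi> p"
  have "\<phi> (fst p) \<bullet> (?G *v ?z) = (\<Sum>i\<in>UNIV. \<Sum>k\<in>UNIV. ?G $ i $ k * (\<phi> (fst p) $ i * ?z $ k))"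
    by (simp add: inner_vec_def matrix_vector_mult_def sum_distrib_left mult_ac)
  moreover have "(norm (?G *v ?z))\<^sup>2 = (\<Sum>i\<in>UNIV. \<Sum>k\<in>UNIV. \<Sum>l\<in>UNIV. (?G $ i $ k * ?G $ i $ l) * (?z $ k * ?z $ l))"
    unfolding power2_norm_eq_inner inner_vec_def
    by (simp add: matrix_vector_mult_def sum_product mult_ac)
  ultimately show ?thesis by (simp add: residual_block_row norm_diff_sq)
qed

text \<open>Serves two functionals: the limiting bias, where it produces the regularization terms,
  and the fluctuation of the quantized averages, where it reduces all costs to finitely many limits.
  Linearity is required on the span only, so the partial sums must be shown to stay in it.\<close>

lemma linear_functional_residual:
  fixes \<Lambda> :: "((real^'n) \<times> (real^'n) \<times> (real^'m) \<Rightarrow> real) \<Rightarrow> real" and \<phi> :: "real^'n \<Rightarrow> real^'N"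
  assumes add: "\<And>F G. F \<in> residual_span \<phi> \<Longrightarrow> G \<in> residual_span \<phi> \<Longrightarrow> \<Lambda> (\<lambda>p. F p + G p) = \<Lambda> F + \<Lambda> G"
    and scale: "\<And>F c. F \<in> residual_span \<phi> \<Longrightarrow> \<Lambda> (\<lambda>p. c * F p) = c * \<Lambda> F"
  shows "\<Lambda> (residual \<phi> A B) = \<Lambda> (\<lambda>p. (norm (\<phi> (fst p)))\<^sup>2)
     + (- 2) * (\<Sum>i\<in>UNIV. \<Sum>k\<in>UNIV. block_row A B $ i $ k * \<Lambda> (\<lambda>p. \<phi> (fst p) $ i * regressor \<phi> p $ k))
     + (\<Sum>i\<in>UNIV. \<Sum>k\<in>UNIV. \<Sum>l\<in>UNIV. (block_row A B $ i $ k * block_row A B $ i $ l)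
          * \<Lambda> (\<lambda>p. regressor \<phi> p $ k * regressor \<phi> p $ l))"
proof -
  have weighted_sum: "(\<lambda>p. \<Sum>j\<in>I. c j * F j p) \<in> residual_span \<phi> \<and>
      \<Lambda> (\<lambda>p. \<Sum>j\<in>I. c j * F j p) = (\<Sum>j\<in>I. c j * \<Lambda> (F j))"
    if "finite I" "\<And>j. F j \<in> residual_span \<phi>" for I :: "'j set" and c F
    using that(1)
  proof (induction I)
    case empty
    \<comment> \<open>The empty sum is seen to be in the span as 0 times the residual of the zero
      pair.\<close>
    show ?case
      using scale[OF residual_span.residual, of 0 0 0] residual_span.scale[OF residual_span.residual, of 0 \<phi> 0 0] by simp
  next
    case (insert j I)
    have "(\<lambda>p. c j * F j p) \<in> residual_span \<phi>" by (rule residual_span.scale[OF that(2)])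
    with insert show ?case
      using add[of "\<lambda>p. c j * F j p" "\<lambda>p. \<Sum>j\<in>I. c j * F j p"] scale[OF that(2)]
        residual_span.add[of "\<lambda>p. c j * F j p" \<phi> "\<lambda>p. \<Sum>j\<in>I. c j * F j p"] by simp
  qed
  define P where "P p = (norm (\<phi> (fst p)))\<^sup>2" for p :: "(real^'n) \<times> (real^'n) \<times> (real^'m)"
  define c1 where "c1 j = block_row A B $ fst j $ snd j" for j
  define c2 where "c2 j = block_row A B $ fst j $ fst (snd j) * block_row A B $ fst j $ snd (snd j)" for j
  define F1 where "F1 j p = \<phi> (fst p) $ fst j * regressor \<phi> p $ snd j"
    for j :: "'N \<times> ('N + 'm)" and p
  define F2 where "F2 j p = regressor \<phi> p $ fst (snd j) * regressor \<phi> p $ snd (snd j)"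
    for j :: "'N \<times> ('N + 'm) \<times> ('N + 'm)" and p
  have P: "P \<in> residual_span \<phi>" unfolding P_def[abs_def] by (rule residual_span_target)
  have F1: "F1 j \<in> residual_span \<phi>" for j unfolding F1_def[abs_def] by (rule residual_span_target_regressor)
  have F2: "F2 j \<in> residual_span \<phi>" for j unfolding F2_def[abs_def] by (rule residual_span_regressor_regressor)
  note w1 = weighted_sum[of UNIV F1 c1, OF finite F1] and w2 = weighted_sum[of UNIV F2 c2, OF finite F2]
  have "residual \<phi> A B = (\<lambda>p. (P p + (- 2) * (\<Sum>j\<in>UNIV. c1 j * F1 j p)) + (\<Sum>j\<in>UNIV. c2 j * F2 j p))"
    by (rule ext, subst residual_expand)
      (simp add: P_def c1_def F1_def c2_def F2_def sum.cartesian_product case_prod_beta)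
  then have "\<Lambda> (residual \<phi> A B) = \<Lambda> (\<lambda>p. (P p + (- 2) * (\<Sum>j\<in>UNIV. c1 j * F1 j p)) + (\<Sum>j\<in>UNIV. c2 j * F2 j p))"
    by (rule arg_cong)
  also have "\<dots> = \<Lambda> (\<lambda>p. P p + (- 2) * (\<Sum>j\<in>UNIV. c1 j * F1 j p)) + \<Lambda> (\<lambda>p. \<Sum>j\<in>UNIV. c2 j * F2 j p)"
    by (rule add[OF residual_span.add[OF P residual_span.scale[OF conjunct1[OF w1]]] conjunct1[OF w2]])
  also have "\<Lambda> (\<lambda>p. P p + (- 2) * (\<Sum>j\<in>UNIV. c1 j * F1 j p)) = \<Lambda> P + \<Lambda> (\<lambda>p. (- 2) * (\<Sum>j\<in>UNIV. c1 j * F1 j p))"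
    by (rule add[OF P residual_span.scale[OF conjunct1[OF w1]]])
  also have "\<Lambda> (\<lambda>p. (- 2) * (\<Sum>j\<in>UNIV. c1 j * F1 j p)) = (- 2) * (\<Sum>j\<in>UNIV. c1 j * \<Lambda> (F1 j))"
    by (simp only: scale[OF conjunct1[OF w1]] conjunct2[OF w1])
  also have "\<Lambda> (\<lambda>p. \<Sum>j\<in>UNIV. c2 j * F2 j p) = (\<Sum>j\<in>UNIV. c2 j * \<Lambda> (F2 j))"
    by (rule conjunct2[OF w2])
  finally show ?thesis
    by (simp add: P_def[abs_def] c1_def F1_def[abs_def] c2_def F2_def[abs_def] sum.cartesian_product case_prod_beta)
qed

lemma residual_span_continuous:
  assumes \<phi>: "continuous_on UNIV \<phi>" and F: "F \<in> residual_span \<phi>"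
  shows "continuous_on UNIV F"
  using F
proof induction
  case (residual A B)
  have "continuous_on UNIV (\<lambda>p. (norm (\<phi> (fst p) - (A *v \<phi> (fst (snd p)) + B *v snd (snd p))))\<^sup>2)"
    by (intro continuous_intros continuous_on_compose2[OF \<phi>]
        bounded_linear.continuous_on[OF matrix_vector_mul_bounded_linear]) auto
  then show ?case by (simp add: residual_predict[abs_def] predict_def)
qed (auto intro: continuous_intros)

text \<open>A sum expands up to the smaller of two radii, which still exceeds
  \<open>\<rho>\<close>.\<close>

lemma residual_span_expansion:
  assumes res: "\<And>A B. \<exists>R>\<rho>. \<exists>c. box_expansion (residual \<phi> A B) p R c" and F: "F \<in> residual_span \<phi>"
  shows "\<exists>R>\<rho>. \<exists>c. box_expansion F p R c"
  using F
proof induction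
  case (add F G)
  then obtain R c R' c' where "R > \<rho>" "box_expansion F p R c" "R' > \<rho>" "box_expansion G p R' c'" by blast
  then have "min R R' > \<rho>" "box_expansion (\<lambda>p. F p + G p) p (min R R') (\<lambda>bs. c bs + c' bs)"
    by (auto intro!: box_expansion_add intro: box_expansion_mono)
  then show ?case by blast
next
  case (scale F c)
  then obtain R a where "R > \<rho>" "box_expansion F p R a" by blast
  then have "R > \<rho>" "box_expansion (\<lambda>p. c * F p) p R (\<lambda>bs. c * a bs)"
    by (auto intro: box_expansion_scale)
  then show ?case by blast
qed (rule res)

section \<open>The limiting bias\<close>

lemma assumption4_continuous:
  assumes "assumption4 \<phi>"
  shows "continuous_on UNIV \<phi>"
proof -
  have "continuous_on UNIV (\<lambda>v. \<phi> v $ i)" for i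
  proof (rule has_derivative_continuous_on)
    fix v
    obtain D where "GDERIV (\<lambda>y. \<phi> y $ i) v :> D"
      using assms unfolding assumption4_def by blast
    then show "((\<lambda>v. \<phi> v $ i) has_derivative (\<lambda>h. h \<bullet> (SOME D. GDERIV (\<lambda>y. \<phi> y $ i) v :> D))) (at v within UNIV)"
      by (rule someI2) (simp add: gderiv_def)
  qed
  then have "continuous_on UNIV (\<lambda>v. \<chi> i. \<phi> v $ i)" by (rule continuous_on_vec_lambda)
  then show ?thesis by simp
qed

lemma assumption1_bounded:
  assumes "assumption1 \<phi> u"
  obtains K where "0 \<le> K" "\<And>v. norm (\<phi> v) \<le> K"
proof -
  from assms obtain l h where lh: "\<And>i v. l i \<le> \<phi> v $ i \<and> \<phi> v $ i \<le> h i"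
    unfolding assumption1_def by metis
  have "norm (\<phi> v) \<le> (\<Sum>i\<in>UNIV. \<bar>l i\<bar> + \<bar>h i\<bar>)" for v
  proof (rule order_trans[OF norm_le_l1_cart], rule sum_mono)
    show "\<bar>\<phi> v $ i\<bar> \<le> \<bar>l i\<bar> + \<bar>h i\<bar>" for i using lh[of i v] by linarith
  qed
  moreover have "0 \<le> (\<Sum>i\<in>UNIV. \<bar>l i\<bar> + \<bar>h i\<bar>)" by (intro sum_nonneg) auto
  ultimately show thesis using that by blast
qed

lemma matrix_bigo:
  fixes f :: "real \<Rightarrow> real^'k^'n"
  assumes "\<And>i j. (\<lambda>\<epsilon>. f \<epsilon> $ i $ j) \<in> O[F](g)"
  shows "(\<lambda>\<epsilon>. norm (f \<epsilon>)) \<in> O[F](g)"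
proof -
  have "norm (f \<epsilon>) \<le> (\<Sum>i\<in>UNIV. \<Sum>j\<in>UNIV. \<bar>f \<epsilon> $ i $ j\<bar>)" for \<epsilon>
  proof -
    have "norm (f \<epsilon>) \<le> (\<Sum>i\<in>UNIV. norm (f \<epsilon> $ i))"
      unfolding norm_vec_def[of "f \<epsilon>"] by (rule L2_set_le_sum) simp
    also have "\<dots> \<le> (\<Sum>i\<in>UNIV. \<Sum>j\<in>UNIV. \<bar>f \<epsilon> $ i $ j\<bar>)"
      by (intro sum_mono norm_le_l1_cart)
    finally show ?thesis .
  qed
  then have "(\<lambda>\<epsilon>. norm (f \<epsilon>)) \<in> O[F](\<lambda>\<epsilon>. \<Sum>i\<in>UNIV. \<Sum>j\<in>UNIV. \<bar>f \<epsilon> $ i $ j\<bar>)"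
    by (intro landau_o.big_mono always_eventually) (auto intro: order_trans[OF _ abs_ge_self])
  also have "(\<lambda>\<epsilon>. \<Sum>i\<in>UNIV. \<Sum>j\<in>UNIV. \<bar>f \<epsilon> $ i $ j\<bar>) \<in> O[F](g)"
    using assms by (intro big_sum_in_bigo) auto
  finally show ?thesis .
qed

text \<open>Everything about the exact data that does not refer to a quantizer, so that the
  regularization matrices can be defined as functions of the resolution alone.\<close>

locale regression_data =
  fixes \<phi> :: "real^'n \<Rightarrow> real^'N" and x :: "nat \<Rightarrow> real^'n" and u :: "nat \<Rightarrow> real^'m" and K :: real
  assumes \<phi>_cont: "continuous_on UNIV \<phi>" and K: "0 \<le> K" and \<phi>_bound: "\<And>v. norm (\<phi> v) \<le> K"
    and data_bounded: "bounded (range (data_point x u))"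
    and cost_limit: "\<And>A B. \<exists>L. (\<lambda>T. ereal (ls_cost \<phi> x u T A B)) \<longlonglongrightarrow> L"
begin

abbreviation p :: "nat \<Rightarrow> (real^'n) \<times> (real^'n) \<times> (real^'m)" where "p \<equiv> data_point x u"

definition bias :: "real \<Rightarrow> ((real^'n) \<times> (real^'n) \<times> (real^'m) \<Rightarrow> real) \<Rightarrow> nat \<Rightarrow> real" where
  "bias \<epsilon> F t = (\<integral>e. F (p t + e) \<partial>noise \<epsilon>) - F (p t)"

text \<open>\<open>\<beta>\<close> and \<open>\<Gamma>\<close> are chosen before the quantizer is given, when convergence of the averages is not yet
  available.\<close>

definition limit_bias :: "real \<Rightarrow> ((real^'n) \<times> (real^'n) \<times> (real^'m) \<Rightarrow> real) \<Rightarrow> real" where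
  "limit_bias \<epsilon> F = (if convergent (avg (bias \<epsilon> F)) then lim (avg (bias \<epsilon> F)) else 0)"

text \<open>The factor -2 is that of the cross term in the expanded square. The indices are
  transposed so that the trace of \<open>\<G> \<beta>\<close> pairs each entry of
  \<open>\<G>\<close> with the bias of its own product.\<close>

definition reg_linear :: "real \<Rightarrow> real^'N^('N + 'm)" where
  "reg_linear \<epsilon> = (\<chi> k i. - 2 * limit_bias \<epsilon> (\<lambda>q. \<phi> (fst q) $ i * regressor \<phi> q $ k))"

definition reg_quadratic :: "real \<Rightarrow> real^('N + 'm)^('N + 'm)" where
  "reg_quadratic \<epsilon> = (\<chi> k l. limit_bias \<epsilon> (\<lambda>q. regressor \<phi> q $ k * regressor \<phi> q $ l))"

lemma span_continuous: "F \<in> residual_span \<phi> \<Longrightarrow> continuous_on UNIV F"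
  by (rule residual_span_continuous[OF \<phi>_cont])

lemma span_bounded:
  assumes "F \<in> residual_span \<phi>"
  obtains c where "0 < c" "\<And>t. \<bar>F (p t)\<bar> \<le> c"
proof -
  obtain c where c: "0 < c" "\<And>q e. q \<in> range p \<Longrightarrow> \<forall>b\<in>Basis. \<bar>e \<bullet> b\<bar> \<le> 0 \<Longrightarrow> \<bar>F (q + e)\<bar> \<le> c"
    using bounded_on_box_shifts[OF span_continuous[OF assms] data_bounded] by metis
  show thesis
  proof (rule that[OF c(1)])
    show "\<bar>F (p t)\<bar> \<le> c" for t using c(2)[of "p t" 0] by simp
  qed
qed

lemma ls_cost_bounded: obtains c where "0 < c" "\<And>T. ls_cost \<phi> x u T A B \<le> c"
proof -
  obtain c where c: "0 < c" "\<And>t. \<bar>residual \<phi> A B (p t)\<bar> \<le> c"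
    using span_bounded[OF residual_span.residual] by metis
  have "ls_cost \<phi> x u T A B \<le> c" for T
    unfolding ls_cost_eq_avg using c by (intro avg_le_bound) (auto intro: order_trans[OF abs_ge_self])
  with c(1) show thesis by (rule that)
qed

lemma ls_cost_nonneg: "0 \<le> ls_cost \<phi> x u T A B"
  unfolding ls_cost_eq_avg by (rule avg_nonneg) (simp add: residual_predict)

text \<open>Assumption 2 provides the limit in the extended reals; the bounded, nonnegative costs
  make it a real number.\<close>

lemma ls_cost_convergent: "convergent (\<lambda>T. ls_cost \<phi> x u T A B)"
proof -
  obtain L where L: "(\<lambda>T. ereal (ls_cost \<phi> x u T A B)) \<longlonglongrightarrow> L" using cost_limit by blast
  obtain c where c: "\<And>T. ls_cost \<phi> x u T A B \<le> c" using ls_cost_bounded by metis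
  have "L \<le> ereal c" using c by (intro LIMSEQ_le_const2[OF L]) auto
  moreover have "0 \<le> L" using ls_cost_nonneg by (intro LIMSEQ_le_const[OF L]) auto
  ultimately obtain l where "L = ereal l" by (cases L) auto
  with L show ?thesis by (auto simp: convergent_def)
qed

lemma lim_ls_cost_finite: "lim (\<lambda>T. ereal (ls_cost \<phi> x u T A B)) < \<infinity>"
proof -
  obtain l where "(\<lambda>T. ls_cost \<phi> x u T A B) \<longlonglongrightarrow> l" using ls_cost_convergent by (auto simp: convergent_def)
  then have "(\<lambda>T. ereal (ls_cost \<phi> x u T A B)) \<longlonglongrightarrow> ereal l" by simp
  from limI[OF this] show ?thesis by simp
qed

lemma span_avg_convergent:
  assumes "F \<in> residual_span \<phi>"
  shows "convergent (avg (\<lambda>t. F (p t)))"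
  using assms
proof induction
  case (residual A B)
  then show ?case using ls_cost_convergent[of A B] by (simp add: ls_cost_eq_avg)
next
  case (add F G)
  have "avg (\<lambda>t. F (p t) + G (p t)) = (\<lambda>T. avg (\<lambda>t. F (p t)) T + avg (\<lambda>t. G (p t)) T)"
    by (rule ext) (rule avg_add)
  then show ?case using convergent_add[OF add.IH] by simp
next
  case (scale F c)
  have "avg (\<lambda>t. c * F (p t)) = (\<lambda>T. c * avg (\<lambda>t. F (p t)) T)"
    by (rule ext) (rule avg_cmult)
  then show ?case using convergent_mult[OF convergent_const scale.IH] by simp
qed

lemma mean_add:
  assumes "0 < \<epsilon>" "F \<in> residual_span \<phi>" "G \<in> residual_span \<phi>"
  shows "(\<integral>e. F (p t + e) + G (p t + e) \<partial>noise \<epsilon>) = (\<integral>e. F (p t + e) \<partial>noise \<epsilon>) + (\<integral>e. G (p t + e) \<partial>noise \<epsilon>)"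
  using assms by (intro Bochner_Integration.integral_add integrable_noise span_continuous)

lemma avg_mean_add:
  assumes "0 < \<epsilon>" "F \<in> residual_span \<phi>" "G \<in> residual_span \<phi>"
  shows "avg (\<lambda>t. \<integral>e. F (p t + e) + G (p t + e) \<partial>noise \<epsilon>) T
    = avg (\<lambda>t. \<integral>e. F (p t + e) \<partial>noise \<epsilon>) T + avg (\<lambda>t. \<integral>e. G (p t + e) \<partial>noise \<epsilon>) T"
  by (simp only: mean_add[OF assms] avg_add)

lemma avg_mean_scale:
  "avg (\<lambda>t. \<integral>e. c * F (p t + e) \<partial>noise \<epsilon>) T = c * avg (\<lambda>t. \<integral>e. F (p t + e) \<partial>noise \<epsilon>) T"
  by (simp add: avg_cmult)

lemma avg_bias: "avg (bias \<epsilon> F) = (\<lambda>T. avg (\<lambda>t. \<integral>e. F (p t + e) \<partial>noise \<epsilon>) T - avg (\<lambda>t. F (p t)) T)"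
  unfolding bias_def[abs_def] by (rule ext) (rule avg_diff)

text \<open>One resolution \<open>\<epsilon>0\<close> with Taylor expansions yields a constant
  \<open>C\<close> that is valid for all \<open>\<epsilon> < \<epsilon>0 / 2\<close>. Second
  differences over steps up to \<open>\<epsilon> / 2\<close>, halved for the bias, give
  \<open>C / 8\<close>, and averages and their limits inherit the bound; the default value 0
  satisfies it trivially.\<close>

lemma limit_bias_bigo:
  assumes \<epsilon>0: "0 < \<epsilon>0" and taylor: "\<And>A B t. taylor_radius_gt (residual \<phi> A B) (p t) (\<epsilon>0 / 2)"
    and F: "F \<in> residual_span \<phi>"
  shows "(\<lambda>\<epsilon>. limit_bias \<epsilon> F) \<in> O[at_right 0](\<lambda>\<epsilon>. \<epsilon>\<^sup>2)"
proof -
  have "\<exists>R>\<epsilon>0 / 2. \<exists>c. box_expansion (residual \<phi> A B) (p t) R c" for A B t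
    using box_expansion_of_taylor_radius[OF taylor] by metis
  then have "\<exists>R>\<epsilon>0 / 2. \<exists>c. box_expansion F (p t) R c" for t
    by (rule residual_span_expansion[OF _ F])
  then obtain C where C: "0 \<le> C" "\<And>t \<delta> h. 0 \<le> \<delta> \<Longrightarrow> \<delta> \<le> \<epsilon>0 / 2 / 2 \<Longrightarrow> \<forall>b\<in>Basis. \<bar>h \<bullet> b\<bar> \<le> \<delta> \<Longrightarrow>
           \<bar>F (p t + h) + F (p t - h) - 2 * F (p t)\<bar> \<le> C * \<delta>\<^sup>2"
    using uniform_second_difference[OF data_bounded, of "\<epsilon>0 / 2" F] \<epsilon>0 by auto
  have bound: "\<bar>limit_bias \<epsilon> F\<bar> \<le> C / 8 * \<epsilon>\<^sup>2" if \<epsilon>: "0 < \<epsilon>" "\<epsilon> < \<epsilon>0 / 2" for \<epsilon>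
  proof -
    have "\<bar>bias \<epsilon> F t\<bar> \<le> C * (\<epsilon> / 2)\<^sup>2 / 2" for t
      unfolding bias_def using \<epsilon> by (intro noise_bias_le span_continuous F C(2)) auto
    then have "\<bar>bias \<epsilon> F t\<bar> \<le> C / 8 * \<epsilon>\<^sup>2" for t by (simp add: power_divide)
    then have le: "\<bar>avg (bias \<epsilon> F) T\<bar> \<le> C / 8 * \<epsilon>\<^sup>2" for T
      using C(1) by (intro order_trans[OF abs_avg_le] avg_le_bound) auto
    show ?thesis
    proof (cases "convergent (avg (bias \<epsilon> F))")
      case True
      then have "(\<lambda>T. \<bar>avg (bias \<epsilon> F) T\<bar>) \<longlonglongrightarrow> \<bar>limit_bias \<epsilon> F\<bar>"
        unfolding limit_bias_def by (simp add: convergent_LIMSEQ_iff tendsto_rabs)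
      then show ?thesis by (rule LIMSEQ_le_const2) (use le in blast)
    qed (use C(1) in \<open>simp add: limit_bias_def\<close>)
  qed
  show ?thesis
  proof (rule bigoI[where c = "C / 8"])
    have "eventually (\<lambda>\<epsilon>. \<epsilon> \<in> {0<..<\<epsilon>0 / 2}) (at_right 0)"
      using \<epsilon>0 by (intro eventually_at_right_real) auto
    then show "\<forall>\<^sub>F \<epsilon> in at_right 0. norm (limit_bias \<epsilon> F) \<le> C / 8 * norm (\<epsilon>\<^sup>2)"
      by eventually_elim (use bound in auto)
  qed
qed

section \<open>Limits at a fixed resolution\<close>

context
  fixes \<epsilon> :: real
  assumes \<epsilon>: "0 < \<epsilon>" and mean_conv: "\<And>A B. convergent (avg (\<lambda>t. \<integral>e. residual \<phi> A B (p t + e) \<partial>noise \<epsilon>))"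
begin

lemma span_mean_convergent:
  assumes "F \<in> residual_span \<phi>"
  shows "convergent (avg (\<lambda>t. \<integral>e. F (p t + e) \<partial>noise \<epsilon>))"
  using assms
proof induction
  case (residual A B)
  show ?case by (rule mean_conv)
next
  case (add F G)
  have "avg (\<lambda>t. \<integral>e. F (p t + e) + G (p t + e) \<partial>noise \<epsilon>)
    = (\<lambda>T. avg (\<lambda>t. \<integral>e. F (p t + e) \<partial>noise \<epsilon>) T + avg (\<lambda>t. \<integral>e. G (p t + e) \<partial>noise \<epsilon>) T)"
    by (rule ext) (rule avg_mean_add[OF \<epsilon> add.hyps])
  then show ?case using convergent_add[OF add.IH] by simp
next
  case (scale F c)
  have "avg (\<lambda>t. \<integral>e. c * F (p t + e) \<partial>noise \<epsilon>) = (\<lambda>T. c * avg (\<lambda>t. \<integral>e. F (p t + e) \<partial>noise \<epsilon>) T)"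
    by (rule ext) (rule avg_mean_scale)
  then show ?case using convergent_mult[OF convergent_const scale.IH] by simp
qed

lemma limit_bias:
  assumes "F \<in> residual_span \<phi>"
  shows "avg (bias \<epsilon> F) \<longlonglongrightarrow> limit_bias \<epsilon> F"
proof -
  have "convergent (avg (bias \<epsilon> F))"
    unfolding avg_bias by (intro convergent_diff span_mean_convergent span_avg_convergent assms)
  then show ?thesis by (simp add: limit_bias_def convergent_LIMSEQ_iff)
qed

lemma limit_bias_add:
  assumes "F \<in> residual_span \<phi>" "G \<in> residual_span \<phi>"
  shows "limit_bias \<epsilon> (\<lambda>q. F q + G q) = limit_bias \<epsilon> F + limit_bias \<epsilon> G"
proof (rule LIMSEQ_unique[OF limit_bias[OF residual_span.add[OF assms]]])
  have "avg (bias \<epsilon> (\<lambda>q. F q + G q)) = (\<lambda>T. avg (bias \<epsilon> F) T + avg (bias \<epsilon> G) T)"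
    unfolding avg_bias avg_mean_add[OF \<epsilon> assms] avg_add by (rule ext) simp
  then show "avg (bias \<epsilon> (\<lambda>q. F q + G q)) \<longlonglongrightarrow> limit_bias \<epsilon> F + limit_bias \<epsilon> G"
    using tendsto_add[OF limit_bias[OF assms(1)] limit_bias[OF assms(2)]] by simp
qed

lemma limit_bias_scale:
  assumes "F \<in> residual_span \<phi>"
  shows "limit_bias \<epsilon> (\<lambda>q. c * F q) = c * limit_bias \<epsilon> F"
proof (rule LIMSEQ_unique[OF limit_bias[OF residual_span.scale[OF assms]]])
  have "avg (bias \<epsilon> (\<lambda>q. c * F q)) = (\<lambda>T. c * avg (bias \<epsilon> F) T)"
    unfolding avg_bias avg_mean_scale avg_cmult by (rule ext) (simp add: right_diff_distrib)
  then show "avg (bias \<epsilon> (\<lambda>q. c * F q)) \<longlonglongrightarrow> c * limit_bias \<epsilon> F"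
    using tendsto_mult[OF tendsto_const limit_bias[OF assms]] by simp
qed

lemma limit_bias_residual:
  "limit_bias \<epsilon> (residual \<phi> A B) = limit_bias \<epsilon> (\<lambda>q. (norm (\<phi> (fst q)))\<^sup>2)
     + trace (block_row A B ** reg_linear \<epsilon>)
     + trace (transpose (block_row A B) ** block_row A B ** reg_quadratic \<epsilon>)"
proof -
  let ?G = "block_row A B"
  let ?b = "\<lambda>i k. limit_bias \<epsilon> (\<lambda>q. \<phi> (fst q) $ i * regressor \<phi> q $ k)"
  let ?g = "\<lambda>k l. limit_bias \<epsilon> (\<lambda>q. regressor \<phi> q $ k * regressor \<phi> q $ l)"
  have "limit_bias \<epsilon> (residual \<phi> A B) = limit_bias \<epsilon> (\<lambda>q. (norm (\<phi> (fst q)))\<^sup>2)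
     + (- 2) * (\<Sum>i\<in>UNIV. \<Sum>k\<in>UNIV. ?G $ i $ k * ?b i k)
     + (\<Sum>i\<in>UNIV. \<Sum>k\<in>UNIV. \<Sum>l\<in>UNIV. (?G $ i $ k * ?G $ i $ l) * ?g k l)"
    by (rule linear_functional_residual) (fact limit_bias_add, fact limit_bias_scale)
  moreover have "trace (?G ** reg_linear \<epsilon>) = (- 2) * (\<Sum>i\<in>UNIV. \<Sum>k\<in>UNIV. ?G $ i $ k * ?b i k)"
    by (simp add: trace_def matrix_matrix_mult_def reg_linear_def sum_distrib_left sum_negf mult_ac)
  moreover have "trace (transpose ?G ** ?G ** reg_quadratic \<epsilon>)
      = (\<Sum>i\<in>UNIV. \<Sum>k\<in>UNIV. \<Sum>l\<in>UNIV. (?G $ i $ k * ?G $ i $ l) * ?g k l)"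
  proof -
    have "trace (transpose ?G ** ?G ** reg_quadratic \<epsilon>)
        = (\<Sum>k\<in>UNIV. \<Sum>l\<in>UNIV. \<Sum>i\<in>UNIV. (?G $ i $ k * ?G $ i $ l) * ?g l k)"
      by (simp add: trace_def matrix_matrix_mult_def transpose_def reg_quadratic_def sum_distrib_right)
    \<comment> \<open>The limiting bias of a product of two regressor entries is symmetric in their
      indices.\<close>
    also have "\<dots> = (\<Sum>k\<in>UNIV. \<Sum>l\<in>UNIV. \<Sum>i\<in>UNIV. (?G $ i $ k * ?G $ i $ l) * ?g k l)"
      by (simp add: mult.commute)
    also have "\<dots> = (\<Sum>k\<in>UNIV. \<Sum>i\<in>UNIV. \<Sum>l\<in>UNIV. (?G $ i $ k * ?G $ i $ l) * ?g k l)"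
      by (rule sum.cong[OF refl]) (rule sum.swap)
    also have "\<dots> = (\<Sum>i\<in>UNIV. \<Sum>k\<in>UNIV. \<Sum>l\<in>UNIV. (?G $ i $ k * ?G $ i $ l) * ?g k l)"
      by (rule sum.swap)
    finally show ?thesis .
  qed
  ultimately show ?thesis by simp
qed

text \<open>Exact limiting cost plus limiting bias of the residual is the limiting mean cost of the
  quantized data. The two trace terms are that bias up to the part of the squared target, a constant
  in \<open>(A, B)\<close>.\<close>

lemma regularized_objective_eq:
  assumes q: "avg (\<lambda>t. \<integral>e. residual \<phi> A B (p t + e) \<partial>noise \<epsilon>) \<longlonglongrightarrow> q"
  shows "regularized_objective \<phi> x u (reg_linear \<epsilon>) (reg_quadratic \<epsilon>) (A, B)
           = ereal (q - limit_bias \<epsilon> (\<lambda>q. (norm (\<phi> (fst q)))\<^sup>2))"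
proof -
  obtain l where l: "(\<lambda>T. ls_cost \<phi> x u T A B) \<longlonglongrightarrow> l"
    using ls_cost_convergent by (auto simp: convergent_def)
  have "limsup (\<lambda>T. ereal (ls_cost \<phi> x u T A B)) = ereal l"
    using l by (intro lim_imp_Limsup) auto
  moreover have "limit_bias \<epsilon> (residual \<phi> A B) = q - l"
  proof (rule LIMSEQ_unique[OF limit_bias[OF residual_span.residual]])
    show "avg (bias \<epsilon> (residual \<phi> A B)) \<longlonglongrightarrow> q - l"
      unfolding avg_bias using l by (intro tendsto_diff q) (simp add: ls_cost_eq_avg)
  qed
  ultimately show ?thesis
    using limit_bias_residual[of A B] by (simp add: regularized_objective_def)
qed

end

end

section \<open>Consistency\<close>

text \<open>Outside a null set the realized quantized data satisfy the hypotheses of the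
  deterministic theorem \<open>least_squares_consistency\<close>, with targets \<open>\<phi>\<close>
  of the next quantized state and \<open>predict\<close> as the linear maps.\<close>

lemma (in regression_data) quantized_estimate_consistent:
  fixes P :: "'w measure" and ymin ymax \<epsilon> :: real and b :: nat
    and wx :: "nat \<Rightarrow> 'w \<Rightarrow> real^'n" and wu :: "nat \<Rightarrow> 'w \<Rightarrow> real^'m"
    and est :: "nat \<Rightarrow> 'w \<Rightarrow> (real^'N^'N) \<times> (real^'m^'N)"
  defines "xq \<equiv> \<lambda>t \<omega>. dither_quantize ymin ymax b (wx t \<omega>) (x t)"
    and "uq \<equiv> \<lambda>t \<omega>. dither_quantize ymin ymax b (wu t \<omega>) (u t)"
  assumes dd: "dithered_data P ymin ymax \<epsilon> b wx wu"
    and taylor: "\<And>A B t. taylor_radius_gt (residual \<phi> A B) (p t) (\<epsilon> / 2)"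
    and mean_conv: "\<And>A B. convergent (\<lambda>T. \<integral>\<omega>. ls_cost \<phi> (\<lambda>t. xq t \<omega>) (\<lambda>t. uq t \<omega>) T A B \<partial>P)"
    and est: "\<And>T \<omega>. \<omega> \<in> space P \<Longrightarrow>
      est T \<omega> \<in> minimizers (\<lambda>(A, B). ls_cost \<phi> (\<lambda>t. xq t \<omega>) (\<lambda>t. uq t \<omega>) T A B)"
  defines "Sol \<equiv> minimizers (regularized_objective \<phi> x u (reg_linear \<epsilon>) (reg_quadratic \<epsilon>))"
  shows "Sol \<noteq> {}" and "AE \<omega> in P. (\<lambda>T. infdist (est T \<omega>) Sol) \<longlonglongrightarrow> 0"
proof -
  interpret D: dithered_data P ymin ymax \<epsilon> b x u wx wu by (rule dd)
  note \<epsilon> = D.\<epsilon>_pos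
  let ?z = D.quantized_point
  have cost: "ls_cost \<phi> (\<lambda>t. xq t \<omega>) (\<lambda>t. uq t \<omega>) T A B
      = avg (\<lambda>t. residual \<phi> A B (?z t \<omega>)) T" for \<omega> T A B
    by (simp add: ls_cost_eq_avg D.quantized_point_def xq_def uq_def)
  have mean: "(\<integral>\<omega>. avg (\<lambda>t. F (?z t \<omega>)) T \<partial>P) = avg (\<lambda>t. \<integral>e. F (p t + e) \<partial>noise \<epsilon>) T"
    if F: "F \<in> residual_span \<phi>" for F T
    using D.expectation_quantized_point[OF span_continuous[OF F]]
    by (simp add: avg_def)
  have mean_conv': "convergent (avg (\<lambda>t. \<integral>e. residual \<phi> A B (p t + e) \<partial>noise \<epsilon>))" for A B
    using mean_conv[of A B] unfolding cost mean[OF residual_span.residual] .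
  define q where "q \<theta> = lim (avg (\<lambda>t. \<integral>e. residual \<phi> (fst \<theta>) (snd \<theta>) (p t + e) \<partial>noise \<epsilon>))" for \<theta>
  have q: "avg (\<lambda>t. \<integral>e. residual \<phi> (fst \<theta>) (snd \<theta>) (p t + e) \<partial>noise \<epsilon>) \<longlonglongrightarrow> q \<theta>" for \<theta>
    unfolding q_def using mean_conv' by (simp add: convergent_LIMSEQ_iff)
  define k where "k = limit_bias \<epsilon> (\<lambda>q. (norm (\<phi> (fst q)))\<^sup>2)"
  have objective: "regularized_objective \<phi> x u (reg_linear \<epsilon>) (reg_quadratic \<epsilon>) \<theta> = ereal (q \<theta> - k)" for \<theta>
    using regularized_objective_eq[OF \<epsilon> mean_conv' q, of \<theta>] by (simp add: k_def)
  have Sol: "Sol = {\<theta>. \<forall>\<theta>'. q \<theta> \<le> q \<theta>'}"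
    unfolding Sol_def minimizers_def is_arg_min_def objective by (auto simp: not_less)
  define \<Lambda> where "\<Lambda> \<omega> T F = avg (\<lambda>t. F (?z t \<omega>) - (\<integral>e. F (p t + e) \<partial>noise \<epsilon>)) T" for \<omega> T F
  have \<Lambda>_add: "\<Lambda> \<omega> T (\<lambda>p. F p + G p) = \<Lambda> \<omega> T F + \<Lambda> \<omega> T G"
    if "F \<in> residual_span \<phi>" "G \<in> residual_span \<phi>" for \<omega> T F G
    unfolding \<Lambda>_def avg_add[symmetric] mean_add[OF \<epsilon> that] by (simp add: algebra_simps)
  have \<Lambda>_scale: "\<Lambda> \<omega> T (\<lambda>p. c * F p) = c * \<Lambda> \<omega> T F" for \<omega> T F c
    unfolding \<Lambda>_def avg_cmult[symmetric] by (simp add: right_diff_distrib)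
  have law: "AE \<omega> in P. (\<lambda>T. \<Lambda> \<omega> T F) \<longlonglongrightarrow> 0" if "F \<in> residual_span \<phi>" for F
    unfolding \<Lambda>_def by (rule D.quantized_strong_law[OF span_continuous[OF that] data_bounded])
  \<comment> \<open>The strong law is invoked for finitely many products only; their common null set
    then serves all pairs \<open>(A, B)\<close>, including the random estimates.\<close>
  have "AE \<omega> in P. \<forall>i\<in>UNIV. \<forall>k\<in>UNIV. (\<lambda>T. \<Lambda> \<omega> T (\<lambda>p. \<phi> (fst p) $ i * regressor \<phi> p $ k)) \<longlonglongrightarrow> 0"
    by (intro AE_finite_allI finite law residual_span_target_regressor)
  moreover have "AE \<omega> in P. \<forall>k\<in>UNIV. \<forall>l\<in>UNIV. (\<lambda>T. \<Lambda> \<omega> T (\<lambda>p. regressor \<phi> p $ k * regressor \<phi> p $ l)) \<longlonglongrightarrow> 0"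
    by (intro AE_finite_allI finite law residual_span_regressor_regressor)
  moreover have "AE \<omega> in P. (\<lambda>T. \<Lambda> \<omega> T (\<lambda>p. (norm (\<phi> (fst p)))\<^sup>2)) \<longlonglongrightarrow> 0"
    by (rule law[OF residual_span_target])
  moreover note D.AE_quantized_point AE_space
  ultimately have main: "AE \<omega> in P. Sol \<noteq> {} \<and> (\<lambda>T. infdist (est T \<omega>) Sol) \<longlonglongrightarrow> 0"
  proof eventually_elim
    case (elim \<omega>)
    have res: "(\<lambda>T. \<Lambda> \<omega> T (residual \<phi> A B)) \<longlonglongrightarrow> 0" for A B
    proof -
      have "(\<lambda>T. \<Lambda> \<omega> T (\<lambda>p. (norm (\<phi> (fst p)))\<^sup>2)
         + (- 2) * (\<Sum>i\<in>UNIV. \<Sum>k\<in>UNIV. block_row A B $ i $ k * \<Lambda> \<omega> T (\<lambda>p. \<phi> (fst p) $ i * regressor \<phi> p $ k))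
         + (\<Sum>i\<in>UNIV. \<Sum>k\<in>UNIV. \<Sum>l\<in>UNIV. (block_row A B $ i $ k * block_row A B $ i $ l)
             * \<Lambda> \<omega> T (\<lambda>p. regressor \<phi> p $ k * regressor \<phi> p $ l)))
        \<longlonglongrightarrow> 0 + (- 2) * (\<Sum>i\<in>UNIV. \<Sum>k\<in>UNIV. block_row A B $ i $ k * 0)
         + (\<Sum>i\<in>UNIV. \<Sum>k\<in>UNIV. \<Sum>l\<in>UNIV. (block_row A B $ i $ k * block_row A B $ i $ l) * 0)"
        by (intro tendsto_add tendsto_mult tendsto_sum tendsto_const) (use elim in auto)
      moreover have "\<Lambda> \<omega> T (residual \<phi> A B) = \<Lambda> \<omega> T (\<lambda>p. (norm (\<phi> (fst p)))\<^sup>2)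
         + (- 2) * (\<Sum>i\<in>UNIV. \<Sum>k\<in>UNIV. block_row A B $ i $ k * \<Lambda> \<omega> T (\<lambda>p. \<phi> (fst p) $ i * regressor \<phi> p $ k))
         + (\<Sum>i\<in>UNIV. \<Sum>k\<in>UNIV. \<Sum>l\<in>UNIV. (block_row A B $ i $ k * block_row A B $ i $ l)
             * \<Lambda> \<omega> T (\<lambda>p. regressor \<phi> p $ k * regressor \<phi> p $ l))" for T
        by (rule linear_functional_residual) (simp_all only: \<Lambda>_add \<Lambda>_scale)
      ultimately show ?thesis by simp
    qed
    have span: "(\<lambda>T. \<Lambda> \<omega> T F) \<longlonglongrightarrow> 0" if "F \<in> residual_span \<phi>" for F
      using that
    proof induction
      case (add F G)
      then show ?case using tendsto_add[OF add.IH] by (simp add: \<Lambda>_add)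
    next
      case (scale F c)
      then show ?case using tendsto_mult_right_zero[OF scale.IH, of c] by (simp add: \<Lambda>_scale)
    qed (rule res)
    have avg_z: "avg (\<lambda>t. F (?z t \<omega>)) = (\<lambda>T. \<Lambda> \<omega> T F + avg (\<lambda>t. \<integral>e. F (p t + e) \<partial>noise \<epsilon>) T)" for F
      unfolding \<Lambda>_def avg_add[symmetric] by (simp add: fun_eq_iff)
    have z_bd: "\<forall>c\<in>Basis. \<bar>(?z t \<omega> - p t) \<bullet> c\<bar> \<le> \<epsilon> / 2" for t using elim by blast
    obtain c where c: "0 < c" "\<And>q e. q \<in> range p \<Longrightarrow> \<forall>b\<in>Basis. \<bar>e \<bullet> b\<bar> \<le> \<epsilon> / 2 \<Longrightarrow> \<bar>norm (q + e)\<bar> \<le> c"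
      using bounded_on_box_shifts[OF continuous_on_norm[OF continuous_on_id] data_bounded] by metis
    have z_norm: "norm (?z t \<omega>) \<le> c" for t using c(2)[OF _ z_bd[of t], of "p t"] by simp
    have input: "norm (snd (snd v)) \<le> norm v" for v :: "(real^'n) \<times> (real^'n) \<times> (real^'m)"
      using norm_snd_le[of "snd (snd v)" "fst (snd v)"] norm_snd_le[of "snd v" "fst v"] by simp
    let ?L = "\<lambda>t. predict \<phi> (?z t \<omega>)" and ?y = "\<lambda>t. \<phi> (fst (?z t \<omega>))"
    have res_eq: "(norm (?y t - ?L t \<theta>))\<^sup>2 = residual \<phi> (fst \<theta>) (snd \<theta>) (?z t \<omega>)" for t \<theta>
      by (simp add: residual_predict)
    \<comment> \<open>\<open>K\<close> bounds the observables and \<open>c\<close> the quantized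
      data point, hence the quantized input; the sum bounds both regressors and targets.\<close>
    have "0 \<le> K + c" using K c(1) by simp
    moreover have "norm (?L t \<theta>) \<le> (K + c) * norm \<theta>" for t \<theta>
      using norm_predict_le[of \<phi> "?z t \<omega>" \<theta>] \<phi>_bound[of "fst (snd (?z t \<omega>))"] input[of "?z t \<omega>"] z_norm[of t]
      by (meson add_mono mult_right_mono norm_ge_zero order_trans)
    moreover have "norm (?y t) \<le> K + c" for t
      using \<phi>_bound[of "fst (?z t \<omega>)"] c(1) by linarith
    moreover have "avg (\<lambda>t. (norm (?y t - ?L t \<theta>))\<^sup>2) \<longlonglongrightarrow> q \<theta>" for \<theta>
      unfolding res_eq avg_z using tendsto_add[OF res q] by simp
    moreover have "avg (\<lambda>t. of_bool (?L t \<theta> \<noteq> 0)) \<longlonglongrightarrow> 0"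
      if lim: "avg (\<lambda>t. (norm (?L t \<theta>))\<^sup>2) \<longlonglongrightarrow> 0" for \<theta>
    proof -
      \<comment> \<open>The squared norm has the same zeros as the prediction and belongs to the
        span. Its realized averages tend to 0, hence by the strong law so do its mean averages, and
        sparseness on the noise boxes covers the realized points, which lie in them.\<close>
      define G where "G v = (norm (predict \<phi> v \<theta>))\<^sup>2" for v
      have G: "G \<in> residual_span \<phi>"
        using residual_span_quadratic[of "block_row (fst \<theta>) (snd \<theta>)" \<phi>]
        by (simp add: block_row_regressor G_def[abs_def])
      have mean_G: "avg (\<lambda>t. \<integral>e. G (p t + e) \<partial>noise \<epsilon>) \<longlonglongrightarrow> 0"
        using tendsto_diff[OF lim span[OF G]] unfolding G_def[symmetric] avg_z by simp
      have expand_G: "\<exists>R>\<epsilon> / 2. \<exists>c. box_expansion G (p t) R c" for t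
        using box_expansion_of_taylor_radius[OF taylor]
        by (intro residual_span_expansion[OF _ G]) metis
      have "avg (\<lambda>t. of_bool (\<exists>e. (\<forall>b\<in>Basis. \<bar>e \<bullet> b\<bar> \<le> \<epsilon> / 2) \<and> G (p t + e) \<noteq> 0)) \<longlonglongrightarrow> 0"
        by (rule sparse_nonvanishing[OF span_continuous[OF G] _ \<epsilon> data_bounded expand_G mean_G]) (simp add: G_def)
      then show ?thesis
      proof (rule tendsto_0_dominated[rotated])
        fix T
        have "of_bool (?L t \<theta> \<noteq> 0) \<le> (of_bool (\<exists>e. (\<forall>b\<in>Basis. \<bar>e \<bullet> b\<bar> \<le> \<epsilon> / 2) \<and> G (p t + e) \<noteq> 0) :: real)" for t
        proof (cases "?L t \<theta> = 0")
          case False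
          then have "G (p t + (?z t \<omega> - p t)) \<noteq> 0" by (simp add: G_def)
          then have "\<exists>e. (\<forall>b\<in>Basis. \<bar>e \<bullet> b\<bar> \<le> \<epsilon> / 2) \<and> G (p t + e) \<noteq> 0" using z_bd by blast
          then show ?thesis by simp
        qed simp
        moreover have "0 \<le> avg (\<lambda>t. of_bool (?L t \<theta> \<noteq> 0)) T" by (rule avg_nonneg) simp
        ultimately show "\<bar>avg (\<lambda>t. of_bool (?L t \<theta> \<noteq> 0)) T\<bar>
            \<le> avg (\<lambda>t. of_bool (\<exists>e. (\<forall>b\<in>Basis. \<bar>e \<bullet> b\<bar> \<le> \<epsilon> / 2) \<and> G (p t + e) \<noteq> 0)) T"
          by (simp add: avg_mono)
      qed
    qed
    moreover have "avg (\<lambda>t. (norm (?y t - ?L t (est T \<omega>)))\<^sup>2) T \<le> avg (\<lambda>t. (norm (?y t - ?L t \<theta>))\<^sup>2) T" for T \<theta>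
      using est[of \<omega> T] elim unfolding minimizers_def is_arg_min_def cost res_eq
      by (auto simp: not_less split: prod.splits)
    ultimately show ?case
      unfolding Sol
      using least_squares_consistency[of ?L "K + c" ?y q "\<lambda>T. est T \<omega>", OF linear_predict] by blast
  qed
  show "Sol \<noteq> {}"
  proof
    \<comment> \<open>\<open>Sol\<close> is deterministic, so one sample point outside the null set
      suffices.\<close>
    assume "Sol = {}"
    with main have "AE \<omega> in P. False" by simp
    then show False by simp
  qed
  show "AE \<omega> in P. (\<lambda>T. infdist (est T \<omega>) Sol) \<longlonglongrightarrow> 0"
    using main by eventually_elim simp
qed

text \<open>Since the limiting problem may have several solutions, convergence to the solution means
  that the distance to the nonempty set of minimizers tends to 0. The matrices are quantified before
  the quantizer, the probability space and the dither, which expresses that they depend on the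
  resolution alone.\<close>

theorem theorem1:
  fixes M :: "(real^'n) set" and \<U> :: "(real^'m) set"
    and f :: "real^'n \<Rightarrow> real^'m \<Rightarrow> real^'n"
    and x :: "nat \<Rightarrow> real^'n" and u :: "nat \<Rightarrow> real^'m"
    and \<phi> :: "real^'n \<Rightarrow> real^'N"
    and \<AA> :: "(real^'N^'N) set" and \<BB> :: "(real^'m^'N) set"
  assumes "compact_manifold M"
    and "\<And>p v. p \<in> M \<Longrightarrow> v \<in> \<U> \<Longrightarrow> f p v \<in> M"
    and "\<And>t. x t \<in> M" and "\<And>t. u t \<in> \<U>"
    and "\<And>t. x (Suc t) = f (x t) (u t)"
    and "assumption1 \<phi> u"
    and "assumption2 \<phi> x u \<AA> \<BB>"
    and "assumption4 \<phi>"
  shows "\<exists>(\<beta> :: real \<Rightarrow> real^'N^('N + 'm)) (\<Gamma> :: real \<Rightarrow> real^('N + 'm)^('N + 'm)).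
    (\<lambda>\<epsilon>. norm (\<beta> \<epsilon>)) \<in> O[at_right 0](\<lambda>\<epsilon>. \<epsilon>\<^sup>2) \<and>
    (\<lambda>\<epsilon>. norm (\<Gamma> \<epsilon>)) \<in> O[at_right 0](\<lambda>\<epsilon>. \<epsilon>\<^sup>2) \<and>
    (\<forall>ymin ymax b (P :: 'w measure) wx wu
       (est :: nat \<Rightarrow> 'w \<Rightarrow> (real^'N^'N) \<times> (real^'m^'N)).
      let \<epsilon> = resolution ymin ymax b;
          xq = (\<lambda>t \<omega>. dither_quantize ymin ymax b (wx t \<omega>) (x t));
          uq = (\<lambda>t \<omega>. dither_quantize ymin ymax b (wu t \<omega>) (u t));
          Sol = minimizers (regularized_objective \<phi> x u (\<beta> \<epsilon>) (\<Gamma> \<epsilon>))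
      in ymin < ymax \<longrightarrow>
         assumption3 \<phi> M \<U> x u \<AA> \<BB> \<epsilon> \<longrightarrow>
         prob_space P \<longrightarrow>
         dither P \<epsilon> wx wu \<longrightarrow>
         no_saturation P ymin ymax x wx \<longrightarrow>
         no_saturation P ymin ymax u wu \<longrightarrow>
         expected_ls_cost_convergent P \<phi> xq uq \<AA> \<BB> \<longrightarrow>
         (\<forall>T. \<forall>\<omega>\<in>space P.
            est T \<omega> \<in> minimizers (\<lambda>(A, B). ls_cost \<phi> (\<lambda>t. xq t \<omega>) (\<lambda>t. uq t \<omega>) T A B)) \<longrightarrow>
         Sol \<noteq> {} \<and>
         (AE \<omega> in P. (\<lambda>T. infdist (est T \<omega>) Sol) \<longlonglongrightarrow> 0))"
proof -
  obtain K where K: "0 \<le> K" "\<And>v. norm (\<phi> v) \<le> K"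
    using assumption1_bounded[OF \<open>assumption1 \<phi> u\<close>] by blast
  have "bounded M" using \<open>compact_manifold M\<close> by (simp add: compact_manifold_def compact_imp_bounded)
  then have "bounded (M \<times> M \<times> range u)"
    using \<open>assumption1 \<phi> u\<close> by (intro bounded_Times) (auto simp: assumption1_def)
  then have bounded_data: "bounded (range (data_point x u))"
    by (rule bounded_subset) (use \<open>\<And>t. x t \<in> M\<close> in \<open>auto simp: data_point_def\<close>)
  interpret regression_data \<phi> x u K
  proof
    show "\<exists>L. (\<lambda>T. ereal (ls_cost \<phi> x u T A B)) \<longlonglongrightarrow> L" for A B
      using \<open>assumption2 \<phi> x u \<AA> \<BB>\<close> unfolding assumption2_def by blast
  qed (fact assumption4_continuous[OF \<open>assumption4 \<phi>\<close>] K bounded_data)+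
  \<comment> \<open>Limiting costs are finite for every pair, so the admissible set is everything
    and Assumption 3 becomes available for all matrices, as polarization requires.\<close>
  have "\<AA> \<times> \<BB> = {(A, B). lim (\<lambda>T. ereal (ls_cost \<phi> x u T A B)) < \<infinity>}"
    using \<open>assumption2 \<phi> x u \<AA> \<BB>\<close> unfolding assumption2_def by blast
  also have "\<dots> = UNIV" using lim_ls_cost_finite by auto
  finally have AB: "A \<in> \<AA>" "B \<in> \<BB>" for A B by blast+
  let ?a3 = "assumption3 \<phi> M \<U> x u \<AA> \<BB>"
  have taylor: "taylor_radius_gt (residual \<phi> A B) (data_point x u t) (\<epsilon> / 2)" if "?a3 \<epsilon>" for \<epsilon> A B t
    using that AB unfolding assumption3_def data_point_def by blast
  \<comment> \<open>The bias is of second order only where the Taylor expansions of Assumption 3 are available.\<close>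
  define \<beta> where "\<beta> \<epsilon> = (if ?a3 \<epsilon> then reg_linear \<epsilon> else 0)" for \<epsilon>
  define \<Gamma> where "\<Gamma> \<epsilon> = (if ?a3 \<epsilon> then reg_quadratic \<epsilon> else 0)" for \<epsilon>
  have entry: "(\<lambda>\<epsilon>. if ?a3 \<epsilon> then c * limit_bias \<epsilon> F else 0) \<in> O[at_right 0](\<lambda>\<epsilon>. \<epsilon>\<^sup>2)"
    if F: "F \<in> residual_span \<phi>" for c F
  proof (cases "\<exists>\<epsilon>0>0. ?a3 \<epsilon>0")
    case True
    then obtain \<epsilon>0 where "0 < \<epsilon>0" "?a3 \<epsilon>0" by blast
    have "(\<lambda>\<epsilon>. if ?a3 \<epsilon> then c * limit_bias \<epsilon> F else 0) \<in> O[at_right 0](\<lambda>\<epsilon>. limit_bias \<epsilon> F)"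
      by (rule bigoI[where c = "\<bar>c\<bar>"]) (auto simp: abs_mult)
    also have "(\<lambda>\<epsilon>. limit_bias \<epsilon> F) \<in> O[at_right 0](\<lambda>\<epsilon>. \<epsilon>\<^sup>2)"
      by (rule limit_bias_bigo[OF \<open>0 < \<epsilon>0\<close> taylor[OF \<open>?a3 \<epsilon>0\<close>] F])
    finally show ?thesis .
  next
    case False
    \<comment> \<open>At every positive resolution the default value 0 is taken, and the filter sees
      only those.\<close>
    then have "\<forall>\<^sub>F \<epsilon> in at_right 0. \<not> ?a3 \<epsilon>"
      by (auto simp: eventually_at_filter intro!: always_eventually)
    then show ?thesis
      by (intro bigoI[where c = 0]) (auto elim!: eventually_mono)
  qed
  have "(\<lambda>\<epsilon>. \<beta> \<epsilon> $ k $ i) \<in> O[at_right 0](\<lambda>\<epsilon>. \<epsilon>\<^sup>2)" for k i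
    using entry[OF residual_span_target_regressor[of \<phi> i k], of "- 2"]
    by (simp add: \<beta>_def reg_linear_def if_distrib[of "\<lambda>v. v $ _"] cong: if_cong)
  then have \<beta>: "(\<lambda>\<epsilon>. norm (\<beta> \<epsilon>)) \<in> O[at_right 0](\<lambda>\<epsilon>. \<epsilon>\<^sup>2)" by (rule matrix_bigo)
  have "(\<lambda>\<epsilon>. \<Gamma> \<epsilon> $ k $ l) \<in> O[at_right 0](\<lambda>\<epsilon>. \<epsilon>\<^sup>2)" for k l
    using entry[OF residual_span_regressor_regressor[of \<phi> k l], of 1]
    by (simp add: \<Gamma>_def reg_quadratic_def if_distrib[of "\<lambda>v. v $ _"] cong: if_cong)
  then have \<Gamma>: "(\<lambda>\<epsilon>. norm (\<Gamma> \<epsilon>)) \<in> O[at_right 0](\<lambda>\<epsilon>. \<epsilon>\<^sup>2)" by (rule matrix_bigo)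
  show ?thesis
  proof (intro exI[of _ \<beta>] exI[of _ \<Gamma>] conjI \<beta> \<Gamma> allI, unfold Let_def, intro impI)
    fix ymin ymax :: real and b and P :: "'w measure"
      and wx :: "nat \<Rightarrow> 'w \<Rightarrow> real^'n" and wu :: "nat \<Rightarrow> 'w \<Rightarrow> real^'m"
      and est :: "nat \<Rightarrow> 'w \<Rightarrow> (real^'N^'N) \<times> (real^'m^'N)"
    let ?\<epsilon> = "resolution ymin ymax b"
    let ?xq = "\<lambda>t \<omega>. dither_quantize ymin ymax b (wx t \<omega>) (x t)"
    let ?uq = "\<lambda>t \<omega>. dither_quantize ymin ymax b (wu t \<omega>) (u t)"
    assume y: "ymin < ymax" and a3: "?a3 ?\<epsilon>" and P: "prob_space P" and d: "dither P ?\<epsilon> wx wu"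
      and conv: "expected_ls_cost_convergent P \<phi> ?xq ?uq \<AA> \<BB>"
      and est: "\<forall>T. \<forall>\<omega>\<in>space P. est T \<omega> \<in> minimizers (\<lambda>(A, B). ls_cost \<phi> (\<lambda>t. ?xq t \<omega>) (\<lambda>t. ?uq t \<omega>) T A B)"
    have dd: "dithered_data P ymin ymax ?\<epsilon> b wx wu"
      using y P d by (simp add: dithered_data_def dithered_data_axioms_def resolution_def)
    have mean: "convergent (\<lambda>T. \<integral>\<omega>. ls_cost \<phi> (\<lambda>t. ?xq t \<omega>) (\<lambda>t. ?uq t \<omega>) T A B \<partial>P)" for A B
      using conv AB unfolding expected_ls_cost_convergent_def by blast
    note result = quantized_estimate_consistent[OF dd taylor[OF a3] mean est[rule_format]]
    show "minimizers (regularized_objective \<phi> x u (\<beta> ?\<epsilon>) (\<Gamma> ?\<epsilon>)) \<noteq> {} \<and>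
      (AE \<omega> in P. (\<lambda>T. infdist (est T \<omega>) (minimizers (regularized_objective \<phi> x u (\<beta> ?\<epsilon>) (\<Gamma> ?\<epsilon>)))) \<longlonglongrightarrow> 0)"
      using result a3 by (simp add: \<beta>_def \<Gamma>_def)
  qed
qed

end
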